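(* Let $p=n$ and let $\mathcal{A}$ and $\mathcal{B}$, defined with $G=\mathbb{R}^n$, satisfy the structural assumptions described in the context with constants $0<a_0\le a_1<\infty$ and $0<b_1<\infty$. Suppose that $u$ is a bounded solution of $-\nabla\cdot\mathcal{A}(x,u,\nabla u)+\mathcal{B}(x,u,\nabla u)=0$ in $\mathbb{R}^n$. Then $u$ is constant.
   Context: Let $n\ge 2$. $\mathcal{A}:\mathbb{R}^n\times\mathbb{R}\times\mathbb{R}^n\to\mathbb{R}^n$ and $\mathcal{B}:\mathbb{R}^n\times\mathbb{R}\times\mathbb{R}^n\to\mathbb{R}$ satisfy the Carathéodory condition: they are measurable in $x\in \mathbb{R}^n$ for every fixed $(t,h)\in\mathbb{R}\times\mathbb{R}^n$ and continuous in $(t,h)$ for almost every fixed $x$. Structural assumptions (with $p=n$): for all $(t,h)\in\mathbb{R}\times\mathbb{R}^n$ and almost every $x\in \mathbb{R}^n$, $$\mathcal{A}(x,t,h)\cdot h\ge a_0|h|^p,\qquad |\mathcal{A}(x,t,h)|\le a_1|h|^{p-1},\qquad |\mathcal{B}(x,t,h)|\le g(x)|h|^{p-1},$$ where $g(x)=b_1$ if $|x|\le 1$ and $g(x)=b_1/|x|$ if $|x|>1$. A function $u\in W^{1,p}_{\rm loc}(\mathbb{R}^n)$ is a solution of the equation in $\mathbb{R}^n$ if for every relatively compact open $D\subset \mathbb{R}^n$ and every $\eta\in W^{1,p}_0(D)$, $$\int_D\mathcal{A}(x,u,\nabla u)\cdot\nabla\eta\,dx+\int_D\mathcal{B}(x,u,\nabla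 u)\,\eta\,dx=0.$$ As usual, Sobolev functions are identified when equal almost everywhere. *)

theory Defs
  imports "HOL-Analysis.Analysis"
begin

(* Classical gradient; meaningful where f is differentiable. *)
definition grad :: "('a::euclidean_space \<Rightarrow> real) \<Rightarrow> 'a \<Rightarrow> 'a" where
  "grad f x = (\<Sum>b\<in>Basis. frechet_derivative f (at x) b *\<^sub>R b)"

primrec C_k :: "nat \<Rightarrow> ('a::euclidean_space \<Rightarrow> real) \<Rightarrow> bool" where
  "C_k 0 f \<longleftrightarrow> continuous_on UNIV f"
| "C_k (Suc k) f \<longleftrightarrow>
     (\<forall>x. f differentiable (at x)) \<and>
     (\<forall>b\<in>Basis. C_k k (\<lambda>x. frechet_derivative f (at x) b))"

(* Smooth functions with compact support in D, extended by zero to the whole space. *)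
definition test_functions :: "'a::euclidean_space set \<Rightarrow> ('a \<Rightarrow> real) set" where
  "test_functions D =
     {\<phi>. (\<forall>k. C_k k \<phi>) \<and> compact (closure {x. \<phi> x \<noteq> 0}) \<and> closure {x. \<phi> x \<noteq> 0} \<subseteq> D}"

definition locally_integrable_on ::
    "('a::euclidean_space \<Rightarrow> 'b::euclidean_space) \<Rightarrow> 'a set \<Rightarrow> bool"
    (infix \<open>locally'_integrable'_on\<close> 50) where
  "f locally_integrable_on D \<longleftrightarrow> (\<forall>K. compact K \<and> K \<subseteq> D \<longrightarrow> f absolutely_integrable_on K)"

(* Sobolev functions are represented by actual functions on the whole space of which only the
   values on D matter. The weak gradient is a relation: G is determined only up to null sets. *)
definition has_weak_gradient ::
    "'a::euclidean_space set \<Rightarrow> ('a \<Rightarrow> real) \<Rightarrow> ('a \<Rightarrow> 'a) \<Rightarrow> bool" where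
  "has_weak_gradient D u G \<longleftrightarrow>
     u locally_integrable_on D \<and> G locally_integrable_on D \<and>
     (\<forall>\<phi>\<in>test_functions D. \<forall>b\<in>Basis.
        (LINT x:D|lebesgue. u x * (grad \<phi> x \<bullet> b)) = - (LINT x:D|lebesgue. (G x \<bullet> b) * \<phi> x))"

definition Lp :: "real \<Rightarrow> 'a::euclidean_space set \<Rightarrow> ('a \<Rightarrow> 'b::euclidean_space) set" where
  "Lp p D = {f. set_borel_measurable lebesgue D f \<and>
                set_integrable lebesgue D (\<lambda>x. norm (f x) powr p)}"

definition relatively_compact_open_in :: "'a::euclidean_space set \<Rightarrow> 'a set \<Rightarrow> bool" where
  "relatively_compact_open_in \<Omega> D \<longleftrightarrow> open D \<and> compact (closure D) \<and> closure D \<subseteq> \<Omega>"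

definition Lp_loc :: "real \<Rightarrow> 'a::euclidean_space set \<Rightarrow> ('a \<Rightarrow> 'b::euclidean_space) set" where
  "Lp_loc p \<Omega> = {f. \<forall>D. relatively_compact_open_in \<Omega> D \<longrightarrow> f \<in> Lp p D}"

definition W1p_loc :: "real \<Rightarrow> 'a::euclidean_space set \<Rightarrow> ('a \<Rightarrow> real) set" where
  "W1p_loc p \<Omega> = {u \<in> Lp_loc p \<Omega>. \<exists>G\<in>Lp_loc p \<Omega>. has_weak_gradient \<Omega> u G}"

(* Closure of the test functions in the norm of W^{1,p}(D). *)
definition W1p_0 :: "real \<Rightarrow> 'a::euclidean_space set \<Rightarrow> ('a \<Rightarrow> real) set" where
  "W1p_0 p D = {\<eta> \<in> Lp p D. \<exists>H\<in>Lp p D. has_weak_gradient D \<eta> H \<and>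
     (\<exists>\<phi>. (\<forall>k::nat. \<phi> k \<in> test_functions D) \<and>
        (\<lambda>k. LINT x:D|lebesgue. norm (\<eta> x - \<phi> k x) powr p) \<longlonglongrightarrow> 0 \<and>
        (\<lambda>k. LINT x:D|lebesgue. norm (H x - grad (\<phi> k) x) powr p) \<longlonglongrightarrow> 0)}"

definition caratheodory ::
    "('a::euclidean_space \<Rightarrow> real \<Rightarrow> 'a \<Rightarrow> 'b::euclidean_space) \<Rightarrow> bool" where
  "caratheodory F \<longleftrightarrow>
     (\<forall>t h. (\<lambda>x. F x t h) \<in> borel_measurable lebesgue) \<and>
     (AE x in lebesgue. continuous_on UNIV (\<lambda>(t, h). F x t h))"

definition decay :: "real \<Rightarrow> 'a::euclidean_space \<Rightarrow> real" where
  "decay b\<^sub>1 x = (if norm x \<le> 1 then b\<^sub>1 else b\<^sub>1 / norm x)"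

definition structural_assumptions ::
    "real \<Rightarrow> real \<Rightarrow> real \<Rightarrow> real \<Rightarrow> ('a::euclidean_space \<Rightarrow> real \<Rightarrow> 'a \<Rightarrow> 'a) \<Rightarrow>
     ('a \<Rightarrow> real \<Rightarrow> 'a \<Rightarrow> real) \<Rightarrow> bool" where
  "structural_assumptions p a\<^sub>0 a\<^sub>1 b\<^sub>1 A B \<longleftrightarrow>
     (\<forall>t h. AE x in lebesgue.
        A x t h \<bullet> h \<ge> a\<^sub>0 * norm h powr p \<and>
        norm (A x t h) \<le> a\<^sub>1 * norm h powr (p - 1) \<and>
        \<bar>B x t h\<bar> \<le> decay b\<^sub>1 x * norm h powr (p - 1))"

(* Weak solution in the whole space of - div A(x,u,grad u) + B(x,u,grad u) = 0.
   G and H range over all representatives of the weak gradients of u and \<eta>; these exist by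
   membership in the Sobolev spaces, and the integrals do not depend on the choice. *)
definition is_solution ::
    "real \<Rightarrow> ('a::euclidean_space \<Rightarrow> real \<Rightarrow> 'a \<Rightarrow> 'a) \<Rightarrow> ('a \<Rightarrow> real \<Rightarrow> 'a \<Rightarrow> real) \<Rightarrow>
     ('a \<Rightarrow> real) \<Rightarrow> bool" where
  "is_solution p A B u \<longleftrightarrow> u \<in> W1p_loc p UNIV \<and>
     (\<forall>G. has_weak_gradient UNIV u G \<longrightarrow>
       (\<forall>D \<eta> H. relatively_compact_open_in UNIV D \<and> \<eta> \<in> W1p_0 p D \<and> has_weak_gradient D \<eta> H \<longrightarrow>
          (LINT x:D|lebesgue. A x (u x) (G x) \<bullet> H x) +
          (LINT x:D|lebesgue. B x (u x) (G x) * \<eta> x) = 0))"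

end

theory Submission
  imports Defs
begin

text \<open>Let \<open>m\<close> be the essential infimum of \<open>u\<close> and \<open>v = u - m\<close>. Testing the equation with
  \<open>\<eta> ^ n * (v + \<epsilon>) powr (1 - n)\<close>, where \<open>\<eta>\<close> is a cut-off function, bounds the \<open>n\<close>-energy of
  \<open>ln (v + \<epsilon>)\<close> on the annuli between the cubes of side \<open>2 R\<close> and \<open>4 R\<close>, independently of \<open>R\<close> and
  \<open>\<epsilon>\<close>: both the \<open>n\<close>-energy and the \<open>L ^ n\<close> norm of the drift coefficient \<open>b1 / norm x\<close> are invariant
  under scaling. Since \<open>n\<close> exceeds the dimension \<open>n - 1\<close> of the faces, Morrey's inequality yields a cube
  boundary in the annulus on which \<open>ln (v + \<epsilon>)\<close> oscillates by at most a constant. By the weak maximum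
  principle for \<open>u\<close> and \<open>- u\<close> the same holds inside the cube, so that \<open>sup v + \<epsilon> \<le> C * (inf v + \<epsilon>)\<close>
  on cubes of every size with the same \<open>C\<close>. Now let \<open>R\<close> tend to infinity and then \<open>\<epsilon>\<close> to zero.

  Boundary values never occur: all estimates are made for smooth approximations of \<open>u\<close> which converge
  almost everywhere, with dominated gradients, and the equation is only tested with smooth functions.\<close>

section \<open>Smooth functions\<close>

text \<open>The obstacle is the maximum principle in the presence of \<open>B\<close>. Testing with
  the positive part of u - d only bounds its n-energy by a multiple of its L^n integral, with a
  factor that is not small on large cubes. Letting d rise to the top level does not help at once,
  because the set where u attains its essential supremum might have positive measure. The way out is
  a family of truncations. For every q >= 1 and every level d at least the boundary bound and at
  most 1/2 below the top, exp(-q / (u - d)), extended by zero, satisfies an energy inequality with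
  the constant (2 b1 / a0)^n, free of q and d. Large q isolates the top level set and shows that it
  is null; then d close to the top gives small support. In both steps estimates of translates take
  the place of Sobolev and Poincare inequalities. The profiles exp(-a / t) / t^j are smooth across t
  = 0, so a truncation above a strict boundary bound is itself a smooth test function. Cubes are
  preferred to balls because a flat face is reached by overwriting one coordinate, and no surface
  measure appears.\<close>

lemma has_derivative_grad:
  assumes "f differentiable (at x)"
  shows "(f has_derivative (\<lambda>h. grad f x \<bullet> h)) (at x)"
proof -
  let ?D = "frechet_derivative f (at x)"
  have D: "(f has_derivative ?D) (at x)" using assms frechet_derivative_works by blast
  then have lin: "linear ?D" using has_derivative_linear by blast
  have "grad f x \<bullet> h = ?D h" for h
  proof -
    have "?D h = ?D (\<Sum>b\<in>Basis. (h \<bullet> b) *\<^sub>R b)" by (simp add: euclidean_representation)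
    also have "\<dots> = (\<Sum>b\<in>Basis. (h \<bullet> b) * ?D b)"
      using lin by (simp add: linear_sum linear_cmul)
    also have "\<dots> = grad f x \<bullet> h"
      unfolding grad_def by (simp add: inner_sum_left inner_commute[of _ h] inner_sum_right mult.commute)
    finally show ?thesis by simp
  qed
  then have "(\<lambda>h. grad f x \<bullet> h) = ?D" by auto
  with D show ?thesis by simp
qed

lemma grad_eqI:
  assumes "(f has_derivative (\<lambda>h. g \<bullet> h)) (at x)"
  shows "grad f x = g"
proof -
  have "frechet_derivative f (at x) = (\<lambda>h. g \<bullet> h)"
    using frechet_derivative_at[OF assms] by simp
  then show ?thesis unfolding grad_def by (simp add: euclidean_representation)
qed

lemma frechet_eq_grad:
  assumes "f differentiable (at x)"
  shows "frechet_derivative f (at x) h = grad f x \<bullet> h"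
  using frechet_derivative_at[OF has_derivative_grad[OF assms]] by (metis)

text \<open>\<open>C_k\<close> is phrased through \<open>frechet_derivative\<close>; uniqueness of
  derivatives lets an explicit gradient field stand in for it. The closure properties below are
  obtained in this way.\<close>

lemma C_k_SucI:
  assumes "\<And>x. (f has_derivative (\<lambda>h. g x \<bullet> h)) (at x)"
    and "\<And>b. b \<in> Basis \<Longrightarrow> C_k k (\<lambda>x. g x \<bullet> b)"
  shows "C_k (Suc k) f"
proof -
  have "frechet_derivative f (at x) = (\<lambda>h. g x \<bullet> h)" for x
    using frechet_derivative_at[OF assms(1)] by simp
  then show ?thesis using assms unfolding C_k.simps differentiable_def by auto
qed

lemma C_k_SucD:
  assumes "C_k (Suc k) f"
  shows "f differentiable (at x)"
    and "(f has_derivative (\<lambda>h. grad f x \<bullet> h)) (at x)"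
    and "b \<in> Basis \<Longrightarrow> C_k k (\<lambda>x. grad f x \<bullet> b)"
proof -
  have d: "\<And>x. f differentiable (at x)" using assms by simp
  then show "f differentiable (at x)" "(f has_derivative (\<lambda>h. grad f x \<bullet> h)) (at x)"
    by (auto intro: has_derivative_grad)
  assume "b \<in> Basis"
  then have "C_k k (\<lambda>x. frechet_derivative f (at x) b)" using assms by simp
  then show "C_k k (\<lambda>x. grad f x \<bullet> b)" using frechet_eq_grad[OF d] by simp
qed

lemma C_k_lower: "C_k (Suc k) f \<Longrightarrow> C_k k f"
proof (induction k arbitrary: f)
  case 0
  then have "\<And>x. f differentiable (at x)" by simp
  then show ?case by (simp add: differentiable_imp_continuous_on differentiable_on_def)
next
  case (Suc k)
  then show ?case by (metis C_k.simps(2))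
qed

lemma C_k_continuous: "C_k k f \<Longrightarrow> continuous_on UNIV f"
  by (induction k) (auto dest: C_k_lower simp del: C_k.simps(2))

lemma C_k_const [simp]: "C_k k (\<lambda>x::'a::euclidean_space. c)"
proof (induction k arbitrary: c)
  case (Suc k)
  show ?case by (rule C_k_SucI[where g="\<lambda>_. 0"]) (auto simp: Suc)
qed auto

lemma C_k_inner [simp]: "C_k k (\<lambda>x::'a::euclidean_space. x \<bullet> v)"
proof (cases k)
  case (Suc m)
  show ?thesis unfolding Suc
    by (rule C_k_SucI[where g="\<lambda>_. v"]) (auto intro!: derivative_eq_intros simp: inner_commute)
qed (auto intro: continuous_intros)

lemma C_k_add: "C_k k f \<Longrightarrow> C_k k g \<Longrightarrow> C_k k (\<lambda>x. f x + g x)"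
proof (induction k arbitrary: f g)
  case (Suc k)
  have "C_k k (\<lambda>x. (grad f x \<bullet> b) + (grad g x \<bullet> b))" if "b \<in> Basis" for b
    using Suc that by (intro Suc.IH C_k_SucD)
  then show ?case
    by (intro C_k_SucI[where g="\<lambda>x. grad f x + grad g x"])
      (use Suc(2,3) C_k_SucD in \<open>auto intro!: derivative_eq_intros simp del: C_k.simps(2) simp: inner_add_left\<close>)
qed (auto intro: continuous_intros)

lemma C_k_mult: "C_k k f \<Longrightarrow> C_k k g \<Longrightarrow> C_k k (\<lambda>x. f x * g x)"
proof (induction k arbitrary: f g)
  case (Suc k)
  have "C_k k (\<lambda>x. g x * (grad f x \<bullet> b) + f x * (grad g x \<bullet> b))" if "b \<in> Basis" for b
    using Suc that by (intro C_k_add Suc.IH C_k_SucD) (auto intro: C_k_lower simp del: C_k.simps)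
  then show ?case
    by (intro C_k_SucI[where g="\<lambda>x. g x *\<^sub>R grad f x + f x *\<^sub>R grad g x"])
      (use Suc(2,3) C_k_SucD in \<open>auto intro!: derivative_eq_intros simp del: C_k.simps(2) simp: inner_add_left algebra_simps\<close>)
qed (auto intro: continuous_intros)

definition smooth :: "('a::euclidean_space \<Rightarrow> real) \<Rightarrow> bool" where
  "smooth f \<longleftrightarrow> (\<forall>k. C_k k f)"

named_theorems smooth_intros

lemma smooth_const [smooth_intros]: "smooth (\<lambda>x. c)" by (simp add: smooth_def)
lemma smooth_inner [smooth_intros]: "smooth (\<lambda>x. x \<bullet> v)" by (simp add: smooth_def)
lemma smooth_add [smooth_intros]: "smooth f \<Longrightarrow> smooth g \<Longrightarrow> smooth (\<lambda>x. f x + g x)"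
  by (simp add: smooth_def C_k_add)
lemma smooth_mult [smooth_intros]: "smooth f \<Longrightarrow> smooth g \<Longrightarrow> smooth (\<lambda>x. f x * g x)"
  by (simp add: smooth_def C_k_mult)
lemma smooth_minus [smooth_intros]: "smooth f \<Longrightarrow> smooth (\<lambda>x. - f x)"
  using smooth_mult[OF smooth_const[of "-1"], of f] by simp
lemma smooth_diff [smooth_intros]: "smooth f \<Longrightarrow> smooth g \<Longrightarrow> smooth (\<lambda>x. f x - g x)"
  using smooth_add[OF _ smooth_minus, of f g] by simp
lemma smooth_power [smooth_intros]: "smooth f \<Longrightarrow> smooth (\<lambda>x. f x ^ k)"
  by (induction k) (auto intro: smooth_intros)
lemma smooth_sum [smooth_intros]: "(\<And>i. i \<in> I \<Longrightarrow> smooth (f i)) \<Longrightarrow> smooth (\<lambda>x. \<Sum>i\<in>I. f i x)"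
  by (induction I rule: infinite_finite_induct) (auto intro: smooth_intros)
lemma smooth_norm_sq [smooth_intros]: "smooth (\<lambda>x. x \<bullet> x)"
  by (subst euclidean_inner) (auto intro!: smooth_intros)

lemma smooth_has_derivative:
  "smooth f \<Longrightarrow> (f has_derivative (\<lambda>h. grad f x \<bullet> h)) (at x)"
  unfolding smooth_def by (metis C_k_SucD(2))

lemma smooth_continuous: "smooth f \<Longrightarrow> continuous_on UNIV f"
  unfolding smooth_def using C_k_continuous by blast

lemma smooth_grad: "smooth f \<Longrightarrow> b \<in> Basis \<Longrightarrow> smooth (\<lambda>x. grad f x \<bullet> b)"
  unfolding smooth_def using C_k_SucD(3) by blast

lemma smooth_continuous_grad:
  assumes "smooth f" shows "continuous_on UNIV (grad f)"
proof -
  have "continuous_on UNIV (\<lambda>x. \<Sum>b\<in>Basis. (grad f x \<bullet> b) *\<^sub>R b)"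
    by (intro continuous_intros smooth_continuous smooth_grad assms)
  then show ?thesis by (simp add: euclidean_representation)
qed

text \<open>Derivatives only see a neighbourhood: near each point the gradient of \<open>f\<close>
  is the gradient of the local model, so the induction hypothesis applies to its components. This is
  for functions defined by cases on the two sides of a cube boundary.\<close>

lemma C_k_local:
  assumes "\<And>x. \<exists>N g. open N \<and> x \<in> N \<and> C_k k g \<and> (\<forall>y\<in>N. f y = g y)"
  shows "C_k k f"
  using assms
proof (induction k arbitrary: f)
  case 0
  have "isCont f x" for x
  proof -
    obtain N g where N: "open N" "x \<in> N" "C_k 0 g" "\<forall>y\<in>N. f y = g y" using 0 by blast
    then have "isCont g x" by (simp add: continuous_on_eq_continuous_at)
    moreover have "eventually (\<lambda>y. f y = g y) (nhds x)"
      using N eventually_nhds by blast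
    ultimately show ?thesis using isCont_cong by blast
  qed
  then show ?case by (simp add: continuous_at_imp_continuous_on)
next
  case (Suc k)
  have loc: "\<exists>N g. open N \<and> x \<in> N \<and> C_k (Suc k) g \<and> (\<forall>y\<in>N. f y = g y \<and> (f has_derivative (\<lambda>h. grad g y \<bullet> h)) (at y))" for x
  proof -
    obtain N g where N: "open N" "x \<in> N" "C_k (Suc k) g" "\<forall>y\<in>N. f y = g y" using Suc(2) by blast
    have "(f has_derivative (\<lambda>h. grad g y \<bullet> h)) (at y)" if "y \<in> N" for y
      using has_derivative_transform_within_open[OF C_k_SucD(2)[OF N(3)] N(1) that] N(4) by metis
    then show ?thesis using N by blast
  qed
  have dif: "f differentiable (at x)" for x using loc[of x] differentiable_def by blast
  show ?case
  proof (rule C_k_SucI[where g="grad f"])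
    show "(f has_derivative (\<bullet>) (grad f x)) (at x)" for x using has_derivative_grad[OF dif] by simp
    fix b :: 'a assume b: "b \<in> Basis"
    show "C_k k (\<lambda>x. grad f x \<bullet> b)"
    proof (rule Suc.IH)
      fix x
      obtain N g where N: "open N" "x \<in> N" "C_k (Suc k) g"
        "\<forall>y\<in>N. f y = g y \<and> (f has_derivative (\<lambda>h. grad g y \<bullet> h)) (at y)" using loc by blast
      then have "\<forall>y\<in>N. grad f y \<bullet> b = grad g y \<bullet> b" using grad_eqI by metis
      then show "\<exists>N g. open N \<and> x \<in> N \<and> C_k k g \<and> (\<forall>y\<in>N. grad f y \<bullet> b = g y)"
        using N C_k_SucD(3)[OF N(3) b] by blast
    qed
  qed
qed

text \<open>The gradient of 1/f is -(1/f)^2 grad f, which involves 1/f at one order less and the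
  smooth gradient of f.\<close>

lemma smooth_inverse [smooth_intros]:
  assumes f: "smooth f" and nz: "\<And>x. f x \<noteq> 0"
  shows "smooth (\<lambda>x. inverse (f x))"
proof -
  have "C_k k (\<lambda>x. inverse (f x))" for k
  proof (induction k)
    case 0
    show ?case using smooth_continuous[OF f] nz by (auto intro!: continuous_intros)
  next
    case (Suc k)
    have c: "C_k k (\<lambda>x. - (inverse (f x) * inverse (f x) * (grad f x \<bullet> b)))" if "b \<in> Basis" for b
      using C_k_mult[OF C_k_const[of k "-1"] C_k_mult[OF C_k_mult[OF Suc Suc]]] smooth_grad[OF f that]
      unfolding smooth_def by simp
    have d: "((\<lambda>x. inverse (f x)) has_derivative (\<lambda>h. (- (inverse (f x) * inverse (f x)) *\<^sub>R grad f x) \<bullet> h)) (at x)" for x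
      using Deriv.has_derivative_inverse[OF nz smooth_has_derivative[OF f, of x]]
      by (rule has_derivative_eq_rhs) (auto simp: algebra_simps)
    show ?case by (rule C_k_SucI[OF d]) (use c in auto)
  qed
  then show ?thesis by (simp add: smooth_def)
qed

lemma smooth_ln [smooth_intros]:
  assumes f: "smooth f" and pos: "\<And>x. f x > 0"
  shows "smooth (\<lambda>x. ln (f x))"
proof -
  have nz: "\<And>x. f x \<noteq> 0" using pos by (metis less_irrefl)
  have "C_k k (\<lambda>x. ln (f x))" for k
  proof (cases k)
    case 0
    then show ?thesis using smooth_continuous[OF f] nz by (auto intro!: continuous_intros)
  next
    case (Suc m)
    have d: "((\<lambda>x. ln (f x)) has_derivative (\<lambda>h. (inverse (f x) *\<^sub>R grad f x) \<bullet> h)) (at x)" for x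
      using has_derivative_ln[OF pos smooth_has_derivative[OF f, of x]]
      by (rule has_derivative_eq_rhs) (auto simp: algebra_simps)
    show ?thesis unfolding Suc
      by (rule C_k_SucI[OF d]) (use smooth_mult[OF smooth_inverse[OF f nz] smooth_grad[OF f]] in \<open>auto simp: smooth_def\<close>)
  qed
  then show ?thesis by (simp add: smooth_def)
qed

text \<open>The division by t^j makes the family closed under differentiation: the derivative
  combines \<open>flat a (j + 2)\<close> and \<open>flat a (j + 1)\<close>, so one induction over
  all j gives smoothness. Besides mollifiers and cut-offs, these functions serve as smooth
  truncations of u - d, whose powers and products stay inside the family.\<close>

definition flat :: "real \<Rightarrow> nat \<Rightarrow> real \<Rightarrow> real" where
  "flat a j t = (if t > 0 then exp (- (a / t)) / t ^ j else 0)"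

lemma flat_nonneg: "flat a j t \<ge> 0" by (simp add: flat_def)
lemma flat_pos: "t > 0 \<Longrightarrow> flat a j t > 0" by (simp add: flat_def)
lemma flat_eq_0: "t \<le> 0 \<Longrightarrow> flat a j t = 0" by (simp add: flat_def)

text \<open>The inequality x <= exp x at x = a / (t m), raised to the power m = j + 2, gives
  exp(-a/t) <= (m t / a)^m, and dividing by t^j leaves t^2. The square makes the derivative at 0
  vanish and also yields bounds on bounded intervals.\<close>

lemma flat_le_square:
  assumes a: "a > 0"
  shows "flat a j t \<le> (real (j + 2) / a) ^ (j + 2) * t\<^sup>2"
proof (cases "t > 0")
  case True
  define m where "m = j + 2"
  have m: "m > 0" by (simp add: m_def)
  have "a / t / m \<le> exp (a / t / m)" using exp_ge_add_one_self[of "a / t / m"] by linarith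
  then have "(a / t / m) ^ m \<le> exp (a / t / m) ^ m"
    by (rule power_mono) (use a True in simp)
  also have "\<dots> = exp (a / t)" using m by (simp flip: exp_of_nat_mult)
  finally have e: "(a / t / m) ^ m \<le> exp (a / t)" .
  have p: "(a / t / m) ^ m > 0" using a True m by simp
  have "exp (- (a / t)) \<le> inverse ((a / t / m) ^ m)"
    unfolding exp_minus using e p by (rule le_imp_inverse_le)
  also have "\<dots> = (m / a) ^ m * t ^ m"
    using a True m by (simp add: field_simps flip: power_mult_distrib power_inverse)
  finally have "exp (- (a / t)) / t ^ j \<le> (m / a) ^ m * t ^ m / t ^ j"
    using True by (intro divide_right_mono) auto
  also have "\<dots> = (m / a) ^ m * t\<^sup>2" using True by (simp add: m_def power_add power2_eq_square)
  finally show ?thesis using True by (simp add: flat_def m_def)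
next
  case False
  then show ?thesis using a by (simp add: flat_def)
qed

lemma flat_has_derivative:
  assumes a: "a > 0"
  shows "(flat a j has_real_derivative (a * flat a (j + 2) t - real j * flat a (j + 1) t)) (at t)"
proof -
  consider "t > 0" | "t < 0" | "t = 0" by linarith
  then show ?thesis
  proof cases
    case 1
    have "((\<lambda>t. exp (- (a / t)) / t ^ j) has_real_derivative (a * flat a (j + 2) t - real j * flat a (j + 1) t)) (at t)"
    proof (cases j)
      case 0
      then show ?thesis using 1
        by (auto intro!: derivative_eq_intros simp: flat_def power2_eq_square)
    next
      case (Suc i)
      show ?thesis unfolding flat_def using 1 Suc
        by (auto intro!: derivative_eq_intros simp: field_simps power_add power2_eq_square split: nat.splits) (cases i; simp)
    qed
    then show ?thesis
      by (rule has_field_derivative_transform_within_open[where S="{0<..}"]) (use 1 in \<open>auto simp: flat_def\<close>)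
  next
    case 2
    have "((\<lambda>t. 0) has_real_derivative 0) (at t)" by simp
    then have "(flat a j has_real_derivative 0) (at t)"
      by (rule has_field_derivative_transform_within_open[where S="{..<0}"]) (use 2 in \<open>auto simp: flat_def\<close>)
    then show ?thesis using 2 by (simp add: flat_def)
  next
    case 3
    define C where "C = (real (j + 2) / a) ^ (j + 2)"
    have "((\<lambda>h. flat a j h / h) \<longlongrightarrow> 0) (at 0)"
    proof (rule Lim_null_comparison)
      have "\<bar>flat a j h / h\<bar> \<le> C * \<bar>h\<bar>" for h
      proof (cases "h = 0")
        case False
        have "\<bar>flat a j h\<bar> \<le> C * (\<bar>h\<bar> * \<bar>h\<bar>)"
          using flat_le_square[OF a, of j h] flat_nonneg[of a j h] by (simp add: C_def power2_eq_square)
        then show ?thesis using False by (simp add: field_simps)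
      qed auto
      then show "\<forall>\<^sub>F h in at 0. norm (flat a j h / h) \<le> C * \<bar>h\<bar>" by simp
      show "((\<lambda>h. C * \<bar>h\<bar>) \<longlongrightarrow> 0) (at 0)" by (auto intro!: tendsto_eq_intros)
    qed
    then have "(flat a j has_real_derivative 0) (at 0)"
      by (simp add: has_field_derivative_iff flat_eq_0)
    then show ?thesis using 3 by (simp add: flat_eq_0)
  qed
qed

lemma continuous_flat: "a > 0 \<Longrightarrow> isCont (flat a j) t"
  using flat_has_derivative DERIV_isCont by blast

lemma smooth_flat [smooth_intros]:
  assumes a: "a > 0" and f: "smooth f"
  shows "smooth (\<lambda>x. flat a j (f x))"
proof -
  have "C_k k (\<lambda>x. flat a j (f x))" for k
  proof (induction k arbitrary: j)
    case 0
    show ?case using smooth_continuous[OF f] continuous_flat[OF a]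
      by (auto intro!: continuous_on_compose2[of UNIV "flat a j" UNIV f] simp: continuous_at_imp_continuous_on)
  next
    case (Suc k)
    let ?D = "\<lambda>x. a * flat a (j + 2) (f x) - real j * flat a (j + 1) (f x)"
    have d: "((\<lambda>x. flat a j (f x)) has_derivative (\<lambda>h. (?D x *\<^sub>R grad f x) \<bullet> h)) (at x)" for x
      using has_derivative_compose[OF smooth_has_derivative[OF f, of x],
          of "flat a j" "\<lambda>h. ?D x * h"] flat_has_derivative[OF a, of j "f x"]
      by (auto simp: has_field_derivative_def)
    have c: "C_k k ?D"
      using C_k_add[OF C_k_mult[OF C_k_const[of k a] Suc] C_k_mult[OF C_k_const[of k "- real j"] Suc], of "j+2" "j+1"]
      by simp
    show ?case
      by (rule C_k_SucI[OF d]) (use C_k_mult[OF c] smooth_grad[OF f] in \<open>auto simp: smooth_def simp del: C_k.simps\<close>)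
  qed
  then show ?thesis by (simp add: smooth_def)
qed

lemma smooth_local:
  assumes "\<And>x. \<exists>N g. open N \<and> x \<in> N \<and> smooth g \<and> (\<forall>y\<in>N. f y = g y)"
  shows "smooth f"
  unfolding smooth_def by (intro allI C_k_local) (meson assms smooth_def)

text \<open>There are three local models: \<open>g\<close> inside, zero outside, and zero on
  \<open>V\<close>, where \<open>g\<close> itself vanishes. This is what replaces a theory of
  boundary values: a function that already vanishes near the boundary of a cube may be cut off
  there.\<close>

lemma smooth_cut_off_at_frontier:
  assumes g: "smooth g" and V: "open V" "frontier U \<subseteq> V" "\<And>y. y \<in> V \<Longrightarrow> g y = 0"
  shows "smooth (\<lambda>x. if x \<in> U then g x else 0)"
proof (rule smooth_local)
  fix x
  consider "x \<in> interior U" | "x \<in> - closure U" | "x \<in> frontier U" by (auto simp: frontier_def)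
  then show "\<exists>N h. open N \<and> x \<in> N \<and> smooth h \<and> (\<forall>y\<in>N. (if y \<in> U then g y else 0) = h y)"
  proof cases
    case 1
    then show ?thesis using g interior_subset
      by (intro exI[of _ "interior U"] exI[of _ g]) auto
  next
    case 2
    then show ?thesis using closure_subset
      by (intro exI[of _ "- closure U"] exI[of _ "\<lambda>_. 0"]) (auto simp: smooth_const)
  next
    case 3
    then show ?thesis using V
      by (intro exI[of _ V] exI[of _ "\<lambda>_. 0"]) (auto simp: smooth_const)
  qed
qed

section \<open>Mollification\<close>

lemma nn_integral_translate:
  fixes f :: "'a::euclidean_space \<Rightarrow> ennreal"
  assumes [measurable]: "f \<in> borel_measurable borel"
  shows "(\<integral>\<^sup>+x. f (c + x) \<partial>lborel) = (\<integral>\<^sup>+x. f x \<partial>lborel)"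
proof -
  have "(\<integral>\<^sup>+x. f x \<partial>lborel) = (\<integral>\<^sup>+x. f x \<partial>(distr lborel borel ((+) c)))"
    by (simp add: lborel_distr_plus)
  also have "\<dots> = (\<integral>\<^sup>+x. f (c + x) \<partial>lborel)" by (subst nn_integral_distr) auto
  finally show ?thesis by simp
qed

lemma bounded_support_integrable:
  fixes f :: "'a::euclidean_space \<Rightarrow> 'b::{banach, second_countable_topology}"
  assumes "f \<in> borel_measurable borel" "\<And>x. norm (f x) \<le> C" "\<And>x. norm x > R \<Longrightarrow> f x = 0"
  shows "integrable lborel f"
  by (rule integrableI_bounded_set[where A="cball 0 R" and B=C])
    (use assms emeasure_lborel_cball_finite[of 0 R] in auto)

lemma integrable_mult_bounded_real:
  fixes f g :: "'a \<Rightarrow> real"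
  assumes f: "integrable M f" and g: "g \<in> borel_measurable M" "\<And>x. \<bar>g x\<bar> \<le> C"
  shows "integrable M (\<lambda>x. f x * g x)"
proof (rule Bochner_Integration.integrable_bound)
  show "integrable M (\<lambda>x. C * f x)" using f by simp
  show "AE x in M. norm (f x * g x) \<le> norm (C * f x)"
  proof (rule AE_I2)
    fix x
    have "\<bar>f x\<bar> * \<bar>g x\<bar> \<le> \<bar>f x\<bar> * \<bar>C\<bar>" using g(2)[of x] by (intro mult_left_mono) auto
    then show "norm (f x * g x) \<le> norm (C * f x)" by (simp add: abs_mult mult.commute)
  qed
qed (use f g in measurable)

text \<open>The tangent at A lies below the convex function t^n; for A > 0 this is Bernoulli's
  inequality for a / A - 1, scaled by A^n.\<close>

lemma power_tangent:
  fixes a A :: real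
  assumes "a \<ge> 0" "A \<ge> 0"
  shows "A ^ n + real n * A ^ (n - 1) * (a - A) \<le> a ^ n"
proof (cases "A = 0")
  case True
  consider "n = 0" | "n = 1" | "n \<ge> 2" by linarith
  then show ?thesis using True assms by cases (auto simp: power_0_left)
next
  case False
  then have A: "A > 0" using assms by simp
  show ?thesis
  proof (cases n)
    case (Suc m)
    have "1 + real n * (a / A - 1) \<le> (1 + (a / A - 1)) ^ n"
      by (rule Bernoulli_inequality) (use assms A in simp)
    then have "A ^ n * (1 + real n * (a / A - 1)) \<le> A ^ n * (a / A) ^ n"
      using A by (intro mult_left_mono) auto
    also have "\<dots> = a ^ n" using A by (simp add: power_divide)
    also have "A ^ n * (1 + real n * (a / A - 1)) = A ^ n + real n * A ^ (n - 1) * (a - A)"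
      using A by (simp add: Suc field_simps)
    finally show ?thesis .
  qed simp
qed

text \<open>Take the tangent inequality at the mean A of |g| and integrate it against the
  probability density: the linear term drops out.\<close>

lemma jensen_power:
  fixes g \<rho> :: "'a \<Rightarrow> real"
  assumes \<rho>: "integrable M \<rho>" "\<And>x. \<rho> x \<ge> 0" "(\<integral>x. \<rho> x \<partial>M) = 1"
    and g: "integrable M (\<lambda>x. g x * \<rho> x)" and gn: "integrable M (\<lambda>x. \<bar>g x\<bar> ^ n * \<rho> x)"
  shows "\<bar>\<integral>x. g x * \<rho> x \<partial>M\<bar> ^ n \<le> (\<integral>x. \<bar>g x\<bar> ^ n * \<rho> x \<partial>M)"
proof -
  define A where "A = (\<integral>x. \<bar>g x\<bar> * \<rho> x \<partial>M)"
  have ga: "integrable M (\<lambda>x. \<bar>g x\<bar> * \<rho> x)"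
    using integrable_abs[OF g] \<rho>(2) by (simp add: abs_mult)
  have A0: "A \<ge> 0" unfolding A_def using \<rho> by (intro integral_nonneg_AE) auto
  have "\<bar>\<integral>x. g x * \<rho> x \<partial>M\<bar> \<le> (\<integral>x. \<bar>g x * \<rho> x\<bar> \<partial>M)" by (rule integral_abs_bound)
  also have "\<dots> = A" unfolding A_def using \<rho>(2) by (simp add: abs_mult)
  finally have "\<bar>\<integral>x. g x * \<rho> x \<partial>M\<bar> ^ n \<le> A ^ n" by (intro power_mono) auto
  also have "A ^ n = (\<integral>x. (A ^ n - real n * A ^ (n - 1) * A) * \<rho> x + real n * A ^ (n - 1) * (\<bar>g x\<bar> * \<rho> x) \<partial>M)"
    using \<rho> ga by (simp add: A_def[symmetric])
  also have "\<dots> \<le> (\<integral>x. \<bar>g x\<bar> ^ n * \<rho> x \<partial>M)"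
  proof (rule integral_mono)
    fix x
    have "(A ^ n + real n * A ^ (n - 1) * (\<bar>g x\<bar> - A)) * \<rho> x \<le> \<bar>g x\<bar> ^ n * \<rho> x"
      using power_tangent[of "\<bar>g x\<bar>" A n] A0 \<rho>(2) by (intro mult_right_mono) auto
    then show "(A ^ n - real n * A ^ (n - 1) * A) * \<rho> x + real n * A ^ (n - 1) * (\<bar>g x\<bar> * \<rho> x) \<le> \<bar>g x\<bar> ^ n * \<rho> x"
      by (simp add: algebra_simps)
  qed (use \<rho> ga gn in auto)
  finally show ?thesis .
qed

lemma power_add_le:
  fixes a b :: real assumes "a \<ge> 0" "b \<ge> 0"
  shows "(a + b) ^ n \<le> 2 ^ n * (a ^ n + b ^ n)"
proof -
  have "(a + b) ^ n \<le> (2 * max a b) ^ n" using assms by (intro power_mono) auto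
  also have "\<dots> = 2 ^ n * max a b ^ n" by (simp add: power_mult_distrib)
  also have "max a b ^ n \<le> a ^ n + b ^ n" using assms by (auto simp: max_def)
  finally show ?thesis by simp
qed

text \<open>Used in place of compact support: with a radius instead of a closure, the supports of
  gradients, products and translates need no topology.\<close>

definition vanishes_outside :: "real \<Rightarrow> ('a::real_normed_vector \<Rightarrow> 'b::zero) \<Rightarrow> bool" where
  "vanishes_outside r f \<longleftrightarrow> (\<forall>x. norm x > r \<longrightarrow> f x = 0)"

lemma vanishes_outsideD: "vanishes_outside r f \<Longrightarrow> norm x > r \<Longrightarrow> f x = 0"
  by (simp add: vanishes_outside_def)

lemma bounded_support_bound:
  fixes f :: "'a::euclidean_space \<Rightarrow> 'b::real_normed_vector"
  assumes c: "continuous_on UNIV f" and z: "vanishes_outside r f"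
  obtains L where "L \<ge> 0" "\<And>x. norm (f x) \<le> L"
proof -
  have "compact (f ` cball 0 r)"
    by (rule compact_continuous_image) (use c continuous_on_subset in auto)
  then obtain L where L: "\<And>x. x \<in> cball 0 r \<Longrightarrow> norm (f x) \<le> L"
    using bounded_iff compact_imp_bounded by (metis imageI)
  have "norm (f x) \<le> max L 0" for x
    using L[of x] vanishes_outsideD[OF z, of x] by (cases "norm x > r") auto
  then show ?thesis using that[of "max L 0"] by simp
qed

lemma grad_zero_outside:
  assumes z: "vanishes_outside r f"
  shows "vanishes_outside r (grad f)"
  unfolding vanishes_outside_def
proof (intro allI impI, rule grad_eqI)
  fix x :: 'a assume x: "norm x > r"
  have "((\<lambda>x. 0::real) has_derivative (\<lambda>h. 0 \<bullet> h)) (at x)" by simp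
  then show "(f has_derivative (\<bullet>) 0) (at x)"
    by (rule has_derivative_transform_within_open[where s="- cball 0 r"]) (use vanishes_outsideD[OF z] x in auto)
qed

lemma bounded_grad:
  assumes "smooth f" "vanishes_outside r f"
  obtains L where "L \<ge> 0" "\<And>x. norm (grad f x) \<le> L"
  using bounded_support_bound[OF smooth_continuous_grad[OF assms(1)] grad_zero_outside[OF assms(2)]] by metis

lemma smooth_lipschitz:
  assumes "smooth f" and "\<And>x. norm (grad f x) \<le> L"
  shows "\<bar>f x - f y\<bar> \<le> L * norm (x - y)"
proof -
  have "norm (f x - f y) \<le> L * norm (x - y)"
  proof (rule differentiable_bound[where S=UNIV and f'="\<lambda>x h. grad f x \<bullet> h"])
    show "onorm ((\<bullet>) (grad f x)) \<le> L" for x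
      by (rule onorm_le) (use assms(2)[of x] in \<open>metis Cauchy_Schwarz_ineq2 norm_ge_zero mult_right_mono order_trans real_norm_def\<close>)
  qed (use smooth_has_derivative[OF assms(1)] in auto)
  then show ?thesis by simp
qed

lemma smooth_measurable [measurable_dest]: "smooth f \<Longrightarrow> f \<in> borel_measurable borel"
  by (intro borel_measurable_continuous_onI smooth_continuous)

lemma smooth_grad_measurable: "smooth f \<Longrightarrow> grad f \<in> borel_measurable borel"
  by (intro borel_measurable_continuous_onI smooth_continuous_grad)

definition conv :: "('a::euclidean_space \<Rightarrow> real) \<Rightarrow> ('a \<Rightarrow> real) \<Rightarrow> 'a \<Rightarrow> real" where
  "conv f \<rho> x = (\<integral>y. f y * \<rho> (x - y) \<partial>lborel)"

context
  fixes f :: "'a::euclidean_space \<Rightarrow> real" and M :: real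
  assumes fm [measurable]: "f \<in> borel_measurable borel" and fb: "\<And>x. \<bar>f x\<bar> \<le> M"
begin

lemma conv_integrand_integrable:
  fixes k :: "'a \<Rightarrow> 'b::euclidean_space"
  assumes c: "continuous_on UNIV k" and z: "vanishes_outside r k"
  shows "integrable lborel (\<lambda>y. f y *\<^sub>R k (x - y))"
proof -
  obtain L where L: "L \<ge> 0" "\<And>x. norm (k x) \<le> L" using bounded_support_bound[OF c z] by metis
  have [measurable]: "k \<in> borel_measurable borel" using c by (rule borel_measurable_continuous_onI)
  show ?thesis
  proof (rule bounded_support_integrable[where C="M * L" and R="norm x + r"])
    show "(\<lambda>y. f y *\<^sub>R k (x - y)) \<in> borel_measurable borel" by measurable
    show "norm (f y *\<^sub>R k (x - y)) \<le> M * L" for y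
      using fb[of y] L(2)[of "x - y"] by (simp add: mult_mono)
    fix y :: 'a assume "norm y > norm x + r"
    then have "norm (x - y) > r" using norm_triangle_ineq4[of x "x - y"] by simp
    then show "f y *\<^sub>R k (x - y) = 0" using vanishes_outsideD[OF z] by simp
  qed
qed

text \<open>The remainder of the difference quotient under the integral, \<open>q h y\<close>, tends
  to 0 for every y because the kernel is differentiable, and the Lipschitz bound of the kernel
  dominates it. So the derivative falls on the kernel, and \<open>f\<close> only has to be bounded
  and measurable.\<close>

lemma conv_has_derivative:
  assumes s: "smooth \<rho>" and z: "vanishes_outside r \<rho>"
  shows "(conv f \<rho> has_derivative (\<lambda>h. (\<integral>y. f y *\<^sub>R grad \<rho> (x - y) \<partial>lborel) \<bullet> h)) (at x)"
proof -
  obtain L where L: "L \<ge> 0" "\<And>x. norm (grad \<rho> x) \<le> L"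
    using bounded_grad[OF s z] by metis
  have [measurable]: "\<rho> \<in> borel_measurable borel" "grad \<rho> \<in> borel_measurable borel"
    using s smooth_grad_measurable by (auto intro: smooth_measurable)
  have int: "integrable lborel (\<lambda>y. f y * \<rho> (x - y))" for x
    using conv_integrand_integrable[OF smooth_continuous[OF s] z, of x] by simp
  have intg: "integrable lborel (\<lambda>y. f y *\<^sub>R grad \<rho> (x - y))" for x
    by (rule conv_integrand_integrable[OF smooth_continuous_grad[OF s] grad_zero_outside[OF z]])
  define D where "D h = (\<integral>y. f y *\<^sub>R grad \<rho> (x - y) \<partial>lborel) \<bullet> h" for h
  have D: "D h = (\<integral>y. f y * (grad \<rho> (x - y) \<bullet> h) \<partial>lborel)" for h
    unfolding D_def by (subst integral_inner_left[symmetric]) (use intg in auto)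
  have intD: "integrable lborel (\<lambda>y. f y * (grad \<rho> (x - y) \<bullet> h))" for h
    using integrable_inner_left[OF intg[of x], of h] by simp
  define q where "q h y = (f y * \<rho> (x + h - y) - f y * \<rho> (x - y) - f y * (grad \<rho> (x - y) \<bullet> h)) / norm h" for h y
  have "((\<lambda>h. norm (conv f \<rho> (x + h) - conv f \<rho> x - D h) / norm h) \<longlongrightarrow> 0) (at 0)"
    unfolding tendsto_at_iff_sequentially
  proof (intro allI impI)
    fix X :: "nat \<Rightarrow> 'a" assume X: "\<forall>i. X i \<in> UNIV - {0}" "X \<longlonglongrightarrow> 0"
    obtain B where B: "\<And>i. norm (X i) \<le> B"
      using convergent_imp_Bseq[of X] X(2) unfolding convergent_def Bseq_def by auto
    \<comment> \<open>The increment of the kernel and its linear part contribute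
      \<open>M * L\<close> each. The radius covers the supports of the kernel around x and around
      all points x + \<open>X i\<close>.\<close>
    define w where "w y = 2 * M * L * indicator (cball (0::'a) (norm x + \<bar>r\<bar> + B)) y" for y
    have "(\<lambda>i. \<integral>y. q (X i) y \<partial>lborel) \<longlonglongrightarrow> (\<integral>y. 0 \<partial>(lborel :: 'a measure))"
    proof (rule integral_dominated_convergence[where w=w])
      show "q (X i) \<in> borel_measurable lborel" for i unfolding q_def by measurable
      show "integrable lborel w" unfolding w_def
        using emeasure_lborel_cball_finite by (intro integrable_mult_right integrable_real_indicator) auto
      show "AE y in lborel. (\<lambda>i. q (X i) y) \<longlonglongrightarrow> 0"
      proof (rule AE_I2)
        fix y
        have "((\<lambda>h. norm (\<rho> (x - y + h) - \<rho> (x - y) - grad \<rho> (x - y) \<bullet> h) / norm h) \<longlongrightarrow> 0) (at 0)"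
          using smooth_has_derivative[OF s, of "x - y"] by (simp add: has_derivative_at)
        then have "(\<lambda>i. norm (\<rho> (x - y + X i) - \<rho> (x - y) - grad \<rho> (x - y) \<bullet> X i) / norm (X i)) \<longlonglongrightarrow> 0"
          using X unfolding tendsto_at_iff_sequentially by (auto simp: o_def)
        then have "(\<lambda>i. norm (f y) * (norm (\<rho> (x - y + X i) - \<rho> (x - y) - grad \<rho> (x - y) \<bullet> X i) / norm (X i))) \<longlonglongrightarrow> 0"
          by (rule tendsto_mult_right_zero)
        then have "(\<lambda>i. norm (q (X i) y)) \<longlonglongrightarrow> 0"
          unfolding q_def by (simp add: abs_mult[symmetric] algebra_simps)
        then show "(\<lambda>i. q (X i) y) \<longlonglongrightarrow> 0" by (rule tendsto_norm_zero_cancel)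
      qed
      show "AE y in lborel. norm (q (X i) y) \<le> w y" for i
      proof (rule AE_I2)
        fix y
        have nz: "norm (X i) > 0" using X by simp
        show "norm (q (X i) y) \<le> w y"
        proof (cases "y \<in> cball 0 (norm x + \<bar>r\<bar> + B)")
          case True
          have "\<bar>\<rho> (x + X i - y) - \<rho> (x - y)\<bar> \<le> L * norm (X i)"
            using smooth_lipschitz[OF s L(2), of "x + X i - y" "x - y"] by simp
          moreover have "\<bar>grad \<rho> (x - y) \<bullet> X i\<bar> \<le> L * norm (X i)"
            using Cauchy_Schwarz_ineq2[of "grad \<rho> (x - y)" "X i"] L(2)[of "x - y"]
            by (meson mult_right_mono norm_ge_zero order_trans)
          ultimately have "\<bar>\<rho> (x + X i - y) - \<rho> (x - y) - grad \<rho> (x - y) \<bullet> X i\<bar> \<le> 2 * L * norm (X i)"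
            by linarith
          then have "\<bar>f y\<bar> * \<bar>\<rho> (x + X i - y) - \<rho> (x - y) - grad \<rho> (x - y) \<bullet> X i\<bar> \<le> M * (2 * L * norm (X i))"
            using fb[of y] by (intro mult_mono) auto
          then show ?thesis using True nz unfolding q_def w_def
            by (simp add: abs_mult[symmetric] divide_le_eq algebra_simps)
        next
          case False
          then have n: "norm y > norm x + \<bar>r\<bar> + B" by simp
          have "norm (x - y) > r" "norm (x + X i - y) > r"
            using n B[of i] order_trans[OF norm_ge_zero B[of i]] norm_triangle_ineq4[of x "x - y"] norm_triangle_ineq4[of "x + X i" "x + X i - y"]
              norm_triangle_ineq[of x "X i"] by auto
          then show ?thesis using vanishes_outsideD[OF z] vanishes_outsideD[OF grad_zero_outside[OF z]] False by (simp add: q_def w_def)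
        qed
      qed
    qed auto
    then have "(\<lambda>i. \<bar>\<integral>y. q (X i) y \<partial>lborel\<bar>) \<longlonglongrightarrow> 0"
      using tendsto_rabs_zero by fastforce
    moreover have "\<bar>\<integral>y. q h y \<partial>lborel\<bar> = norm (conv f \<rho> (x + h) - conv f \<rho> x - D h) / norm h" for h
      unfolding q_def conv_def D using int intD
      by (simp add: Bochner_Integration.integral_diff)
    ultimately show "((\<lambda>h. norm (conv f \<rho> (x + h) - conv f \<rho> x - D h) / norm h) \<circ> X) \<longlonglongrightarrow> 0"
      by (simp add: o_def)
  qed
  moreover have "bounded_linear D" unfolding D_def by (rule bounded_linear_inner_right)
  ultimately show ?thesis unfolding has_derivative_at D_def by simp
qed

lemma conv_grad_inner:
  assumes s: "smooth \<rho>" and z: "vanishes_outside r \<rho>"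
  shows "grad (conv f \<rho>) x \<bullet> b = conv f (\<lambda>x. grad \<rho> x \<bullet> b) x"
proof -
  have intg: "integrable lborel (\<lambda>y. f y *\<^sub>R grad \<rho> (x - y))" for x
    by (rule conv_integrand_integrable[OF smooth_continuous_grad[OF s] grad_zero_outside[OF z]])
  have "grad (conv f \<rho>) x = (\<integral>y. f y *\<^sub>R grad \<rho> (x - y) \<partial>lborel)"
    using grad_eqI conv_has_derivative[OF s z] by blast
  then show ?thesis unfolding conv_def
    by (simp, subst integral_inner_left[symmetric]) (use intg in auto)
qed

text \<open>Each component of the gradient is a convolution of the same \<open>f\<close> with a
  component of \<open>grad \<rho>\<close>, which is again an admissible kernel; hence the induction
  is over all kernels.\<close>

lemma conv_smooth:
  assumes "smooth \<rho>" and "vanishes_outside r \<rho>"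
  shows "smooth (conv f \<rho>)"
proof -
  have "C_k k (conv f \<rho>)" for k
    using assms
  proof (induction k arbitrary: \<rho>)
    case 0
    show ?case
      using has_derivative_continuous[OF conv_has_derivative[OF 0(1,2)]]
      by (simp add: continuous_at_imp_continuous_on)
  next
    case (Suc k)
    have "C_k k (\<lambda>x. grad (conv f \<rho>) x \<bullet> b)" if b: "b \<in> Basis" for b
      unfolding conv_grad_inner[OF Suc(2,3)]
      using Suc.IH[OF smooth_grad[OF Suc(2) b]] grad_zero_outside[OF Suc(3)] by (simp add: vanishes_outside_def)
    moreover have "(conv f \<rho> has_derivative (\<lambda>h. grad (conv f \<rho>) x \<bullet> h)) (at x)" for x
      using has_derivative_grad conv_has_derivative[OF Suc(2,3)] differentiable_def by blast
    ultimately show ?case by (rule C_k_SucI[rotated])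
  qed
  then show ?thesis by (simp add: smooth_def)
qed

end

lemma AE_lborel_of_lebesgue:
  assumes "AE x in lebesgue. P x" shows "AE x in lborel. P x"
proof -
  obtain N where N: "{x \<in> space lebesgue. \<not> P x} \<subseteq> N" "N \<in> null_sets lebesgue"
    using assms unfolding eventually_ae_filter by blast
  then obtain N' where "N' \<in> null_sets lborel" "N \<subseteq> N'"
    unfolding null_sets_completion_iff2 by blast
  with N show ?thesis by (intro AE_I'[of N']) auto
qed

lemma integral_translate:
  fixes f :: "'a::euclidean_space \<Rightarrow> 'b::{banach, second_countable_topology}"
  assumes [measurable]: "f \<in> borel_measurable borel"
  shows "(\<integral>x. f (c + x) \<partial>lborel) = (\<integral>x. f x \<partial>lborel)"
proof -
  have "(\<integral>x. f x \<partial>lborel) = (\<integral>x. f x \<partial>(distr lborel borel ((+) c)))"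
    by (simp add: lborel_distr_plus)
  also have "\<dots> = (\<integral>x. f (c + x) \<partial>lborel)" by (subst integral_distr) auto
  finally show ?thesis by simp
qed

section \<open>The standard mollifiers\<close>

definition bump :: "real \<Rightarrow> 'a::euclidean_space \<Rightarrow> real" where
  "bump \<delta> x = flat 1 0 (\<delta>\<^sup>2 - x \<bullet> x)"

definition moll :: "real \<Rightarrow> 'a::euclidean_space \<Rightarrow> real" where
  "moll \<delta> x = bump \<delta> x * inverse (\<integral>y. bump \<delta> y \<partial>(lborel :: 'a measure))"

lemma smooth_bump [smooth_intros]: "smooth (bump \<delta>)"
  unfolding bump_def by (auto intro!: smooth_intros)

lemma smooth_moll [smooth_intros]: "smooth (moll \<delta>)"
  unfolding moll_def by (auto intro!: smooth_intros)

lemma bump_measurable [measurable]: "bump \<delta> \<in> borel_measurable borel"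
  by (rule smooth_measurable[OF smooth_bump])

lemma moll_measurable [measurable]: "moll \<delta> \<in> borel_measurable borel"
  by (rule smooth_measurable[OF smooth_moll])

lemma bump_bounds: "0 \<le> bump \<delta> x" "bump \<delta> x \<le> 1"
  by (auto simp: bump_def flat_def)

lemma bump_outside: assumes "\<delta> > 0" shows "vanishes_outside \<delta> (bump \<delta>)"
  unfolding vanishes_outside_def bump_def
proof (intro allI impI flat_eq_0)
  fix x :: 'a assume "norm x > \<delta>"
  then have "\<delta>\<^sup>2 \<le> (norm x)\<^sup>2" using assms by (intro power_mono) auto
  then show "\<delta>\<^sup>2 - x \<bullet> x \<le> 0" by (simp add: power2_norm_eq_inner)
qed

lemma moll_outside: "\<delta> > 0 \<Longrightarrow> vanishes_outside \<delta> (moll \<delta>)"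
  using bump_outside unfolding moll_def vanishes_outside_def by fastforce

lemma moll_uminus: "moll \<delta> (- x) = moll \<delta> x"
  by (simp add: moll_def bump_def)

lemma bump_integrable: "\<delta> > 0 \<Longrightarrow> integrable lborel (bump \<delta> :: 'a::euclidean_space \<Rightarrow> real)"
  by (rule bounded_support_integrable[where C=1 and R=\<delta>])
    (auto simp: bump_bounds vanishes_outsideD[OF bump_outside])

lemma bump_integral_pos:
  assumes "\<delta> > 0" shows "(\<integral>y. bump \<delta> y \<partial>(lborel :: 'a::euclidean_space measure)) > 0"
proof -
  have "(\<integral>y. bump \<delta> y \<partial>(lborel :: 'a measure)) \<noteq> 0"
  proof
    assume "(\<integral>y. bump \<delta> y \<partial>(lborel :: 'a measure)) = 0"
    then have "AE y in (lborel :: 'a measure). bump \<delta> y = 0"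
      using integral_nonneg_eq_0_iff_AE[OF bump_integrable[OF assms]] bump_bounds by auto
    then have "AE y in (lborel :: 'a measure). y \<notin> ball 0 \<delta>"
    proof eventually_elim
      case (elim y)
      show ?case
      proof
        assume "y \<in> ball 0 \<delta>"
        then have "(norm y)\<^sup>2 < \<delta>\<^sup>2" by (intro power_strict_mono) auto
        then show False using elim flat_pos[of "\<delta>\<^sup>2 - y \<bullet> y" 1 0]
          by (simp add: bump_def power2_norm_eq_inner)
      qed
    qed
    then have "emeasure lborel (ball (0::'a) \<delta>) = 0"
      by (subst (asm) AE_iff_measurable[of "ball 0 \<delta>"]) auto
    then show False using content_ball_pos[OF assms, of "0::'a"] by (simp add: measure_def)
  qed
  moreover have "(\<integral>y. bump \<delta> y \<partial>(lborel :: 'a measure)) \<ge> 0"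
    by (intro integral_nonneg_AE) (use bump_bounds in auto)
  ultimately show ?thesis by simp
qed

lemma moll_nonneg: "moll \<delta> x \<ge> 0"
  unfolding moll_def
  by (intro mult_nonneg_nonneg bump_bounds) (use bump_bounds in \<open>auto intro!: integral_nonneg_AE\<close>)

lemma moll_integrable: "\<delta> > 0 \<Longrightarrow> integrable lborel (moll \<delta> :: 'a::euclidean_space \<Rightarrow> real)"
  unfolding moll_def using bump_integrable by auto

lemma moll_integral: "\<delta> > 0 \<Longrightarrow> (\<integral>y. moll \<delta> y \<partial>(lborel :: 'a::euclidean_space measure)) = 1"
  unfolding moll_def using bump_integrable[where 'a='a] bump_integral_pos[where 'a='a, of \<delta>] by simp

lemma moll_diff: "moll \<delta> (x - y) = moll \<delta> (- x + y)"
  using moll_uminus[of \<delta> "x - y"] by simp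

lemma moll_shift:
  fixes x :: "'a::euclidean_space" assumes "\<delta> > 0"
  shows "integrable lborel (\<lambda>y. moll \<delta> (x - y))" "(\<integral>y. moll \<delta> (x - y) \<partial>lborel) = 1"
proof -
  show "(\<integral>y. moll \<delta> (x - y) \<partial>lborel) = 1"
    unfolding moll_diff using integral_translate[of "moll \<delta>" "- x"] moll_integral[OF assms] by simp
  then show "integrable lborel (\<lambda>y. moll \<delta> (x - y))"
    using not_integrable_integral_eq by fastforce
qed

section \<open>Continuity of translations in L^n and convergence of mollifications\<close>

lemma Lp_integrable_restrict:
  fixes f :: "'a::euclidean_space \<Rightarrow> real"
  assumes f [measurable]: "f \<in> borel_measurable borel" and z: "vanishes_outside R f"
    and i: "integrable lborel (\<lambda>x. \<bar>f x\<bar> ^ n)" and n: "n > 0"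
  shows "integrable lborel f"
proof (rule Bochner_Integration.integrable_bound)
  show "integrable lborel (\<lambda>x. \<bar>f x\<bar> ^ n + indicator (cball 0 R) x)"
    using i emeasure_lborel_cball_finite by (intro Bochner_Integration.integrable_add integrable_real_indicator) auto
  show "AE x in lborel. norm (f x) \<le> norm (\<bar>f x\<bar> ^ n + indicator (cball 0 R) x)"
  proof (rule AE_I2)
    fix x
    show "norm (f x) \<le> norm (\<bar>f x\<bar> ^ n + indicator (cball 0 R) x)"
    proof (cases "\<bar>f x\<bar> \<le> 1")
      case True
      have "0 \<le> \<bar>f x\<bar> ^ n" by simp
      with True have "\<bar>f x\<bar> \<le> \<bar>f x\<bar> ^ n + 1" by linarith
      then show ?thesis using vanishes_outsideD[OF z, of x]
        by (cases "norm x > R") (simp_all add: indicator_def)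
    next
      case False
      then have "\<bar>f x\<bar> ^ 1 \<le> \<bar>f x\<bar> ^ n" using n by (intro power_increasing) auto
      then show ?thesis by (simp add: indicator_def)
    qed
  qed
qed simp

definition clip :: "real \<Rightarrow> real \<Rightarrow> real" where "clip N t = max (- N) (min N t)"

lemma nn_integral_cmult_add3:
  assumes [measurable]: "f \<in> borel_measurable M" "g \<in> borel_measurable M" "h \<in> borel_measurable M"
  shows "(\<integral>\<^sup>+x. c * (f x + g x + h x) \<partial>M) = c * ((\<integral>\<^sup>+x. f x \<partial>M) + (\<integral>\<^sup>+x. g x \<partial>M) + (\<integral>\<^sup>+x. h x \<partial>M))"
proof -
  have "(\<integral>\<^sup>+x. c * (f x + g x + h x) \<partial>M) = c * (\<integral>\<^sup>+x. f x + g x + h x \<partial>M)"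
    by (rule nn_integral_cmult) measurable
  also have "(\<integral>\<^sup>+x. f x + g x + h x \<partial>M) = (\<integral>\<^sup>+x. f x + g x \<partial>M) + (\<integral>\<^sup>+x. h x \<partial>M)"
    by (rule nn_integral_add) measurable
  also have "(\<integral>\<^sup>+x. f x + g x \<partial>M) = (\<integral>\<^sup>+x. f x \<partial>M) + (\<integral>\<^sup>+x. g x \<partial>M)"
    by (rule nn_integral_add) measurable
  finally show ?thesis .
qed

lemma clip_measurable [measurable]: "clip N \<in> borel_measurable borel"
  unfolding clip_def by measurable

lemma clip_diff_power: "\<bar>t - clip (real N) t\<bar> ^ n \<le> \<bar>t\<bar> ^ n"
  by (rule power_mono) (auto simp: clip_def)

text \<open>First clip the values of \<open>f\<close>, then use that a bounded measurable function
  is an a.e. limit of continuous ones. These are clipped and multiplied by a cut-off that is 1 on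
  the ball of radius R, so that dominated convergence turns the a.e. limit into an L^n
  limit.\<close>

lemma Lp_dense_continuous:
  fixes f :: "'a::euclidean_space \<Rightarrow> real"
  assumes f [measurable]: "f \<in> borel_measurable borel" and z: "vanishes_outside R f"
    and i: "integrable lborel (\<lambda>x. \<bar>f x\<bar> ^ n)" and n: "n > 0" and e: "e > 0"
  obtains h R' where "continuous_on UNIV h" "vanishes_outside R' h"
    "(\<integral>\<^sup>+x. ennreal (\<bar>f x - h x\<bar> ^ n) \<partial>lborel) \<le> ennreal e"
proof -
  \<comment> \<open>There are two errors, from clipping and from the continuous approximation, and
    each is multiplied by 2^n in \<open>power_add_le\<close>.\<close>
  define e' where "e' = e / (2 * 2 ^ n)"
  have e': "e' > 0" using e by (simp add: e'_def)
  have "(\<lambda>N. \<integral>x. \<bar>f x - clip (real N) (f x)\<bar> ^ n \<partial>lborel) \<longlonglongrightarrow> (\<integral>x. 0 \<partial>(lborel :: 'a measure))"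
  proof (rule integral_dominated_convergence[where w="\<lambda>x. \<bar>f x\<bar> ^ n"])
    show "AE x in lborel. (\<lambda>N. \<bar>f x - clip (real N) (f x)\<bar> ^ n) \<longlonglongrightarrow> 0"
    proof (rule AE_I2)
      fix x
      obtain N0 :: nat where "\<bar>f x\<bar> \<le> real N0" using real_arch_simple by blast
      then have "\<forall>\<^sub>F N in sequentially. 0 = \<bar>f x - clip (real N) (f x)\<bar> ^ n"
        unfolding eventually_sequentially clip_def using n by (intro exI[of _ N0]) auto
      then show "(\<lambda>N. \<bar>f x - clip (real N) (f x)\<bar> ^ n) \<longlonglongrightarrow> 0"
        by (rule Lim_transform_eventually[OF tendsto_const])
    qed
    show "AE x in lborel. norm (\<bar>f x - clip (real N) (f x)\<bar> ^ n) \<le> \<bar>f x\<bar> ^ n" for N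
      using clip_diff_power by (intro AE_I2) simp
  qed (use i in \<open>auto simp: clip_def\<close>)
  then have "\<forall>\<^sub>F N in sequentially. (\<integral>x. \<bar>f x - clip (real N) (f x)\<bar> ^ n \<partial>lborel) < e'"
    using e' by (intro order_tendstoD) auto
  then obtain N where N: "(\<integral>x. \<bar>f x - clip (real N) (f x)\<bar> ^ n \<partial>lborel) < e'"
    by (auto simp: eventually_sequentially)
  define F where "F x = clip (real N) (f x)" for x
  have [measurable]: "F \<in> borel_measurable borel" unfolding F_def clip_def by simp
  have Fz: "vanishes_outside R F" using z by (auto simp: vanishes_outside_def F_def clip_def)
  have Fb: "\<bar>F x\<bar> \<le> N" for x by (auto simp: F_def clip_def)
  have "F measurable_on UNIV"
    by (rule lebesgue_measurable_imp_measurable_on_real) (auto intro: measurable_completion)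
  then obtain Z g where Z: "negligible Z" "\<And>k. continuous_on UNIV (g k)"
      "\<And>x. x \<notin> Z \<Longrightarrow> (\<lambda>k. g k x) \<longlonglongrightarrow> F x"
    unfolding measurable_on_def by auto
  define \<kappa> where "\<kappa> x = max 0 (min 1 (R + 1 - norm x))" for x :: 'a
  define h where "h k x = \<kappa> x * clip (real N) (g k x)" for k x
  have hc: "continuous_on UNIV (h k)" for k
    unfolding h_def \<kappa>_def clip_def by (intro continuous_intros Z(2))
  then have [measurable]: "h k \<in> borel_measurable borel" for k by (rule borel_measurable_continuous_onI)
  have hz: "vanishes_outside (R + 1) (h k)" for k by (auto simp: vanishes_outside_def h_def \<kappa>_def)
  have F\<kappa>: "\<kappa> x * F x = F x" for x
    using vanishes_outsideD[OF Fz, of x] by (cases "norm x > R") (auto simp: \<kappa>_def)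
  have hb: "\<bar>F x - h k x\<bar> \<le> 2 * N" for k x
  proof -
    have "\<bar>h k x\<bar> \<le> 1 * real N" unfolding h_def abs_mult
      by (intro mult_mono) (auto simp: \<kappa>_def clip_def)
    then show ?thesis using Fb[of x] by linarith
  qed
  have "(\<lambda>k. \<integral>x. \<bar>F x - h k x\<bar> ^ n \<partial>lborel) \<longlonglongrightarrow> (\<integral>x. 0 \<partial>(lborel :: 'a measure))"
  proof (rule integral_dominated_convergence[where w="\<lambda>x. (2 * real N) ^ n * indicator (cball 0 (\<bar>R\<bar> + 1)) x"])
    have "AE x in lebesgue. x \<notin> Z" using Z(1) negligible_iff_null_sets AE_not_in by blast
    then have "AE x in lborel. x \<notin> Z" by (rule AE_lborel_of_lebesgue)
    then show "AE x in lborel. (\<lambda>k. \<bar>F x - h k x\<bar> ^ n) \<longlonglongrightarrow> 0"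
    proof eventually_elim
      case (elim x)
      have "(\<lambda>k. h k x) \<longlonglongrightarrow> \<kappa> x * clip (real N) (F x)"
        unfolding h_def clip_def by (intro tendsto_intros Z elim)
      also have "\<kappa> x * clip (real N) (F x) = F x" 
      proof -
        have "clip (real N) (F x) = F x" using Fb[of x] by (auto simp: clip_def)
        then show ?thesis using F\<kappa>[of x] by simp
      qed
      finally have "(\<lambda>k. \<bar>F x - h k x\<bar> ^ n) \<longlonglongrightarrow> \<bar>F x - F x\<bar> ^ n" by (intro tendsto_intros)
      then show ?case using n by (simp add: zero_power)
    qed
    show "integrable lborel (\<lambda>x::'a. (2 * real N) ^ n * indicator (cball 0 (\<bar>R\<bar> + 1)) x)"
      using emeasure_lborel_cball_finite by (intro integrable_mult_right integrable_real_indicator) auto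
    show "AE x in lborel. norm (\<bar>F x - h k x\<bar> ^ n) \<le> (2 * real N) ^ n * indicator (cball 0 (\<bar>R\<bar> + 1)) x" for k
    proof (rule AE_I2)
      fix x :: 'a
      show "norm (\<bar>F x - h k x\<bar> ^ n) \<le> (2 * real N) ^ n * indicator (cball 0 (\<bar>R\<bar> + 1)) x"
      proof (cases "norm x > \<bar>R\<bar> + 1")
        case True
        then show ?thesis using vanishes_outsideD[OF Fz, of x] vanishes_outsideD[OF hz, of x] n by (simp add: zero_power)
      next
        case False
        then show ?thesis using power_mono[OF hb[of x k] abs_ge_zero, of n] by simp
      qed
    qed
  qed auto
  then have "\<forall>\<^sub>F k in sequentially. (\<integral>x. \<bar>F x - h k x\<bar> ^ n \<partial>lborel) < e'"
    using e' by (intro order_tendstoD) auto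
  then obtain k where k: "(\<integral>x. \<bar>F x - h k x\<bar> ^ n \<partial>lborel) < e'"
    by (auto simp: eventually_sequentially)
  have iF: "integrable lborel (\<lambda>x. \<bar>f x - F x\<bar> ^ n)"
    by (rule Bochner_Integration.integrable_bound[OF i])
      (use clip_diff_power in \<open>auto simp: F_def intro!: AE_I2\<close>)
  have ih: "integrable lborel (\<lambda>x. \<bar>F x - h k x\<bar> ^ n)"
  proof (rule bounded_support_integrable[where C="(2 * real N) ^ n" and R="\<bar>R\<bar> + 1"])
    show "norm (\<bar>F x - h k x\<bar> ^ n) \<le> (2 * real N) ^ n" for x
      using power_mono[OF hb[of x k] abs_ge_zero, of n] by simp
    show "\<bar>F x - h k x\<bar> ^ n = 0" if "norm x > \<bar>R\<bar> + 1" for x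
      using vanishes_outsideD[OF Fz, of x] vanishes_outsideD[OF hz, of x k] that n by simp
  qed simp
  have "(\<integral>\<^sup>+x. ennreal (\<bar>f x - h k x\<bar> ^ n) \<partial>lborel)
      \<le> (\<integral>\<^sup>+x. ennreal (2 ^ n * (\<bar>f x - F x\<bar> ^ n + \<bar>F x - h k x\<bar> ^ n)) \<partial>lborel)"
  proof (intro nn_integral_mono ennreal_leI)
    fix x
    have "\<bar>f x - h k x\<bar> ^ n \<le> (\<bar>f x - F x\<bar> + \<bar>F x - h k x\<bar>) ^ n" by (intro power_mono) auto
    also have "\<dots> \<le> 2 ^ n * (\<bar>f x - F x\<bar> ^ n + \<bar>F x - h k x\<bar> ^ n)" by (rule power_add_le) auto
    finally show "\<bar>f x - h k x\<bar> ^ n \<le> 2 ^ n * (\<bar>f x - F x\<bar> ^ n + \<bar>F x - h k x\<bar> ^ n)" .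
  qed
  also have "\<dots> = ennreal (\<integral>x. 2 ^ n * (\<bar>f x - F x\<bar> ^ n + \<bar>F x - h k x\<bar> ^ n) \<partial>lborel)"
    by (rule nn_integral_eq_integral) (use iF ih in auto)
  also have "(\<integral>x. 2 ^ n * (\<bar>f x - F x\<bar> ^ n + \<bar>F x - h k x\<bar> ^ n) \<partial>lborel)
      = 2 ^ n * ((\<integral>x. \<bar>f x - F x\<bar> ^ n \<partial>lborel) + (\<integral>x. \<bar>F x - h k x\<bar> ^ n \<partial>lborel))"
    using iF ih by simp
  also have "\<dots> \<le> 2 ^ n * (e' + e')"
    using N k by (intro mult_left_mono add_mono) (auto simp: F_def)
  also have "\<dots> = e" by (simp add: e'_def)
  finally show ?thesis using that[OF hc hz] by (simp add: ennreal_leI)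
qed

lemma Lp_translation_continuous:
  fixes f :: "'a::euclidean_space \<Rightarrow> real"
  assumes f [measurable]: "f \<in> borel_measurable borel" and z: "vanishes_outside R f"
    and i: "integrable lborel (\<lambda>x. \<bar>f x\<bar> ^ n)" and n: "n > 0" and e: "e > 0"
  obtains d where "d > 0" "\<And>z. norm z < d \<Longrightarrow> (\<integral>\<^sup>+x. ennreal (\<bar>f (x + z) - f x\<bar> ^ n) \<partial>lborel) \<le> ennreal e"
proof -
  \<comment> \<open>Three errors remain: f - h twice and the shift of h. Two applications of
    \<open>power_add_le\<close> cost 4^n, and 3 * 4^n * \<open>e1\<close> is at most e.\<close>
  define e1 where "e1 = e / (4 * 4 ^ n)"
  have e1: "e1 > 0" using e by (simp add: e1_def)
  obtain h R' where h: "continuous_on UNIV h" "vanishes_outside R' h"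
    "(\<integral>\<^sup>+x. ennreal (\<bar>f x - h x\<bar> ^ n) \<partial>lborel) \<le> ennreal e1"
    by (rule Lp_dense_continuous[OF f z i n e1])
  have [measurable]: "h \<in> borel_measurable borel" using h(1) by (rule borel_measurable_continuous_onI)
  define V where "V = measure lborel (cball (0::'a) (\<bar>R'\<bar> + 1)) + 1"
  have V: "V > 0" by (simp add: V_def add_nonneg_pos)
  \<comment> \<open>Because \<open>\<eta>\<close> is at most 1, its n-th power is at most
    \<open>\<eta>\<close>, hence at most \<open>e1 / V\<close>; the shift error of h over a ball of
    volume below V is then at most \<open>e1\<close>.\<close>
  define \<eta> where "\<eta> = min 1 (e1 / V)"
  have \<eta>: "\<eta> > 0" "\<eta> ^ n * V \<le> e1"
  proof -
    show "\<eta> > 0" using e1 V by (simp add: \<eta>_def)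
    then have "\<eta> ^ n \<le> \<eta> ^ 1" using n by (intro power_decreasing) (auto simp: \<eta>_def)
    also have "\<dots> \<le> e1 / V" by (simp add: \<eta>_def)
    finally show "\<eta> ^ n * V \<le> e1" using V by (simp add: pos_le_divide_eq)
  qed
  have "uniformly_continuous_on (cball 0 (\<bar>R'\<bar> + 2)) h"
    by (rule compact_uniformly_continuous) (use h(1) continuous_on_subset in auto)
  then obtain d where d: "d > 0" "\<And>x y. x \<in> cball 0 (\<bar>R'\<bar> + 2) \<Longrightarrow> y \<in> cball 0 (\<bar>R'\<bar> + 2) \<Longrightarrow> dist y x < d \<Longrightarrow> dist (h y) (h x) < \<eta>"
    unfolding uniformly_continuous_on_def using \<eta>(1) by metis
  show ?thesis
  proof (rule that[of "min d 1"])
    fix v :: 'a assume v: "norm v < min d 1"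
    have hv: "\<bar>h (x + v) - h x\<bar> ^ n \<le> \<eta> ^ n * indicator (cball 0 (\<bar>R'\<bar> + 1)) x" for x
    proof (cases "norm x > \<bar>R'\<bar> + 1")
      case True
      moreover have "norm v < 1" using v by simp
      moreover have "norm x \<le> norm (x + v) + norm v" using norm_triangle_ineq4[of "x + v" v] by simp
      ultimately have "norm (x + v) > R'" by linarith
      then show ?thesis using True vanishes_outsideD[OF h(2)] n by (simp add: zero_power)
    next
      case False
      then have "x \<in> cball 0 (\<bar>R'\<bar> + 2)" "x + v \<in> cball 0 (\<bar>R'\<bar> + 2)" "dist (x + v) x < d"
        using v norm_triangle_ineq[of x v] by (auto simp: dist_norm mem_cball_0 simp del: mem_cball)
      then have "\<bar>h (x + v) - h x\<bar> < \<eta>" using d(2) by (metis dist_real_def)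
      then show ?thesis using False by (auto intro!: power_mono)
    qed
    have "(\<integral>\<^sup>+x. ennreal (\<bar>f (x + v) - f x\<bar> ^ n) \<partial>lborel)
      \<le> (\<integral>\<^sup>+x. ennreal (4 ^ n) * (ennreal (\<bar>f (v + x) - h (v + x)\<bar> ^ n) + ennreal (\<bar>f x - h x\<bar> ^ n)
           + ennreal (\<eta> ^ n) * indicator (cball 0 (\<bar>R'\<bar> + 1)) x) \<partial>lborel)"
    proof (intro nn_integral_mono)
      fix x
      define a b c where "a = \<bar>f (x + v) - h (x + v)\<bar>" "b = \<bar>f x - h x\<bar>" "c = \<bar>h (x + v) - h x\<bar>"
      note abc = this
      have "\<bar>f (x + v) - f x\<bar> ^ n \<le> ((a + b) + c) ^ n" unfolding abc by (intro power_mono) auto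
      also have "\<dots> \<le> 2 ^ n * ((a + b) ^ n + c ^ n)" by (rule power_add_le) (auto simp: abc)
      also have "\<dots> \<le> 2 ^ n * (2 ^ n * (a ^ n + b ^ n) + 2 ^ n * c ^ n)"
      proof (intro mult_left_mono add_mono power_add_le)
        have "1 * c ^ n \<le> 2 ^ n * c ^ n" by (intro mult_right_mono) (auto simp: abc)
        then show "c ^ n \<le> 2 ^ n * c ^ n" by simp
      qed (auto simp: abc)
      also have "\<dots> = 4 ^ n * (a ^ n + b ^ n + c ^ n)"
      proof -
        have "(4::real) ^ n = 2 ^ n * 2 ^ n" by (simp flip: power_mult_distrib)
        then show ?thesis by (simp only: distrib_left mult.assoc)
      qed
      also have "\<dots> \<le> 4 ^ n * (a ^ n + b ^ n + \<eta> ^ n * indicator (cball 0 (\<bar>R'\<bar> + 1)) x)"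
        using hv[of x] by (intro mult_left_mono add_mono) (auto simp: abc)
      finally have "ennreal (\<bar>f (x + v) - f x\<bar> ^ n) \<le> ennreal (4 ^ n * (a ^ n + b ^ n + \<eta> ^ n * indicator (cball 0 (\<bar>R'\<bar> + 1)) x))"
        by (rule ennreal_leI)
      also have "\<dots> = ennreal (4 ^ n) * (ennreal (a ^ n) + ennreal (b ^ n) + ennreal (\<eta> ^ n) * indicator (cball 0 (\<bar>R'\<bar> + 1)) x)"
        using \<eta>(1) by (auto simp: abc ennreal_mult' ennreal_plus indicator_def)
      finally show "ennreal (\<bar>f (x + v) - f x\<bar> ^ n) \<le> ennreal (4 ^ n) * (ennreal (\<bar>f (v + x) - h (v + x)\<bar> ^ n) + ennreal (\<bar>f x - h x\<bar> ^ n)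
           + ennreal (\<eta> ^ n) * indicator (cball 0 (\<bar>R'\<bar> + 1)) x)" unfolding abc by (simp add: add.commute)
    qed
    also have "\<dots> = ennreal (4 ^ n) * ((\<integral>\<^sup>+x. ennreal (\<bar>f (v + x) - h (v + x)\<bar> ^ n) \<partial>lborel) + (\<integral>\<^sup>+x. ennreal (\<bar>f x - h x\<bar> ^ n) \<partial>lborel)
           + ennreal (\<eta> ^ n) * emeasure lborel (cball (0::'a) (\<bar>R'\<bar> + 1)))"
    proof -
      have "(\<integral>\<^sup>+x. ennreal (\<eta> ^ n) * indicator (cball (0::'a) (\<bar>R'\<bar> + 1)) x \<partial>lborel) = ennreal (\<eta> ^ n) * emeasure lborel (cball (0::'a) (\<bar>R'\<bar> + 1))"
        by (rule nn_integral_cmult_indicator) simp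
      note A = this
      have [measurable]: "cball (0::'a) (\<bar>R'\<bar> + 1) \<in> sets borel" by simp
      show ?thesis unfolding A[symmetric] by (rule nn_integral_cmult_add3) measurable
    qed
    also have "(\<integral>\<^sup>+x. ennreal (\<bar>f (v + x) - h (v + x)\<bar> ^ n) \<partial>lborel) = (\<integral>\<^sup>+x. ennreal (\<bar>f x - h x\<bar> ^ n) \<partial>lborel)"
      by (rule nn_integral_translate[of "\<lambda>x. ennreal (\<bar>f x - h x\<bar> ^ n)"]) simp
    also have "ennreal (4 ^ n) * ((\<integral>\<^sup>+x. ennreal (\<bar>f x - h x\<bar> ^ n) \<partial>lborel) + (\<integral>\<^sup>+x. ennreal (\<bar>f x - h x\<bar> ^ n) \<partial>lborel)
           + ennreal (\<eta> ^ n) * emeasure lborel (cball (0::'a) (\<bar>R'\<bar> + 1)))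
        \<le> ennreal (4 ^ n) * (ennreal e1 + ennreal e1 + ennreal e1)"
    proof (intro mult_left_mono add_mono h(3))
      have "emeasure lborel (cball (0::'a) (\<bar>R'\<bar> + 1)) = ennreal (measure lborel (cball (0::'a) (\<bar>R'\<bar> + 1)))"
        using emeasure_lborel_cball_finite[of "0::'a" "\<bar>R'\<bar> + 1"] by (simp add: emeasure_eq_ennreal_measure)
      also have "\<dots> \<le> ennreal V" by (intro ennreal_leI) (simp add: V_def)
      finally have "ennreal (\<eta> ^ n) * emeasure lborel (cball (0::'a) (\<bar>R'\<bar> + 1)) \<le> ennreal (\<eta> ^ n) * ennreal V"
        by (rule mult_left_mono) simp
      also have "\<dots> = ennreal (\<eta> ^ n * V)" using \<eta> V by (simp add: ennreal_mult')
      also have "\<dots> \<le> ennreal e1" using \<eta> by (intro ennreal_leI)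
      finally show "ennreal (\<eta> ^ n) * emeasure lborel (cball (0::'a) (\<bar>R'\<bar> + 1)) \<le> ennreal e1" .
    qed auto
    also have "\<dots> = ennreal (4 ^ n * (e1 + e1 + e1))" 
    proof -
      have "0 \<le> e1" "0 \<le> e1 + e1" "0 \<le> e1 + e1 + e1" "(0::real) \<le> 4 ^ n" using e1 by auto
      then show ?thesis by (simp only: ennreal_plus ennreal_mult')
    qed
    also have "\<dots> \<le> ennreal e" by (intro ennreal_leI) (use e in \<open>simp add: e1_def field_simps\<close>)
    finally show "(\<integral>\<^sup>+x. ennreal (\<bar>f (x + v) - f x\<bar> ^ n) \<partial>lborel) \<le> ennreal e" .
  qed (use d in auto)
qed

text \<open>The mollification error at x is the mean of f(x + z) - f(x) for the probability density
  \<open>moll \<delta>\<close>. Jensen's inequality and the exchange of integrals reduce it to the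
  translation errors for norm z at most \<open>\<delta>\<close>.\<close>

lemma conv_moll_Lp:
  fixes f :: "'a::euclidean_space \<Rightarrow> real"
  assumes f [measurable]: "f \<in> borel_measurable borel" and z: "vanishes_outside R f"
    and i: "integrable lborel (\<lambda>x. \<bar>f x\<bar> ^ n)" and n: "n > 0" and \<delta>: "\<delta> > 0"
    and w: "\<And>z. norm z \<le> \<delta> \<Longrightarrow> (\<integral>\<^sup>+x. ennreal (\<bar>f (x + z) - f x\<bar> ^ n) \<partial>lborel) \<le> ennreal e"
  shows "(\<integral>\<^sup>+x. ennreal (\<bar>conv f (moll \<delta>) x - f x\<bar> ^ n) \<partial>lborel) \<le> ennreal e"
proof -
  let ?\<rho> = "moll \<delta> :: 'a \<Rightarrow> real"
  obtain L where L: "\<And>x. norm (?\<rho> x) \<le> L"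
    using bounded_support_bound[OF smooth_continuous[OF smooth_moll] moll_outside[OF \<delta>]] by metis
  note rho = moll_shift[OF \<delta>]
  have f1: "integrable lborel f" by (rule Lp_integrable_restrict[OF f z i n])
  have f1r: "integrable lborel (\<lambda>y. f y * ?\<rho> (x - y))" for x
    by (rule integrable_mult_bounded_real[OF f1, where C=L]) (use L in auto)
  have fnr: "integrable lborel (\<lambda>y. \<bar>f y\<bar> ^ n * ?\<rho> (x - y))" for x
    by (rule integrable_mult_bounded_real[OF i, where C=L]) (use L in auto)
  have point: "ennreal (\<bar>conv f ?\<rho> x - f x\<bar> ^ n) \<le> (\<integral>\<^sup>+v. ennreal (\<bar>f (x + v) - f x\<bar> ^ n) * ennreal (?\<rho> v) \<partial>lborel)" for x
  proof -
    have i1: "integrable lborel (\<lambda>y. (f y - f x) * ?\<rho> (x - y))"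
      using f1r[of x] rho(1)[of x] by (auto simp: left_diff_distrib)
    have i2: "integrable lborel (\<lambda>y. \<bar>f y - f x\<bar> ^ n * ?\<rho> (x - y))"
    proof (rule Bochner_Integration.integrable_bound)
      show "integrable lborel (\<lambda>y. 2 ^ n * (\<bar>f y\<bar> ^ n * ?\<rho> (x - y) + \<bar>f x\<bar> ^ n * ?\<rho> (x - y)))"
        by (intro integrable_mult_right Bochner_Integration.integrable_add fnr rho(1))
      show "AE y in lborel. norm (\<bar>f y - f x\<bar> ^ n * ?\<rho> (x - y)) \<le> norm (2 ^ n * (\<bar>f y\<bar> ^ n * ?\<rho> (x - y) + \<bar>f x\<bar> ^ n * ?\<rho> (x - y)))"
      proof (rule AE_I2)
        fix y
        have "\<bar>f y - f x\<bar> ^ n \<le> (\<bar>f y\<bar> + \<bar>f x\<bar>) ^ n" by (intro power_mono) auto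
        also have "\<dots> \<le> 2 ^ n * (\<bar>f y\<bar> ^ n + \<bar>f x\<bar> ^ n)" by (rule power_add_le) auto
        finally have "\<bar>f y - f x\<bar> ^ n * ?\<rho> (x - y) \<le> 2 ^ n * (\<bar>f y\<bar> ^ n + \<bar>f x\<bar> ^ n) * ?\<rho> (x - y)"
          by (rule mult_right_mono) (rule moll_nonneg)
        then show "norm (\<bar>f y - f x\<bar> ^ n * ?\<rho> (x - y)) \<le> norm (2 ^ n * (\<bar>f y\<bar> ^ n * ?\<rho> (x - y) + \<bar>f x\<bar> ^ n * ?\<rho> (x - y)))"
          using moll_nonneg[of \<delta> "x - y"] by (simp add: algebra_simps)
      qed
    qed simp
    have "conv f ?\<rho> x - f x = (\<integral>y. (f y - f x) * ?\<rho> (x - y) \<partial>lborel)"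
      unfolding conv_def left_diff_distrib using f1r[of x] rho[of x] by simp
    then have "\<bar>conv f ?\<rho> x - f x\<bar> ^ n \<le> (\<integral>y. \<bar>f y - f x\<bar> ^ n * ?\<rho> (x - y) \<partial>lborel)"
      using jensen_power[OF rho(1) moll_nonneg rho(2) i1 i2] by simp
    then have "ennreal (\<bar>conv f ?\<rho> x - f x\<bar> ^ n) \<le> ennreal (\<integral>y. \<bar>f y - f x\<bar> ^ n * ?\<rho> (x - y) \<partial>lborel)"
      by (rule ennreal_leI)
    also have "\<dots> = (\<integral>\<^sup>+y. ennreal (\<bar>f y - f x\<bar> ^ n * ?\<rho> (x - y)) \<partial>lborel)"
      by (rule nn_integral_eq_integral[symmetric, OF i2]) (simp add: moll_nonneg)
    also have "\<dots> = (\<integral>\<^sup>+v. ennreal (\<bar>f (x + v) - f x\<bar> ^ n * ?\<rho> (x - (x + v))) \<partial>lborel)"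
      by (rule nn_integral_translate[symmetric]) simp
    also have "\<dots> = (\<integral>\<^sup>+v. ennreal (\<bar>f (x + v) - f x\<bar> ^ n) * ennreal (?\<rho> v) \<partial>lborel)"
      by (simp add: moll_uminus ennreal_mult' moll_nonneg)
    finally show ?thesis .
  qed
  have "(\<integral>\<^sup>+x. ennreal (\<bar>conv f ?\<rho> x - f x\<bar> ^ n) \<partial>lborel)
     \<le> (\<integral>\<^sup>+x. (\<integral>\<^sup>+v. ennreal (\<bar>f (x + v) - f x\<bar> ^ n) * ennreal (?\<rho> v) \<partial>lborel) \<partial>lborel)"
    by (intro nn_integral_mono point)
  also have "\<dots> = (\<integral>\<^sup>+v. (\<integral>\<^sup>+x. ennreal (\<bar>f (x + v) - f x\<bar> ^ n) * ennreal (?\<rho> v) \<partial>lborel) \<partial>lborel)"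
    by (rule lborel_pair.Fubini') measurable
  also have "\<dots> \<le> (\<integral>\<^sup>+v. ennreal e * ennreal (?\<rho> v) \<partial>lborel)"
  proof (intro nn_integral_mono)
    fix v
    have "(\<integral>\<^sup>+x. ennreal (\<bar>f (x + v) - f x\<bar> ^ n) * ennreal (?\<rho> v) \<partial>lborel)
        = (\<integral>\<^sup>+x. ennreal (\<bar>f (x + v) - f x\<bar> ^ n) \<partial>lborel) * ennreal (?\<rho> v)"
      by (rule nn_integral_multc) simp
    also have "\<dots> \<le> ennreal e * ennreal (?\<rho> v)"
    proof (cases "norm v \<le> \<delta>")
      case True
      then show ?thesis by (intro mult_right_mono w) auto
    next
      case False
      then show ?thesis using vanishes_outsideD[OF moll_outside[OF \<delta>], of v] by simp
    qed
    finally show "(\<integral>\<^sup>+x. ennreal (\<bar>f (x + v) - f x\<bar> ^ n) * ennreal (?\<rho> v) \<partial>lborel) \<le> ennreal e * ennreal (?\<rho> v)" .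
  qed
  also have "\<dots> = ennreal e * (\<integral>\<^sup>+v. ennreal (?\<rho> v) \<partial>lborel)"
    by (rule nn_integral_cmult) simp
  also have "(\<integral>\<^sup>+v. ennreal (?\<rho> v) \<partial>lborel) = ennreal (\<integral>v. ?\<rho> v \<partial>lborel)"
    by (rule nn_integral_eq_integral) (use moll_integrable[OF \<delta>] moll_nonneg in auto)
  also have "\<dots> = 1" using moll_integral[OF \<delta>, where 'a='a] by simp
  finally show ?thesis by simp
qed

text \<open>The sum of all |d k|^n has finite integral, hence is finite a.e.: its terms tend to zero
  and the sum dominates each of them. A geometric rate thus gives a.e. convergence and an integrable
  majorant at once.\<close>

lemma dominated_vanishing_sequence:
  fixes d :: "nat \<Rightarrow> 'a::euclidean_space \<Rightarrow> real"
  assumes [measurable]: "\<And>k. d k \<in> borel_measurable borel" and n: "n > 0"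
    and le: "\<And>k. (\<integral>\<^sup>+x. ennreal (\<bar>d k x\<bar> ^ n) \<partial>lborel) \<le> ennreal ((1/2) ^ k)"
  obtains s where "integrable lborel s" "s \<in> borel_measurable borel" "\<And>x. s x \<ge> 0"
    "AE x in lborel. (\<lambda>k. d k x) \<longlonglongrightarrow> 0 \<and> (\<forall>k. \<bar>d k x\<bar> ^ n \<le> s x)"
proof -
  define S where "S x = (\<Sum>k. ennreal (\<bar>d k x\<bar> ^ n))" for x
  have [measurable]: "S \<in> borel_measurable borel" unfolding S_def by measurable
  have "(\<integral>\<^sup>+x. S x \<partial>lborel) = (\<Sum>k. \<integral>\<^sup>+x. ennreal (\<bar>d k x\<bar> ^ n) \<partial>lborel)"
    unfolding S_def by (rule nn_integral_suminf) measurable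
  also have "\<dots> \<le> (\<Sum>k. ennreal ((1/2) ^ k))" by (intro suminf_le le) auto
  also have "\<dots> = ennreal (\<Sum>k. (1/2) ^ k)"
    by (rule suminf_ennreal2) (auto intro: summable_geometric)
  also have "\<dots> < \<infinity>" by simp
  finally have fin: "(\<integral>\<^sup>+x. S x \<partial>lborel) < \<infinity>" .
  then have AEf: "AE x in lborel. S x \<noteq> \<infinity>" by (intro nn_integral_PInf_AE) auto
  define s where "s x = enn2real (S x)" for x
  have sm: "s \<in> borel_measurable borel" unfolding s_def by measurable
  have s0: "s x \<ge> 0" for x by (simp add: s_def)
  have "(\<integral>\<^sup>+x. ennreal (s x) \<partial>lborel) \<le> (\<integral>\<^sup>+x. S x \<partial>lborel)"
    by (intro nn_integral_mono) (simp add: s_def ennreal_enn2real_if)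
  then have si: "integrable lborel s"
    using fin sm s0 by (intro integrableI_nonneg) auto
  have "AE x in lborel. (\<lambda>k. d k x) \<longlonglongrightarrow> 0 \<and> (\<forall>k. \<bar>d k x\<bar> ^ n \<le> s x)"
    using AEf
  proof eventually_elim
    case (elim x)
    have sum: "summable (\<lambda>k. \<bar>d k x\<bar> ^ n)"
      using elim by (intro summable_suminf_not_top) (auto simp: S_def)
    then have "(\<lambda>k. root n (\<bar>d k x\<bar> ^ n)) \<longlonglongrightarrow> root n 0"
      by (intro tendsto_real_root summable_LIMSEQ_zero)
    then have "(\<lambda>k. \<bar>d k x\<bar>) \<longlonglongrightarrow> 0" using n by (simp add: real_root_power_cancel)
    then have c: "(\<lambda>k. d k x) \<longlonglongrightarrow> 0" by (rule tendsto_rabs_zero_cancel)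
    have "S x = ennreal (\<Sum>k. \<bar>d k x\<bar> ^ n)" unfolding S_def by (rule suminf_ennreal2[OF _ sum]) simp
    then have "s x = (\<Sum>k. \<bar>d k x\<bar> ^ n)" unfolding s_def by (simp add: suminf_nonneg sum)
    then have "\<bar>d k x\<bar> ^ n \<le> s x" for k
      using sum_le_suminf[OF sum, of "{k}"] by simp
    with c show ?case by simp
  qed
  with si sm s0 that show ?thesis by blast
qed

lemma power_sum_le:
  fixes a :: "'i \<Rightarrow> real"
  assumes "finite I" "\<And>i. i \<in> I \<Longrightarrow> a i \<ge> 0" and "n > 0"
  shows "(\<Sum>i\<in>I. a i) ^ n \<le> real (card I) ^ n * (\<Sum>i\<in>I. a i ^ n)"
proof (cases "I = {}")
  case False
  define A where "A = Max (a ` I)"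
  have "A \<in> a ` I" unfolding A_def by (rule Max_in) (use assms(1) False in auto)
  then obtain j where j: "j \<in> I" "A = a j" by auto
  have "(\<Sum>i\<in>I. a i) \<le> (\<Sum>i\<in>I. A)" unfolding A_def using assms(1) by (intro sum_mono) auto
  then have "(\<Sum>i\<in>I. a i) ^ n \<le> (real (card I) * a j) ^ n"
    using assms by (intro power_mono) (auto simp: j intro!: sum_nonneg)
  also have "\<dots> = real (card I) ^ n * a j ^ n" by (simp add: power_mult_distrib)
  also have "a j ^ n \<le> (\<Sum>i\<in>I. a i ^ n)"
    using member_le_sum[of j I "\<lambda>i. a i ^ n"] j assms by auto
  finally show ?thesis by (simp add: mult_left_mono)
qed (use assms in \<open>simp add: zero_power\<close>)

lemma conv_local:
  fixes f :: "'a::euclidean_space \<Rightarrow> real"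
  assumes "vanishes_outside \<delta> \<rho>" "\<And>y. norm y \<le> norm x + \<delta> \<Longrightarrow> f y = g y"
  shows "conv f \<rho> x = conv g \<rho> x"
  unfolding conv_def
proof (rule Bochner_Integration.integral_cong)
  fix y :: 'a
  show "f y * \<rho> (x - y) = g y * \<rho> (x - y)"
  proof (cases "norm (x - y) > \<delta>")
    case True
    then show ?thesis using vanishes_outsideD[OF assms(1)] by simp
  next
    case False
    then have "norm y \<le> norm x + \<delta>" using norm_triangle_ineq4[of x "x - y"] by simp
    then show ?thesis using assms(2) by simp
  qed
qed simp

lemma smooth_shifted_moll: "smooth (\<lambda>y. moll \<delta> (x - y))"
proof -
  have "(\<lambda>y. moll \<delta> (x - y)) = (\<lambda>y. flat 1 0 (\<delta>\<^sup>2 - (x \<bullet> x - 2 * (y \<bullet> x) + y \<bullet> y)) * inverse (\<integral>y. bump \<delta> y \<partial>(lborel :: 'a measure)))"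
    by (simp add: fun_eq_iff moll_def bump_def inner_diff_left inner_diff_right inner_commute algebra_simps)
  then show ?thesis by (auto intro!: smooth_intros)
qed

lemma grad_shifted:
  assumes "smooth f" shows "grad (\<lambda>y. f (x - y)) y = - grad f (x - y)"
proof (rule grad_eqI)
  have "((\<lambda>y. x - y) has_derivative (\<lambda>h. - h)) (at y)" by (auto intro!: derivative_eq_intros)
  from has_derivative_compose[OF this smooth_has_derivative[OF assms, of "x - y"]]
  show "((\<lambda>y. f (x - y)) has_derivative (\<bullet>) (- grad f (x - y))) (at y)"
    by (rule has_derivative_eq_rhs) auto
qed

lemma conv_moll_bounds:
  fixes u :: "'a::euclidean_space \<Rightarrow> real"
  assumes [measurable]: "u \<in> borel_measurable borel" and b: "\<And>x. m \<le> u x" "\<And>x. u x \<le> M" and \<delta>: "\<delta> > 0"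
  shows "m \<le> conv u (moll \<delta>) x" "conv u (moll \<delta>) x \<le> M"
proof -
  have "\<bar>u x\<bar> \<le> max \<bar>m\<bar> \<bar>M\<bar>" for x using b[of x] by linarith
  then have i: "integrable lborel (\<lambda>y. moll \<delta> (x - y) * u y)"
    by (intro integrable_mult_bounded_real[OF moll_shift(1)[OF \<delta>]]) auto
  have i': "integrable lborel (\<lambda>y. u y * moll \<delta> (x - y))" using i by (simp add: mult.commute)
  have "m = (\<integral>y. m * moll \<delta> (x - y) \<partial>lborel)" using moll_shift(2)[OF \<delta>, of x] by simp
  also have "\<dots> \<le> conv u (moll \<delta>) x" unfolding conv_def
    by (intro integral_mono i' integrable_mult_right moll_shift(1)[OF \<delta>] mult_right_mono b moll_nonneg)
  finally show "m \<le> conv u (moll \<delta>) x" .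
  have "conv u (moll \<delta>) x \<le> (\<integral>y. M * moll \<delta> (x - y) \<partial>lborel)" unfolding conv_def
    by (intro integral_mono i' integrable_mult_right moll_shift(1)[OF \<delta>] mult_right_mono b moll_nonneg)
  also have "\<dots> = M" using moll_shift(2)[OF \<delta>, of x] by simp
  finally show "conv u (moll \<delta>) x \<le> M" .
qed

text \<open>The mollifications of u respect the pointwise bounds because the kernel is a probability
  density. By the weak gradient identity their gradients are the mollifications of G. Radii are
  chosen so that u and all components of G have translation errors at most 2^-k, which brings in
  \<open>dominated_vanishing_sequence\<close>.\<close>

lemma smooth_approximation:
  fixes u :: "'a::euclidean_space \<Rightarrow> real" and G :: "'a \<Rightarrow> 'a"
  assumes um [measurable]: "u \<in> borel_measurable borel" and ub: "\<And>x. m \<le> u x" "\<And>x. u x \<le> M"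
    and Gm [measurable]: "G \<in> borel_measurable borel"
    and Gi: "\<And>r. integrable lborel (\<lambda>x. indicator (cball 0 r) x * norm (G x) ^ n)" and n: "n > 0"
    and weak: "\<And>\<phi> r b. smooth \<phi> \<Longrightarrow> vanishes_outside r \<phi> \<Longrightarrow> b \<in> Basis \<Longrightarrow>
      (\<integral>x. u x * (grad \<phi> x \<bullet> b) \<partial>lborel) = - (\<integral>x. (G x \<bullet> b) * \<phi> x \<partial>lborel)"
  obtains U S where "\<And>k::nat. smooth (U k)" "\<And>k x. m \<le> U k x" "\<And>k x. U k x \<le> M"
    "integrable lborel S" "\<And>x. S x \<ge> 0"
    "AE x in lborel. norm x < K \<longrightarrow> (\<lambda>k. U k x) \<longlonglongrightarrow> u x \<and> (\<lambda>k. grad (U k) x) \<longlonglongrightarrow> G x \<and>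
      (\<forall>k. norm (grad (U k) x) ^ n \<le> S x)"
proof -
  \<comment> \<open>The index 0, which is no basis vector, stands for u and an index b in
    \<open>Basis\<close> for a component of G. The extra radius 1 leaves room for mollification
    radii up to 1, so the cut-off is not noticed where norm x < K.\<close>
  define F where "F b x = indicator (cball 0 (K + 1)) x * (if b = 0 then u x else G x \<bullet> b)" for b x
  have Fm [measurable]: "F b \<in> borel_measurable borel" for b 
  proof -
    have [measurable]: "cball (0::'a) (K + 1) \<in> sets borel" by simp
    show ?thesis unfolding F_def by measurable
  qed
  have Fz: "vanishes_outside (K + 1) (F b)" for b by (auto simp: vanishes_outside_def F_def indicator_def)
  define B0 where "B0 = insert 0 (Basis :: 'a set)"
  have finB0: "finite B0" by (simp add: B0_def)
  define C where "C = max \<bar>m\<bar> \<bar>M\<bar>"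
  have uC: "\<bar>u x\<bar> \<le> C" for x using ub[of x] by (auto simp: C_def)
  have Fi: "integrable lborel (\<lambda>x. \<bar>F b x\<bar> ^ n)" if "b \<in> B0" for b
  proof (cases "b = 0")
    case True
    show ?thesis
    proof (rule bounded_support_integrable[where C="C ^ n" and R="K + 1"])
      show "norm (\<bar>F b x\<bar> ^ n) \<le> C ^ n" for x
        using uC[of x] order_trans[OF abs_ge_zero uC[of x]] n
        by (auto simp: F_def True indicator_def zero_power intro!: power_mono)
      show "norm x > K + 1 \<Longrightarrow> \<bar>F b x\<bar> ^ n = 0" for x using n by (simp add: F_def zero_power)
    qed simp
  next
    case False
    then have "norm b = 1" using that by (auto simp: B0_def)
    have "\<bar>F b x\<bar> ^ n \<le> indicator (cball 0 (K + 1)) x * norm (G x) ^ n" for x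
      using Cauchy_Schwarz_ineq2[of "G x" b] n \<open>norm b = 1\<close>
      by (auto simp: F_def False indicator_def zero_power intro!: power_mono)
    then show ?thesis
      by (intro Bochner_Integration.integrable_bound[OF Gi[of "K + 1"]]) (auto intro!: AE_I2 order_trans[OF _ abs_ge_self])
  qed
  have "\<exists>\<delta>>0. \<delta> \<le> 1 \<and> (\<forall>b\<in>B0. \<forall>z. norm z \<le> \<delta> \<longrightarrow>
      (\<integral>\<^sup>+x. ennreal (\<bar>F b (x + z) - F b x\<bar> ^ n) \<partial>lborel) \<le> ennreal ((1/2) ^ k))" for k :: nat
  proof -
    have "\<exists>d>0. \<forall>z. norm z < d \<longrightarrow> (\<integral>\<^sup>+x. ennreal (\<bar>F b (x + z) - F b x\<bar> ^ n) \<partial>lborel) \<le> ennreal ((1/2) ^ k)"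
      if "b \<in> B0" for b
    proof -
      have "(1/2::real) ^ k > 0" by simp
      from Lp_translation_continuous[OF Fm Fz Fi[OF that] n this] show ?thesis by blast
    qed
    then have "\<forall>b\<in>B0. \<exists>d. d > 0 \<and> (\<forall>z. norm z < d \<longrightarrow> (\<integral>\<^sup>+x. ennreal (\<bar>F b (x + z) - F b x\<bar> ^ n) \<partial>lborel) \<le> ennreal ((1/2) ^ k))"
      by simp
    from bchoice[OF this] obtain d where "\<forall>b\<in>B0. d b > 0 \<and> (\<forall>z. norm z < d b \<longrightarrow> (\<integral>\<^sup>+x. ennreal (\<bar>F b (x + z) - F b x\<bar> ^ n) \<partial>lborel) \<le> ennreal ((1/2) ^ k))"
      by (elim exE)
    then have d: "\<And>b. b \<in> B0 \<Longrightarrow> d b > 0"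
      "\<And>b z. b \<in> B0 \<Longrightarrow> norm z < d b \<Longrightarrow> (\<integral>\<^sup>+x. ennreal (\<bar>F b (x + z) - F b x\<bar> ^ n) \<partial>lborel) \<le> ennreal ((1/2) ^ k)"
      by blast+
    define \<delta> where "\<delta> = min 1 (Min (d ` B0) / 2)"
    have "Min (d ` B0) > 0" using d(1) finB0 by (subst Min_gr_iff) (auto simp: B0_def)
    moreover have "Min (d ` B0) \<le> d b" if "b \<in> B0" for b using that finB0 by auto
    ultimately have "\<delta> > 0" "\<delta> \<le> 1" "\<And>b. b \<in> B0 \<Longrightarrow> \<delta> < d b"
      by (auto simp: \<delta>_def min_less_iff_disj) (smt (verit) field_sum_of_halves)
    then show ?thesis using d(2) by (intro exI[of _ \<delta>]) (auto intro: order_le_less_trans)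
  qed
  then have "\<forall>k::nat. \<exists>\<delta>. \<delta> > 0 \<and> \<delta> \<le> 1 \<and> (\<forall>b\<in>B0. \<forall>z. norm z \<le> \<delta> \<longrightarrow>
      (\<integral>\<^sup>+x. ennreal (\<bar>F b (x + z) - F b x\<bar> ^ n) \<partial>lborel) \<le> ennreal ((1/2) ^ k))"
    by blast
  from choice[OF this] obtain \<delta> where all\<delta>: "\<forall>k::nat. \<delta> k > 0 \<and> \<delta> k \<le> 1 \<and> (\<forall>b\<in>B0. \<forall>z. norm z \<le> \<delta> k \<longrightarrow>
      (\<integral>\<^sup>+x. ennreal (\<bar>F b (x + z) - F b x\<bar> ^ n) \<partial>lborel) \<le> ennreal ((1/2) ^ k))"
    by (elim exE)
  have \<delta>: "\<And>k. \<delta> k > 0" "\<And>k. \<delta> k \<le> 1"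
    "\<And>k b z. b \<in> B0 \<Longrightarrow> norm z \<le> \<delta> k \<Longrightarrow> (\<integral>\<^sup>+x. ennreal (\<bar>F b (x + z) - F b x\<bar> ^ n) \<partial>lborel) \<le> ennreal ((1/2) ^ k)"
    using spec[OF all\<delta>] by simp_all
  have cm: "conv (F b) (moll (\<delta> k)) \<in> borel_measurable borel" for b k unfolding conv_def by measurable
  define dd where "dd b k x = conv (F b) (moll (\<delta> k)) x - F b x" for b k x
  have ddm: "dd b k \<in> borel_measurable borel" for b k unfolding dd_def using cm by simp
  have ddle: "(\<integral>\<^sup>+x. ennreal (\<bar>dd b k x\<bar> ^ n) \<partial>lborel) \<le> ennreal ((1/2) ^ k)" if "b \<in> B0" for b k
    unfolding dd_def using conv_moll_Lp[OF Fm Fz Fi[OF that] n \<delta>(1) \<delta>(3)[OF that]] .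
  have "\<exists>s. integrable lborel s \<and> s \<in> borel_measurable borel \<and> (\<forall>x. s x \<ge> 0) \<and>
    (AE x in lborel. (\<lambda>k. dd b k x) \<longlonglongrightarrow> 0 \<and> (\<forall>k. \<bar>dd b k x\<bar> ^ n \<le> s x))" if "b \<in> B0" for b
    by (rule dominated_vanishing_sequence[of "dd b", OF ddm n ddle[OF that]]) (intro exI conjI allI)
  then have "\<forall>b\<in>B0. \<exists>s. integrable lborel (s) \<and> s \<in> borel_measurable borel \<and> (\<forall>x. s x \<ge> 0) \<and>
    (AE x in lborel. (\<lambda>k. dd b k x) \<longlonglongrightarrow> 0 \<and> (\<forall>k. \<bar>dd b k x\<bar> ^ n \<le> s x))"
    by simp
  from bchoice[OF this] obtain s where sall: "\<forall>b\<in>B0. integrable lborel (s b) \<and> s b \<in> borel_measurable borel \<and> (\<forall>x. s b x \<ge> 0) \<and>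
    (AE x in lborel. (\<lambda>k. dd b k x) \<longlonglongrightarrow> 0 \<and> (\<forall>k. \<bar>dd b k x\<bar> ^ n \<le> s b x))"
    by (elim exE)
  have s: "\<And>b. b \<in> B0 \<Longrightarrow> integrable lborel (s b)" "\<And>b. b \<in> B0 \<Longrightarrow> s b \<in> borel_measurable borel"
    "\<And>b x. b \<in> B0 \<Longrightarrow> s b x \<ge> 0"
    "\<And>b. b \<in> B0 \<Longrightarrow> AE x in lborel. (\<lambda>k. dd b k x) \<longlonglongrightarrow> 0 \<and> (\<forall>k. \<bar>dd b k x\<bar> ^ n \<le> s b x)"
    using bspec[OF sall] by simp_all
  have AEall: "AE x in lborel. \<forall>b\<in>B0. (\<lambda>k. dd b k x) \<longlonglongrightarrow> 0 \<and> (\<forall>k. \<bar>dd b k x\<bar> ^ n \<le> s b x)"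
    using s(4) finB0 by (intro AE_finite_allI) auto
  define U where "U k = conv u (moll (\<delta> k))" for k
  have Us: "smooth (U k)" for k unfolding U_def
    by (rule conv_smooth[OF um uC smooth_moll moll_outside[OF \<delta>(1)]])
  have UF: "U k x = conv (F 0) (moll (\<delta> k)) x" if "norm x < K" for k x
    unfolding U_def by (rule conv_local[OF moll_outside[OF \<delta>(1)]]) (use \<delta>(2)[of k] that in \<open>auto simp: F_def\<close>)
  \<comment> \<open>Differentiating the kernel in y instead of x changes the sign; the weak gradient
    identity, with the shifted kernel as test function, changes it back.\<close>
  have gradU: "grad (U k) x \<bullet> b = conv (F b) (moll (\<delta> k)) x" if "norm x < K" and b: "b \<in> Basis" for k x b
  proof -
    let ?\<rho> = "moll (\<delta> k) :: 'a \<Rightarrow> real"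
    have "grad (U k) x \<bullet> b = (\<integral>y. u y * (grad ?\<rho> (x - y) \<bullet> b) \<partial>lborel)"
      unfolding U_def using conv_grad_inner[OF um uC smooth_moll moll_outside[OF \<delta>(1)]] by (simp add: conv_def)
    also have "\<dots> = - (\<integral>y. u y * (grad (\<lambda>y. ?\<rho> (x - y)) y \<bullet> b) \<partial>lborel)"
      by (simp add: grad_shifted[OF smooth_moll])
    also have "\<dots> = (\<integral>y. (G y \<bullet> b) * ?\<rho> (x - y) \<partial>lborel)"
    proof -
      have "vanishes_outside (norm x + \<delta> k) (\<lambda>y. ?\<rho> (x - y))"
        unfolding vanishes_outside_def
      proof (intro allI impI)
        fix y :: 'a assume "norm y > norm x + \<delta> k"
        then have "norm (x - y) > \<delta> k" using norm_triangle_ineq4[of x "x - y"] by simp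
        then show "?\<rho> (x - y) = 0" by (rule vanishes_outsideD[OF moll_outside[OF \<delta>(1)]])
      qed
      from weak[OF smooth_shifted_moll this b] show ?thesis by simp
    qed
    also have "\<dots> = conv (\<lambda>y. G y \<bullet> b) ?\<rho> x" by (simp add: conv_def)
    also have "\<dots> = conv (F b) ?\<rho> x"
      by (rule conv_local[OF moll_outside[OF \<delta>(1)]])
        (use \<delta>(2)[of k] that nonzero_Basis[OF b] in \<open>auto simp: F_def\<close>)
    finally show ?thesis .
  qed
  define S where "S x = real DIM('a) ^ n * (\<Sum>b\<in>Basis. 2 ^ n * (s b x + \<bar>F b x\<bar> ^ n))" for x
  have BB: "Basis \<subseteq> B0" "0 \<in> B0" by (auto simp: B0_def)
  show ?thesis
  proof (rule that[of U S])
    show "smooth (U k)" for k by (rule Us)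
    show "m \<le> U k x" "U k x \<le> M" for k x unfolding U_def using conv_moll_bounds[OF um ub \<delta>(1)] by auto
    show "integrable lborel S" unfolding S_def
      using s(1) Fi BB by (intro integrable_mult_right Bochner_Integration.integrable_sum Bochner_Integration.integrable_add) auto
    show "S x \<ge> 0" for x unfolding S_def using s(3) BB
      by (intro mult_nonneg_nonneg sum_nonneg add_nonneg_nonneg) auto
    show "AE x in lborel. norm x < K \<longrightarrow> (\<lambda>k. U k x) \<longlonglongrightarrow> u x \<and> (\<lambda>k. grad (U k) x) \<longlonglongrightarrow> G x \<and>
      (\<forall>k. norm (grad (U k) x) ^ n \<le> S x)"
      using AEall
    proof eventually_elim
      case (elim x)
      show ?case
      proof (intro impI conjI allI)
        assume x: "norm x < K"
        have lim: "(\<lambda>k. conv (F b) (moll (\<delta> k)) x) \<longlonglongrightarrow> F b x" if "b \<in> B0" for b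
        proof -
          have "(\<lambda>k. dd b k x) \<longlonglongrightarrow> 0" using bspec[OF elim that] by (rule conjunct1)
          then show ?thesis unfolding dd_def by (rule LIM_zero_cancel)
        qed
        show "(\<lambda>k. U k x) \<longlonglongrightarrow> u x" using lim[OF BB(2)] UF[OF x] x by (simp add: F_def)
        have FG: "F b x = G x \<bullet> b" if "b \<in> Basis" for b using x nonzero_Basis[OF that] by (simp add: F_def)
        have "(\<lambda>k. \<Sum>b\<in>Basis. (grad (U k) x \<bullet> b) *\<^sub>R b) \<longlonglongrightarrow> (\<Sum>b\<in>Basis. (G x \<bullet> b) *\<^sub>R b)"
        proof (intro tendsto_sum tendsto_scaleR tendsto_const)
          fix b :: 'a assume b: "b \<in> Basis"
          show "(\<lambda>k. grad (U k) x \<bullet> b) \<longlonglongrightarrow> G x \<bullet> b"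
            using lim[of b] b BB by (simp add: gradU[OF x b] FG[OF b] subset_iff)
        qed
        then show "(\<lambda>k. grad (U k) x) \<longlonglongrightarrow> G x" by (simp add: euclidean_representation)
        fix k
        have "norm (grad (U k) x) ^ n \<le> (\<Sum>b\<in>Basis. \<bar>grad (U k) x \<bullet> b\<bar>) ^ n"
          by (intro power_mono norm_le_l1) auto
        also have "\<dots> \<le> real DIM('a) ^ n * (\<Sum>b\<in>Basis. \<bar>grad (U k) x \<bullet> b\<bar> ^ n)"
          using power_sum_le[of "Basis :: 'a set" "\<lambda>b. \<bar>grad (U k) x \<bullet> b\<bar>" n] n by simp
        also have "\<dots> \<le> S x" unfolding S_def
        proof (intro mult_left_mono sum_mono)
          fix b :: 'a assume b: "b \<in> Basis"
          have "\<bar>grad (U k) x \<bullet> b\<bar> ^ n \<le> (\<bar>dd b k x\<bar> + \<bar>F b x\<bar>) ^ n"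
            by (intro power_mono) (auto simp: gradU[OF x b] dd_def)
          also have "\<dots> \<le> 2 ^ n * (\<bar>dd b k x\<bar> ^ n + \<bar>F b x\<bar> ^ n)" by (rule power_add_le) auto
          also have "\<dots> \<le> 2 ^ n * (s b x + \<bar>F b x\<bar> ^ n)" using elim b BB by (intro mult_left_mono add_mono) auto
          finally show "\<bar>grad (U k) x \<bullet> b\<bar> ^ n \<le> 2 ^ n * (s b x + \<bar>F b x\<bar> ^ n)" .
        qed auto
        finally show "norm (grad (U k) x) ^ n \<le> S x" .
      qed
    qed
  qed
qed

section \<open>Oscillation on the boundaries of cubes\<close>

definition upd :: "'a::euclidean_space \<Rightarrow> real \<Rightarrow> 'a \<Rightarrow> 'a" where
  "upd e c z = z + (c - z \<bullet> e) *\<^sub>R e"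

lemma upd_inner: "e \<in> Basis \<Longrightarrow> b \<in> Basis \<Longrightarrow> upd e c z \<bullet> b = (if b = e then c else z \<bullet> b)"
  by (simp add: upd_def inner_add_left inner_Basis)

lemma upd_same: "upd e (x \<bullet> e) x = x" by (simp add: upd_def)

lemma upd_measurable [measurable]: "upd e c \<in> borel_measurable borel"
  unfolding upd_def by measurable

text \<open>The face \<open>{z. z \<bullet> e = c}\<close> of a cube is parametrised redundantly by the whole cube, through
  \<open>upd e c\<close>, so that only integrals over the full space occur.\<close>

lemma slice_integral:
  fixes F :: "'a::euclidean_space \<Rightarrow> ennreal"
  assumes [measurable]: "F \<in> borel_measurable borel" and e: "e \<in> Basis" and r: "r \<ge> 0"
  shows "(\<integral>\<^sup>+c. (\<integral>\<^sup>+z. indicator {z. \<bar>z \<bullet> e\<bar> \<le> r} z * F (upd e c z) \<partial>lborel) \<partial>lborel)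
    = ennreal (2 * r) * (\<integral>\<^sup>+x. F x \<partial>lborel)"
proof -
  have ee: "e \<bullet> e = 1" using e by simp
  have "(\<integral>\<^sup>+c. (\<integral>\<^sup>+z. indicator {z. \<bar>z \<bullet> e\<bar> \<le> r} z * F (upd e c z) \<partial>lborel) \<partial>lborel)
    = (\<integral>\<^sup>+z. (\<integral>\<^sup>+c. indicator {z. \<bar>z \<bullet> e\<bar> \<le> r} z * F (upd e c z) \<partial>lborel) \<partial>lborel)"
    unfolding upd_def by (rule lborel_pair.Fubini') measurable
  \<comment> \<open>Two shears undo \<open>upd\<close>: c is shifted by the e-coordinate of z for
    fixed z, then z by c times e for fixed c. What is left of the redundant coordinate is an
    interval of length 2 r for c.\<close>
  also have "\<dots> = (\<integral>\<^sup>+z. (\<integral>\<^sup>+c. indicator {z. \<bar>z \<bullet> e\<bar> \<le> r} z * F (z + c *\<^sub>R e) \<partial>lborel) \<partial>lborel)"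
  proof (rule nn_integral_cong)
    fix z :: 'a
    show "(\<integral>\<^sup>+c. indicator {z. \<bar>z \<bullet> e\<bar> \<le> r} z * F (upd e c z) \<partial>lborel)
        = (\<integral>\<^sup>+c. indicator {z. \<bar>z \<bullet> e\<bar> \<le> r} z * F (z + c *\<^sub>R e) \<partial>lborel)"
      using nn_integral_translate[of "\<lambda>c. indicator {z. \<bar>z \<bullet> e\<bar> \<le> r} z * F (upd e c z)" "z \<bullet> e"]
      by (simp add: upd_def)
  qed
  also have "\<dots> = (\<integral>\<^sup>+c. (\<integral>\<^sup>+z. indicator {z. \<bar>z \<bullet> e\<bar> \<le> r} z * F (z + c *\<^sub>R e) \<partial>lborel) \<partial>lborel)"
    by (rule lborel_pair.Fubini') measurable
  also have "\<dots> = (\<integral>\<^sup>+c. (\<integral>\<^sup>+z. indicator {c. \<bar>z \<bullet> e - c\<bar> \<le> r} c * F z \<partial>lborel) \<partial>lborel)"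
  proof (rule nn_integral_cong)
    fix c :: real
    show "(\<integral>\<^sup>+z. indicator {z. \<bar>z \<bullet> e\<bar> \<le> r} z * F (z + c *\<^sub>R e) \<partial>lborel)
        = (\<integral>\<^sup>+z. indicator {c. \<bar>z \<bullet> e - c\<bar> \<le> r} c * F z \<partial>lborel)"
      using nn_integral_translate[of "\<lambda>z. indicator {c. \<bar>z \<bullet> e - c\<bar> \<le> r} c * F z" "c *\<^sub>R e"] ee
      by (simp add: inner_add_left indicator_def add.commute)
  qed
  also have "\<dots> = (\<integral>\<^sup>+z. (\<integral>\<^sup>+c. indicator {c. \<bar>z \<bullet> e - c\<bar> \<le> r} c * F z \<partial>lborel) \<partial>lborel)"
    by (rule lborel_pair.Fubini') measurable
  also have "\<dots> = (\<integral>\<^sup>+z. ennreal (2 * r) * F z \<partial>lborel)"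
  proof (rule nn_integral_cong)
    fix z :: 'a
    have "(\<integral>\<^sup>+c. indicator {c. \<bar>z \<bullet> e - c\<bar> \<le> r} c * F z \<partial>lborel)
       = (\<integral>\<^sup>+c. indicator {z \<bullet> e - r .. z \<bullet> e + r} c * F z \<partial>lborel)"
      by (rule nn_integral_cong) (auto simp: indicator_def)
    also have "\<dots> = ennreal (2 * r) * F z" using r by (subst nn_integral_multc) auto
    finally show "(\<integral>\<^sup>+c. indicator {c. \<bar>z \<bullet> e - c\<bar> \<le> r} c * F z \<partial>lborel) = ennreal (2 * r) * F z" .
  qed
  also have "\<dots> = ennreal (2 * r) * (\<integral>\<^sup>+x. F x \<partial>lborel)" by (rule nn_integral_cmult) simp
  finally show ?thesis .
qed

lemma path_bound:
  fixes \<phi> \<phi>' :: "real \<Rightarrow> real"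
  assumes d: "\<And>t. (\<phi> has_real_derivative \<phi>' t) (at t)" and c: "continuous_on UNIV \<phi>'"
  shows "ennreal \<bar>\<phi> 1 - \<phi> 0\<bar> \<le> (\<integral>\<^sup>+t. ennreal \<bar>\<phi>' t\<bar> * indicator {0..1} t \<partial>lborel)"
proof -
  have cc: "isCont \<phi>' t" for t using c by (simp add: continuous_on_eq_continuous_at)
  have h: "has_bochner_integral lborel (\<lambda>x. \<phi>' x * indicator {0 .. 1} x) (\<phi> 1 - \<phi> 0)"
    by (rule has_bochner_integral_FTC_Icc_real) (use d cc in auto)
  then have "norm (\<integral>x. \<phi>' x * indicator {0 .. 1} x \<partial>lborel) \<le> (\<integral>\<^sup>+x. norm (\<phi>' x * indicator {0 .. 1} x) \<partial>lborel)"
    by (intro integral_norm_bound_ennreal) (auto simp: has_bochner_integral_iff)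
  also have "(\<integral>\<^sup>+x. norm (\<phi>' x * indicator {0 .. 1::real} x) \<partial>lborel) = (\<integral>\<^sup>+t. ennreal \<bar>\<phi>' t\<bar> * indicator {0..1} t \<partial>lborel)"
    by (rule nn_integral_cong) (auto simp: indicator_def)
  finally show ?thesis using h by (simp add: has_bochner_integral_iff)
qed

text \<open>The contraction spares the direction e, the redundant coordinate of a face. The Jacobian
  is therefore the power DIM - 1 that belongs to the dimension of the face.\<close>

lemma nn_integral_scale_off:
  fixes g :: "'a::euclidean_space \<Rightarrow> ennreal"
  assumes [measurable]: "g \<in> borel_measurable borel" and e: "e \<in> Basis" and t: "t > 0"
  shows "ennreal (t ^ (DIM('a) - 1)) * (\<integral>\<^sup>+y. g (p + (\<Sum>j\<in>Basis. ((if j = e then 1 else t) * (y \<bullet> j)) *\<^sub>R j)) \<partial>lborel)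
    = (\<integral>\<^sup>+y. g y \<partial>lborel)"
proof -
  define c where "c j = (if j = e then 1 else t)" for j :: 'a
  define T where "T y = p + (\<Sum>j\<in>Basis. (c j * (y \<bullet> j)) *\<^sub>R j)" for y
  have [measurable]: "T \<in> borel_measurable borel" unfolding T_def by measurable
  have "(\<Prod>j\<in>Basis. \<bar>c j\<bar>) = (\<Prod>j\<in>Basis - {e}. t)"
    using e t unfolding c_def by (subst prod.remove[of _ e]) (auto intro!: prod.cong)
  also have "\<dots> = t ^ (DIM('a) - 1)" using e by simp
  finally have p: "(\<Prod>j\<in>Basis. \<bar>c j\<bar>) = t ^ (DIM('a) - 1)" .
  have "lborel = density (distr lborel borel T) (\<lambda>_. ennreal (\<Prod>j\<in>Basis. \<bar>c j\<bar>))"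
    unfolding T_def by (rule lborel_affine_euclidean) (use t in \<open>auto simp: c_def\<close>)
  then have "(\<integral>\<^sup>+y. g y \<partial>lborel) = (\<integral>\<^sup>+y. g y \<partial>(density (distr lborel borel T) (\<lambda>_. ennreal (t ^ (DIM('a) - 1)))))"
    unfolding p by simp
  also have "\<dots> = ennreal (t ^ (DIM('a) - 1)) * (\<integral>\<^sup>+y. g (T y) \<partial>lborel)"
    by (simp add: nn_integral_density nn_integral_distr nn_integral_cmult)
  finally show ?thesis unfolding T_def c_def by simp
qed

definition cub :: "real \<Rightarrow> 'a::euclidean_space set" where
  "cub s = {z. \<forall>b\<in>Basis. \<bar>z \<bullet> b\<bar> \<le> s}"

lemma cub_eq_cbox: "cub s = cbox (- (s *\<^sub>R One)) (s *\<^sub>R One)"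
proof (rule set_eqI)
  fix x :: 'a
  show "x \<in> cub s \<longleftrightarrow> x \<in> cbox (- (s *\<^sub>R One)) (s *\<^sub>R One)"
    unfolding cub_def mem_box mem_Collect_eq by (intro ball_cong refl) (simp, linarith)
qed

lemma cub_measurable [measurable]: "cub s \<in> sets borel"
  by (simp add: cub_eq_cbox)

lemma emeasure_cub: "s \<ge> 0 \<Longrightarrow> emeasure lborel (cub s :: 'a::euclidean_space set) = ennreal ((2 * s) ^ DIM('a))"
proof -
  assume s: "s \<ge> 0"
  have "(\<Prod>b\<in>Basis. (s *\<^sub>R One - - (s *\<^sub>R (One::'a))) \<bullet> b) = (\<Prod>b\<in>(Basis::'a set). 2 * s)"
    by (rule prod.cong) (auto simp: inner_add_left)
  then show ?thesis using s unfolding cub_eq_cbox by (subst emeasure_lborel_cbox) auto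
qed

text \<open>If a exceeds \<open>\<kappa>\<close>, then (a / \<open>\<kappa>\<close>)^(n - 1) is at
  least 1 and the second term alone suffices.\<close>

lemma young_split:
  fixes a \<kappa> :: real
  assumes "a \<ge> 0" "\<kappa> > 0" "n > 0"
  shows "a \<le> \<kappa> + a ^ n / \<kappa> ^ (n - 1)"
proof (cases "a \<le> \<kappa>")
  case True
  then show ?thesis using assms by (simp add: add_increasing2)
next
  case False
  then have "\<kappa> ^ (n - 1) \<le> a ^ (n - 1)" using assms by (intro power_mono) auto
  then have "a * \<kappa> ^ (n - 1) \<le> a * a ^ (n - 1)" using assms by (intro mult_left_mono) auto
  also have "\<dots> = a ^ n" using assms by (simp flip: power_Suc)
  finally have "a \<le> a ^ n / \<kappa> ^ (n - 1)" using assms by (simp add: pos_le_divide_eq)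
  then show ?thesis using assms by simp
qed

text \<open>Points \<open>x\<close> and \<open>y\<close> of a face are joined by the path \<open>x + \<tau> ^ n *\<^sub>R (y - x)\<close>. With this
  parametrisation and the Young weight \<open>1 / (s * \<tau> ^ (n - 1))\<close> the proof of Morrey's inequality needs no
  singular integral: the bound below times the speed \<open>n * \<tau> ^ (n - 1)\<close> does not depend on \<open>\<tau>\<close>.\<close>

lemma face_contraction_integral:
  fixes f :: "'a::euclidean_space \<Rightarrow> real"
  assumes f: "smooth f" and e: "e \<in> Basis" and s: "s > 0" and x: "x \<in> cub s" and \<tau>: "0 < \<tau>" "\<tau> \<le> 1"
    and n: "n = DIM('a)"
    and X: "(\<integral>\<^sup>+z. indicator (cub s) z * ennreal (norm (grad f (upd e c z)) ^ n) \<partial>lborel) \<le> ennreal X" "X \<ge> 0"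
  shows "(\<integral>\<^sup>+y. indicator (cub s) y * ennreal (norm (grad f (upd e c (x + \<tau> ^ n *\<^sub>R (y - x))))) \<partial>lborel)
    \<le> ennreal (s ^ (n - 1) / \<tau> ^ (n - 1) * (2 ^ n + X))"
proof -
  have [measurable]: "grad f \<in> borel_measurable borel" using smooth_grad_measurable[OF f] .
  have n0: "n > 0" using n by simp
  define t where "t = \<tau> ^ n"
  have t: "0 < t" "t \<le> 1" using \<tau> by (auto simp: t_def power_le_one)
  \<comment> \<open>As \<open>upd e c\<close> overwrites the e-coordinate, the contraction towards x
    need not touch it. \<open>T\<close> leaves it alone, yields the same point of the face, and has
    Jacobian t^(n - 1).\<close>
  define p where "p = (1 - t) *\<^sub>R (x - (x \<bullet> e) *\<^sub>R e)"
  define T where "T y = p + (\<Sum>j\<in>Basis. ((if j = e then 1 else t) * (y \<bullet> j)) *\<^sub>R j)" for y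
  have [measurable]: "T \<in> borel_measurable borel" unfolding T_def by measurable
  have Tb: "T y \<bullet> b = (if b = e then y \<bullet> e else x \<bullet> b + t * (y \<bullet> b - x \<bullet> b))" if "b \<in> Basis" for y b
    using that e by (auto simp: T_def p_def inner_add_left inner_diff_left inner_Basis algebra_simps)
  have Teq: "upd e c (T y) = upd e c (x + t *\<^sub>R (y - x))" for y
    by (rule euclidean_eqI) (use e in \<open>auto simp: upd_inner Tb inner_add_left inner_diff_left\<close>)
  have Tcub: "T y \<in> cub s" if "y \<in> cub s" for y
  proof -
    have "\<bar>x \<bullet> b + t * (y \<bullet> b - x \<bullet> b)\<bar> \<le> s" if "b \<in> Basis" for b
    proof -
      have "\<bar>(1 - t) * (x \<bullet> b) + t * (y \<bullet> b)\<bar> \<le> (1 - t) * s + t * s"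
        using x \<open>y \<in> cub s\<close> that t unfolding cub_def
        by (intro order_trans[OF abs_triangle_ineq] add_mono) (auto simp: abs_mult intro!: mult_left_mono)
      then show ?thesis by (simp add: algebra_simps)
    qed
    then show ?thesis using \<open>y \<in> cub s\<close> Tb e by (auto simp: cub_def)
  qed
  define F where "F z = ennreal (norm (grad f (upd e c z)) ^ n)" for z
  have [measurable]: "F \<in> borel_measurable borel" unfolding F_def by measurable
  define I where "I = (\<integral>\<^sup>+y. indicator (cub s) y * F (T y) \<partial>lborel)"
  have "ennreal (t ^ (n - 1)) * I \<le> ennreal (t ^ (n - 1)) * (\<integral>\<^sup>+y. indicator (cub s) (T y) * F (T y) \<partial>lborel)"
    unfolding I_def by (intro mult_left_mono nn_integral_mono mult_right_mono) (auto simp: indicator_def Tcub)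
  also have "\<dots> = (\<integral>\<^sup>+y. indicator (cub s) y * F y \<partial>lborel)"
    unfolding T_def n by (rule nn_integral_scale_off[of "\<lambda>z. indicator (cub s) z * F z", OF _ e t(1)]) measurable
  also have "\<dots> \<le> ennreal X" using X by (simp add: F_def)
  finally have "ennreal (t ^ (n - 1)) * I \<le> ennreal X" .
  then have "ennreal (1 / t ^ (n - 1)) * (ennreal (t ^ (n - 1)) * I) \<le> ennreal (1 / t ^ (n - 1)) * ennreal X"
    by (rule mult_left_mono) simp
  also have "ennreal (1 / t ^ (n - 1)) * (ennreal (t ^ (n - 1)) * I) = I"
    using t by (simp add: mult.assoc[symmetric] ennreal_mult'[symmetric])
  also have "ennreal (1 / t ^ (n - 1)) * ennreal X = ennreal (X / t ^ (n - 1))"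
    using t X by (simp add: ennreal_mult'[symmetric])
  finally have I: "I \<le> ennreal (X / t ^ (n - 1))" .
  define \<kappa> where "\<kappa> = 1 / (s * \<tau> ^ (n - 1))"
  have \<kappa>: "\<kappa> > 0" using s \<tau> by (simp add: \<kappa>_def)
  have "(\<integral>\<^sup>+y. indicator (cub s) y * ennreal (norm (grad f (upd e c (x + t *\<^sub>R (y - x))))) \<partial>lborel)
     \<le> (\<integral>\<^sup>+y. ennreal \<kappa> * indicator (cub s) y + ennreal (1 / \<kappa> ^ (n - 1)) * (indicator (cub s) y * F (T y)) \<partial>lborel)"
  proof (intro nn_integral_mono)
    fix y
    have "ennreal (norm (grad f (upd e c (T y)))) \<le> ennreal (\<kappa> + norm (grad f (upd e c (T y))) ^ n / \<kappa> ^ (n - 1))"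
      by (intro ennreal_leI young_split n0 \<kappa>) auto
    also have "\<dots> = ennreal \<kappa> + ennreal (1 / \<kappa> ^ (n - 1)) * F (T y)"
      using \<kappa> by (simp add: F_def ennreal_plus ennreal_mult'[symmetric])
    finally show "indicator (cub s) y * ennreal (norm (grad f (upd e c (x + t *\<^sub>R (y - x)))))
       \<le> ennreal \<kappa> * indicator (cub s) y + ennreal (1 / \<kappa> ^ (n - 1)) * (indicator (cub s) y * F (T y))"
      by (auto simp: indicator_def Teq)
  qed
  also have "\<dots> = (\<integral>\<^sup>+y. ennreal \<kappa> * indicator (cub s :: 'a set) y \<partial>lborel) + (\<integral>\<^sup>+y. ennreal (1 / \<kappa> ^ (n - 1)) * (indicator (cub s) y * F (T y)) \<partial>lborel)"
    by (rule nn_integral_add) measurable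
  also have "\<dots> = ennreal \<kappa> * ennreal ((2 * s) ^ n) + ennreal (1 / \<kappa> ^ (n - 1)) * I"
    unfolding I_def using s by (subst nn_integral_cmult, measurable) (simp add: nn_integral_cmult_indicator emeasure_cub n)
  also have "\<dots> \<le> ennreal \<kappa> * ennreal ((2 * s) ^ n) + ennreal (1 / \<kappa> ^ (n - 1)) * ennreal (X / t ^ (n - 1))"
    by (intro add_left_mono mult_left_mono I) auto
  also have "\<dots> = ennreal (\<kappa> * (2 * s) ^ n + 1 / \<kappa> ^ (n - 1) * (X / t ^ (n - 1)))"
    using \<kappa> s t X by (simp add: ennreal_mult'[symmetric] ennreal_plus[symmetric] del: ennreal_plus)
  also have "\<kappa> * (2 * s) ^ n + 1 / \<kappa> ^ (n - 1) * (X / t ^ (n - 1)) = s ^ (n - 1) / \<tau> ^ (n - 1) * (2 ^ n + X)"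
  proof -
    obtain m where m: "n = Suc m" using n0 gr0_implies_Suc by blast
    have 1: "\<kappa> * (2 * s) ^ n = s ^ m / \<tau> ^ m * 2 ^ n" using s \<tau> by (simp add: \<kappa>_def m power_mult_distrib)
    have "t ^ m = (\<tau> ^ m) ^ m * \<tau> ^ m" by (simp add: t_def m power_mult_distrib power_add flip: power_mult)
    moreover have "1 / \<kappa> ^ m = s ^ m * (\<tau> ^ m) ^ m" by (simp add: \<kappa>_def m power_mult_distrib power_divide)
    ultimately have 2: "1 / \<kappa> ^ m * (X / t ^ m) = s ^ m / \<tau> ^ m * X" using \<tau> by simp
    show ?thesis using 1 2 by (simp add: m distrib_left)
  qed
  finally show ?thesis by (simp add: t_def)
qed

text \<open>Integrate the derivative along the paths from x to y and exchange the integrals. The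
  constant collects n from the speed, the length bound 2 n s, and s^(n - 1) from
  \<open>face_contraction_integral\<close>.\<close>

lemma face_mean_oscillation:
  fixes f :: "'a::euclidean_space \<Rightarrow> real"
  assumes f: "smooth f" and e: "e \<in> Basis" and s: "s > 0" and x: "x \<in> cub s" and n: "n = DIM('a)"
    and X: "(\<integral>\<^sup>+z. indicator (cub s) z * ennreal (norm (grad f (upd e c z)) ^ n) \<partial>lborel) \<le> ennreal X" "X \<ge> 0"
  shows "(\<integral>\<^sup>+y. indicator (cub s) y * ennreal \<bar>f (upd e c y) - f (upd e c x)\<bar> \<partial>lborel)
    \<le> ennreal (2 * real n ^ 2 * s ^ n * (2 ^ n + X))"
proof -
  have [measurable]: "grad f \<in> borel_measurable borel" using smooth_grad_measurable[OF f] .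
  have n0: "n > 0" using n by simp
  define L where "L = 2 * real n * s"
  have L: "L \<ge> 0" using s by (simp add: L_def)
  define g where "g \<tau> y = norm (grad f (upd e c (x + \<tau> ^ n *\<^sub>R (y - x))))" for \<tau> y
  define w where "w \<tau> = real n * \<tau> ^ (n - 1) * L" for \<tau> :: real
  have path: "ennreal \<bar>f (upd e c y) - f (upd e c x)\<bar> \<le> (\<integral>\<^sup>+\<tau>. ennreal (w \<tau> * g \<tau> y) * indicator {0..1} \<tau> \<partial>lborel)"
    if y: "y \<in> cub s" for y
  proof -
    define \<gamma> where "\<gamma> \<tau> = upd e c (x + \<tau> ^ n *\<^sub>R (y - x))" for \<tau> :: real
    define v where "v = y - x - ((y - x) \<bullet> e) *\<^sub>R e"
    have \<gamma>: "(\<gamma> has_derivative (\<lambda>h. (h * (real n * \<tau> ^ (n - 1))) *\<^sub>R v)) (at \<tau>)" for \<tau>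
      unfolding \<gamma>_def upd_def v_def
      by (auto intro!: derivative_eq_intros simp: fun_eq_iff inner_add_left inner_diff_left algebra_simps)
    define \<phi>' where "\<phi>' \<tau> = real n * \<tau> ^ (n - 1) * (grad f (\<gamma> \<tau>) \<bullet> v)" for \<tau> :: real
    have d: "((\<lambda>\<tau>. f (\<gamma> \<tau>)) has_real_derivative \<phi>' \<tau>) (at \<tau>)" for \<tau>
      using has_derivative_compose[OF \<gamma>[of \<tau>] smooth_has_derivative[OF f]]
      unfolding has_field_derivative_def
      by (rule has_derivative_eq_rhs) (simp add: fun_eq_iff \<phi>'_def algebra_simps)
    have c: "continuous_on UNIV \<phi>'" unfolding \<phi>'_def \<gamma>_def upd_def
      by (intro continuous_intros continuous_on_compose2[OF smooth_continuous_grad[OF f]]) auto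
    have vL: "norm v \<le> L"
    proof -
      have "norm v \<le> (\<Sum>b\<in>Basis. \<bar>v \<bullet> b\<bar>)" by (rule norm_le_l1)
      also have "\<dots> \<le> (\<Sum>b\<in>(Basis::'a set). 2 * s)"
      proof (rule sum_mono)
        fix b :: 'a assume b: "b \<in> Basis"
        have "\<bar>x \<bullet> b\<bar> \<le> s" "\<bar>y \<bullet> b\<bar> \<le> s" using x y b by (auto simp: cub_def)
        then show "\<bar>v \<bullet> b\<bar> \<le> 2 * s" using b e s by (auto simp: v_def inner_diff_left inner_Basis)
      qed
      also have "\<dots> = L" by (simp add: L_def n)
      finally show ?thesis .
    qed
    have "ennreal \<bar>f (\<gamma> 1) - f (\<gamma> 0)\<bar> \<le> (\<integral>\<^sup>+\<tau>. ennreal \<bar>\<phi>' \<tau>\<bar> * indicator {0..1} \<tau> \<partial>lborel)"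
      by (rule path_bound[OF d c])
    also have "\<dots> \<le> (\<integral>\<^sup>+\<tau>. ennreal (w \<tau> * g \<tau> y) * indicator {0..1} \<tau> \<partial>lborel)"
    proof (intro nn_integral_mono)
      fix \<tau> :: real
      show "ennreal \<bar>\<phi>' \<tau>\<bar> * indicator {0..1} \<tau> \<le> ennreal (w \<tau> * g \<tau> y) * indicator {0..1} \<tau>"
      proof (cases "\<tau> \<in> {0..1}")
        case True
        have "\<bar>grad f (\<gamma> \<tau>) \<bullet> v\<bar> \<le> norm (grad f (\<gamma> \<tau>)) * L"
          using Cauchy_Schwarz_ineq2[of "grad f (\<gamma> \<tau>)" v] mult_left_mono[OF vL norm_ge_zero, of "grad f (\<gamma> \<tau>)"] by linarith
        then have "real n * \<tau> ^ (n - 1) * \<bar>grad f (\<gamma> \<tau>) \<bullet> v\<bar> \<le> real n * \<tau> ^ (n - 1) * (norm (grad f (\<gamma> \<tau>)) * L)"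
          using True by (intro mult_left_mono) auto
        then have "\<bar>\<phi>' \<tau>\<bar> \<le> w \<tau> * g \<tau> y"
          using True by (simp add: \<phi>'_def w_def g_def \<gamma>_def abs_mult algebra_simps)
        then show ?thesis by (intro mult_right_mono ennreal_leI) auto
      qed simp
    qed
    finally show ?thesis using n0 by (simp add: \<gamma>_def zero_power)
  qed
  have "(\<integral>\<^sup>+y. indicator (cub s) y * ennreal \<bar>f (upd e c y) - f (upd e c x)\<bar> \<partial>lborel)
     \<le> (\<integral>\<^sup>+y. (\<integral>\<^sup>+\<tau>. indicator (cub s) y * (ennreal (w \<tau> * g \<tau> y) * indicator {0..1} \<tau>) \<partial>lborel) \<partial>lborel)"
    by (intro nn_integral_mono) (use path in \<open>auto simp: indicator_def\<close>)
  also have "\<dots> = (\<integral>\<^sup>+\<tau>. (\<integral>\<^sup>+y. indicator (cub s) y * (ennreal (w \<tau> * g \<tau> y) * indicator {0..1} \<tau>) \<partial>lborel) \<partial>lborel)"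
    unfolding w_def g_def upd_def by (rule lborel_pair.Fubini') measurable
  also have "\<dots> \<le> (\<integral>\<^sup>+\<tau>. ennreal (real n * L * (s ^ (n - 1) * (2 ^ n + X))) * indicator {0..1::real} \<tau> \<partial>lborel)"
  proof (rule nn_integral_mono_AE)
    have "AE \<tau> in lborel. \<tau> \<noteq> (0::real)" by (rule AE_lborel_singleton)
    then show "AE \<tau> in lborel. (\<integral>\<^sup>+y. indicator (cub s) y * (ennreal (w \<tau> * g \<tau> y) * indicator {0..1} \<tau>) \<partial>lborel)
        \<le> ennreal (real n * L * (s ^ (n - 1) * (2 ^ n + X))) * indicator {0..1::real} \<tau>"
    proof eventually_elim
      case (elim \<tau>)
      show ?case
      proof (cases "\<tau> \<in> {0..1}")
        case True
        then have \<tau>: "0 < \<tau>" "\<tau> \<le> 1" using elim by auto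
        have w0: "w \<tau> \<ge> 0" using \<tau> L by (simp add: w_def)
        have [measurable]: "g \<tau> \<in> borel_measurable borel" unfolding g_def by measurable
        have "(\<integral>\<^sup>+y. indicator (cub s) y * (ennreal (w \<tau> * g \<tau> y) * indicator {0..1} \<tau>) \<partial>lborel)
           = (\<integral>\<^sup>+y. ennreal (w \<tau>) * (indicator (cub s) y * ennreal (g \<tau> y)) \<partial>lborel)"
          using True w0 by (intro nn_integral_cong) (simp add: ennreal_mult' mult_ac)
        also have "\<dots> = ennreal (w \<tau>) * (\<integral>\<^sup>+y. indicator (cub s) y * ennreal (g \<tau> y) \<partial>lborel)"
          by (rule nn_integral_cmult) measurable
        also have "\<dots> \<le> ennreal (w \<tau>) * ennreal (s ^ (n - 1) / \<tau> ^ (n - 1) * (2 ^ n + X))"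
          unfolding g_def by (intro mult_left_mono face_contraction_integral[OF f e s x \<tau> n X]) simp
        also have "\<dots> = ennreal (w \<tau> * (s ^ (n - 1) / \<tau> ^ (n - 1) * (2 ^ n + X)))" by (rule ennreal_mult'[OF w0, symmetric])
        also have "w \<tau> * (s ^ (n - 1) / \<tau> ^ (n - 1) * (2 ^ n + X)) = real n * L * (s ^ (n - 1) * (2 ^ n + X))"
          using \<tau> by (simp add: w_def)
        finally show ?thesis using True by simp
      qed simp
    qed
  qed
  also have "\<dots> = ennreal (real n * L * (s ^ (n - 1) * (2 ^ n + X)))"
    by (subst nn_integral_cmult_indicator) auto
  also have "real n * L * (s ^ (n - 1) * (2 ^ n + X)) = 2 * real n ^ 2 * s ^ n * (2 ^ n + X)"
  proof -
    have "s ^ n = s * s ^ (n - 1)" using n0 by (simp flip: power_Suc)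
    then show ?thesis by (simp add: L_def power2_eq_square)
  qed
  finally show ?thesis .
qed

text \<open>Averaging |f x - f x'| <= |f y - f x| + |f y - f x'| over all y in the cube bounds it by
  two mean oscillations. The factor s^n cancels against the volume, so the bound does not depend on
  the size of the cube.\<close>

lemma face_oscillation:
  fixes f :: "'a::euclidean_space \<Rightarrow> real"
  assumes f: "smooth f" and e: "e \<in> Basis" and s: "s > 0" and x: "x \<in> cub s" "x' \<in> cub s" and n: "n = DIM('a)"
    and X: "(\<integral>\<^sup>+z. indicator (cub s) z * ennreal (norm (grad f (upd e c z)) ^ n) \<partial>lborel) \<le> ennreal X" "X \<ge> 0"
  shows "\<bar>f (upd e c x) - f (upd e c x')\<bar> \<le> 4 * real n ^ 2 * (2 ^ n + X)"
proof -
  have [measurable]: "f \<in> borel_measurable borel" using smooth_measurable[OF f] .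
  define J where "J = 2 * real n ^ 2 * s ^ n * (2 ^ n + X)"
  have J0: "J \<ge> 0" using s X by (simp add: J_def)
  define a where "a = \<bar>f (upd e c x) - f (upd e c x')\<bar>"
  have "ennreal (a * (2 * s) ^ n) = (\<integral>\<^sup>+y. ennreal a * indicator (cub s) y \<partial>(lborel :: 'a measure))"
    using s by (subst nn_integral_cmult_indicator) (auto simp: emeasure_cub n ennreal_mult' a_def)
  also have "\<dots> \<le> (\<integral>\<^sup>+y. indicator (cub s) y * ennreal \<bar>f (upd e c y) - f (upd e c x)\<bar>
      + indicator (cub s) y * ennreal \<bar>f (upd e c y) - f (upd e c x')\<bar> \<partial>lborel)"
  proof (rule nn_integral_mono)
    fix y
    have "ennreal a \<le> ennreal (\<bar>f (upd e c y) - f (upd e c x)\<bar> + \<bar>f (upd e c y) - f (upd e c x')\<bar>)"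
      by (rule ennreal_leI) (simp add: a_def)
    then show "ennreal a * indicator (cub s) y \<le> indicator (cub s) y * ennreal \<bar>f (upd e c y) - f (upd e c x)\<bar>
      + indicator (cub s) y * ennreal \<bar>f (upd e c y) - f (upd e c x')\<bar>"
      by (auto simp: indicator_def)
  qed
  also have "\<dots> = (\<integral>\<^sup>+y. indicator (cub s) y * ennreal \<bar>f (upd e c y) - f (upd e c x)\<bar> \<partial>lborel)
      + (\<integral>\<^sup>+y. indicator (cub s) y * ennreal \<bar>f (upd e c y) - f (upd e c x')\<bar> \<partial>lborel)"
    by (rule nn_integral_add) measurable
  also have "\<dots> \<le> ennreal J + ennreal J"
    unfolding J_def by (intro add_mono face_mean_oscillation[OF f e s _ n X] x)
  also have "\<dots> = ennreal (2 * J)" using J0 by (simp flip: ennreal_plus)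
  finally have "a * (2 * s) ^ n \<le> 2 * J" using J0 by (subst (asm) ennreal_le_iff) auto
  then have "a * 2 ^ n * s ^ n \<le> 4 * real n ^ 2 * (2 ^ n + X) * s ^ n"
    by (simp add: J_def power_mult_distrib algebra_simps)
  then have "a * 2 ^ n \<le> 4 * real n ^ 2 * (2 ^ n + X)" using s by simp
  moreover have "a * 1 \<le> a * 2 ^ n" by (intro mult_left_mono) (auto simp: a_def)
  ultimately show ?thesis by (simp add: a_def)
qed

section \<open>Assembling the faces into the boundary of a cube\<close>

lemma infnorm_le_iff: "infnorm (x::'a::euclidean_space) \<le> s \<longleftrightarrow> x \<in> cub s"
  by (auto simp: infnorm_Max cub_def Max_le_iff)

lemma infnorm_attained:
  fixes x :: "'a::euclidean_space"
  obtains b where "b \<in> Basis" "\<bar>x \<bullet> b\<bar> = infnorm x"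
proof -
  have "Max ((\<lambda>i. \<bar>x \<bullet> i\<bar>) ` Basis) \<in> (\<lambda>i. \<bar>x \<bullet> i\<bar>) ` (Basis :: 'a set)" by (rule Max_in) auto
  then obtain b where "b \<in> Basis" "Max ((\<lambda>i. \<bar>x \<bullet> i\<bar>) ` Basis) = \<bar>x \<bullet> b\<bar>" by (elim imageE)
  then show ?thesis using that[of b] by (simp add: infnorm_Max)
qed

lemma infnorm_eqI:
  fixes x :: "'a::euclidean_space"
  assumes "x \<in> cub s" "b \<in> Basis" "\<bar>x \<bullet> b\<bar> = s"
  shows "infnorm x = s"
  using assms Basis_le_infnorm[of b x] infnorm_le_iff[of x s] by auto

text \<open>This is Gehring's oscillation lemma, for the boundaries of cubes instead of spheres.\<close>

lemma good_cube:
  fixes E0 :: real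
  assumes E0: "E0 \<ge> 0" and dim: "DIM('a::euclidean_space) \<ge> 2"
  shows "\<exists>K. \<forall>R>0. \<forall>f::'a \<Rightarrow> real. smooth f \<longrightarrow>
    (\<integral>\<^sup>+x. indicator {x. R \<le> infnorm x \<and> infnorm x \<le> 2 * R} x * ennreal (norm (grad f x) ^ DIM('a)) \<partial>lborel) \<le> ennreal E0 \<longrightarrow>
    (\<exists>s. R \<le> s \<and> s \<le> 2 * R \<and> (\<forall>x y. infnorm x = s \<longrightarrow> infnorm y = s \<longrightarrow> \<bar>f x - f y\<bar> \<le> K))"
proof -
  define n where "n = DIM('a)"
  \<comment> \<open>By \<open>slice_integral\<close> with slabs of half-width 2 R, each pair of
    opposite faces contributes at most 8 R \<open>E0\<close> when integrated over s. For n
    directions this is (X - 1) R, less than X times the length R of the range of s, so some s has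
    all its face integrals at most X. Thanks to the redundant coordinate these integrals are scale
    invariant, and X does not involve R.\<close>
  define X where "X = 8 * real n * E0 + 1"
  define K0 where "K0 = 4 * real n ^ 2 * (2 ^ n + X)"
  have X0: "X \<ge> 0" using E0 by (simp add: X_def)
  show ?thesis
  proof (rule exI[of _ "4 * K0"], intro allI impI)
    fix R :: real and f :: "'a \<Rightarrow> real"
    assume R: "R > 0" and f: "smooth f"
      and E: "(\<integral>\<^sup>+x. indicator {x. R \<le> infnorm x \<and> infnorm x \<le> 2 * R} x * ennreal (norm (grad f x) ^ DIM('a)) \<partial>lborel) \<le> ennreal E0"
    have [measurable]: "grad f \<in> borel_measurable borel" using smooth_grad_measurable[OF f] .
    have [measurable]: "(infnorm :: 'a \<Rightarrow> real) \<in> borel_measurable borel"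
      by (intro borel_measurable_continuous_onI continuous_on_infnorm continuous_on_id)
    define F where "F x = indicator {x. R \<le> infnorm x \<and> infnorm x \<le> 2 * R} x * ennreal (norm (grad f x) ^ n)" for x
    have [measurable]: "F \<in> borel_measurable borel" unfolding F_def by measurable
    define I where "I e c = (\<integral>\<^sup>+z. indicator {z. \<bar>z \<bullet> e\<bar> \<le> 2 * R} z * F (upd e c z) \<partial>lborel)" for e :: 'a and c
    have Im [measurable]: "I e \<in> borel_measurable borel" for e unfolding I_def upd_def by measurable
    have II: "(\<integral>\<^sup>+c. I e c \<partial>lborel) \<le> ennreal (4 * R * E0)" if "e \<in> Basis" for e
    proof -
      have "(\<integral>\<^sup>+c. I e c \<partial>lborel) = ennreal (2 * (2 * R)) * (\<integral>\<^sup>+x. F x \<partial>lborel)"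
        unfolding I_def by (rule slice_integral) (use that R in auto)
      also have "\<dots> \<le> ennreal (2 * (2 * R)) * ennreal E0"
        using E by (intro mult_left_mono) (auto simp: F_def n_def)
      finally show ?thesis using R E0 by (simp add: ennreal_mult'[symmetric])
    qed
    have II': "(\<integral>\<^sup>+c. I e (- c) \<partial>lborel) \<le> ennreal (4 * R * E0)" if "e \<in> Basis" for e
      using nn_integral_real_affine[of "I e" "-1" 0] II[OF that] by simp
    have "\<exists>s. R \<le> s \<and> s \<le> 2 * R \<and> (\<Sum>e\<in>Basis. I e s + I e (- s)) \<le> ennreal X"
    proof (rule ccontr)
      assume "\<not> ?thesis"
      then have c: "ennreal X \<le> (\<Sum>e\<in>Basis. I e s + I e (- s))" if "R \<le> s" "s \<le> 2 * R" for s
        using that by (meson linear)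
      have "ennreal (X * R) = (\<integral>\<^sup>+s. ennreal X * indicator {R..2*R} s \<partial>lborel)"
        using R X0 by (subst nn_integral_cmult_indicator) (auto simp: ennreal_mult')
      also have "\<dots> \<le> (\<integral>\<^sup>+s. (\<Sum>e\<in>Basis. I e s + I e (- s)) \<partial>lborel)"
        by (rule nn_integral_mono) (use c in \<open>auto simp: indicator_def\<close>)
      also have "\<dots> = (\<Sum>e\<in>Basis. (\<integral>\<^sup>+s. I e s + I e (- s) \<partial>lborel))"
        by (rule nn_integral_sum) measurable
      also have "\<dots> \<le> (\<Sum>e\<in>(Basis::'a set). ennreal (8 * R * E0))"
      proof (rule sum_mono)
        fix e :: 'a assume e: "e \<in> Basis"
        have "(\<integral>\<^sup>+s. I e s + I e (- s) \<partial>lborel) = (\<integral>\<^sup>+s. I e s \<partial>lborel) + (\<integral>\<^sup>+s. I e (- s) \<partial>lborel)"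
          by (rule nn_integral_add) measurable
        also have "\<dots> \<le> ennreal (4 * R * E0) + ennreal (4 * R * E0)" using II[OF e] II'[OF e] by (rule add_mono)
        also have "\<dots> = ennreal (8 * R * E0)" using R E0 by (simp flip: ennreal_plus)
        finally show "(\<integral>\<^sup>+s. I e s + I e (- s) \<partial>lborel) \<le> ennreal (8 * R * E0)" .
      qed
      also have "\<dots> = ennreal (real n * (8 * R * E0))" by (simp add: n_def ennreal_mult'' ennreal_of_nat_eq_real_of_nat R E0 less_imp_le)
      finally have "X * R \<le> real n * (8 * R * E0)" using R E0 by (subst (asm) ennreal_le_iff) auto
      then show False using R by (simp add: X_def algebra_simps)
    qed
    then obtain s where s: "R \<le> s" "s \<le> 2 * R" "(\<Sum>e\<in>Basis. I e s + I e (- s)) \<le> ennreal X" by blast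
    have s0: "s > 0" using s R by linarith
    have Xe: "(\<integral>\<^sup>+z. indicator (cub s) z * ennreal (norm (grad f (upd e c z)) ^ n) \<partial>lborel) \<le> ennreal X"
      if e: "e \<in> Basis" and c: "c = s \<or> c = - s" for e c
    proof -
      have "(\<integral>\<^sup>+z. indicator (cub s) z * ennreal (norm (grad f (upd e c z)) ^ n) \<partial>lborel) \<le> I e c"
        unfolding I_def
      proof (rule nn_integral_mono)
        fix z
        show "indicator (cub s) z * ennreal (norm (grad f (upd e c z)) ^ n) \<le> indicator {z. \<bar>z \<bullet> e\<bar> \<le> 2 * R} z * F (upd e c z)"
        proof (cases "z \<in> cub s")
          case True
          have "infnorm (upd e c z) = s"
            by (rule infnorm_eqI[of _ _ e]) (use True e c s0 in \<open>auto simp: cub_def upd_inner\<close>)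
          moreover have "\<bar>z \<bullet> e\<bar> \<le> 2 * R" using True e s by (force simp: cub_def)
          ultimately show ?thesis using s by (simp add: F_def indicator_def)
        qed simp
      qed
      also have "\<dots> \<le> I e s + I e (- s)" using c by auto
      also have "\<dots> \<le> (\<Sum>e\<in>Basis. I e s + I e (- s))" by (rule member_le_sum) (use e in auto)
      finally show ?thesis using s(3) by simp
    qed
    have osc: "\<bar>f x - f y\<bar> \<le> K0" if "e \<in> Basis" "c = s \<or> c = - s" "x \<in> cub s" "y \<in> cub s" "x \<bullet> e = c" "y \<bullet> e = c" for x y e c
      using face_oscillation[OF f that(1) s0 that(3,4) n_def Xe[OF that(1,2)] X0] upd_same[of e x] upd_same[of e y] that(5,6)
      by (simp add: K0_def)
    have K0: "K0 \<ge> 0" using X0 by (simp add: K0_def)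
    \<comment> \<open>Faces with different normals meet: z takes its e-coordinate from x and its
      e'-coordinate from y, the others being zero, and lies on both faces.\<close>
    have adj: "\<bar>f x - f y\<bar> \<le> 2 * K0" if "e \<in> Basis" "\<bar>x \<bullet> e\<bar> = s" "e' \<in> Basis" "\<bar>y \<bullet> e'\<bar> = s" "e \<noteq> e'" "x \<in> cub s" "y \<in> cub s" for x y e e'
    proof -
      define z where "z = (x \<bullet> e) *\<^sub>R e + (y \<bullet> e') *\<^sub>R e'"
      have ze: "z \<bullet> e = x \<bullet> e" "z \<bullet> e' = y \<bullet> e'" using that by (auto simp: z_def inner_add_left inner_Basis)
      have "z \<in> cub s" using that s0 by (auto simp: cub_def z_def inner_add_left inner_Basis)
      then have "\<bar>f x - f z\<bar> \<le> K0" "\<bar>f z - f y\<bar> \<le> K0"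
        using osc[of e "x \<bullet> e" x z] osc[of e' "y \<bullet> e'" z y] that ze by (auto simp: abs_if split: if_splits)
      then show ?thesis by linarith
    qed
    show "\<exists>s. R \<le> s \<and> s \<le> 2 * R \<and> (\<forall>x y. infnorm x = s \<longrightarrow> infnorm y = s \<longrightarrow> \<bar>f x - f y\<bar> \<le> 4 * K0)"
    proof (rule exI[of _ s], intro conjI allI impI s)
      fix x y :: 'a assume xy: "infnorm x = s" "infnorm y = s"
      have c: "x \<in> cub s" "y \<in> cub s" using xy infnorm_le_iff by (metis order_refl)+
      obtain e where e: "e \<in> Basis" "\<bar>x \<bullet> e\<bar> = s" using infnorm_attained[of x] xy by metis
      obtain e' where e': "e' \<in> Basis" "\<bar>y \<bullet> e'\<bar> = s" using infnorm_attained[of y] xy by metis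
      show "\<bar>f x - f y\<bar> \<le> 4 * K0"
      proof (cases "e = e'")
        case False
        then show ?thesis using adj[OF e e' False c] K0 by linarith
      next
        case True
        \<comment> \<open>On the same or on opposite faces, go through a face with another normal b,
          which exists in dimension at least 2. Two adjacent pairs give the total 4
          \<open>K0\<close>.\<close>
        have "\<exists>b\<in>Basis. b \<noteq> e"
        proof (rule ccontr)
          assume "\<not> ?thesis"
          then have "(Basis :: 'a set) \<subseteq> {e}" by auto
          then have "DIM('a) \<le> 1" using card_mono[of "{e}" "Basis :: 'a set"] by simp
          then show False using dim by simp
        qed
        then obtain b where b: "b \<in> Basis" "b \<noteq> e" by blast
        have z: "s *\<^sub>R b \<in> cub s" "\<bar>(s *\<^sub>R b) \<bullet> b\<bar> = s" using b s0 by (auto simp: cub_def inner_Basis)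
        have "\<bar>f x - f (s *\<^sub>R b)\<bar> \<le> 2 * K0" "\<bar>f (s *\<^sub>R b) - f y\<bar> \<le> 2 * K0"
          using adj[OF e b(1) z(2) _ c(1) z(1)] adj[OF b(1) z(2) e' _ z(1) c(2)] b True by auto
        then show ?thesis by linarith
      qed
    qed
  qed
qed

section \<open>Weak solutions\<close>

text \<open>Young's inequality with a crude constant: the larger of y and \<open>\<delta>\<close> x
  decides which term alone is sufficient. The small factor \<open>\<delta>\<close> is what allows
  absorption into the coercive term.\<close>

lemma young_product:
  fixes x y \<delta> :: real
  assumes "x \<ge> 0" "y \<ge> 0" "\<delta> > 0" "n > 0"
  shows "x ^ (n - 1) * y \<le> \<delta> * x ^ n + y ^ n / \<delta> ^ (n - 1)"
proof -
  obtain k where k: "n = Suc k" using assms gr0_implies_Suc by blast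
  show ?thesis
  proof (cases "y \<le> \<delta> * x")
    case True
    then have "x ^ k * y \<le> x ^ k * (\<delta> * x)" using assms by (intro mult_left_mono) auto
    moreover have "0 \<le> y ^ n / \<delta> ^ k" using assms by simp
    ultimately show ?thesis by (simp add: k mult_ac)
  next
    case False
    then have "x \<le> y / \<delta>" using assms by (simp add: pos_le_divide_eq mult.commute)
    then have "x ^ k * y \<le> (y / \<delta>) ^ k * y" using assms by (intro mult_right_mono power_mono) auto
    moreover have "0 \<le> \<delta> * x ^ n" using assms by simp
    ultimately show ?thesis by (simp add: k power_divide mult_ac)
  qed
qed

lemma infnorm_measurable [measurable]: "(infnorm :: 'a::euclidean_space \<Rightarrow> real) \<in> borel_measurable borel"
  by (intro borel_measurable_continuous_onI continuous_on_infnorm continuous_on_id)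

lemma infnorm_frontier: "frontier {x::'a::euclidean_space. infnorm x < s} \<subseteq> {x. infnorm x = s}"
proof -
  have c: "continuous_on UNIV (infnorm :: 'a \<Rightarrow> real)" by (intro continuous_on_infnorm continuous_on_id)
  have "open {x::'a. infnorm x < s}" "closed {x::'a. infnorm x \<le> s}"
    using c by (auto intro: open_Collect_less closed_Collect_le continuous_on_const)
  then have "frontier {x::'a. infnorm x < s} \<subseteq> {x. infnorm x \<le> s} - {x. infnorm x < s}"
    unfolding frontier_def interior_open[OF \<open>open _\<close>]
    by (intro Diff_mono closure_minimal) auto
  then show ?thesis by auto
qed

text \<open>Cut-offs to cubes of varying size converge away from the boundary of the limit cube;
  that boundary is a null set and can be ignored.\<close>

lemma AE_infnorm_neq: "AE x in (lborel :: 'a::euclidean_space measure). infnorm x \<noteq> s"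
proof (cases "s > 0")
  case True
  have e: "emeasure lborel (cub s - box (- (s *\<^sub>R One)) (s *\<^sub>R One) :: 'a set) = 0"
  proof -
    have "(\<Prod>b\<in>Basis. (s *\<^sub>R One - - (s *\<^sub>R (One::'a))) \<bullet> b) = (\<Prod>b\<in>(Basis::'a set). 2 * s)"
      by (rule prod.cong) (auto simp: inner_add_left)
    then have "emeasure lborel (box (- (s *\<^sub>R One)) (s *\<^sub>R One) :: 'a set) = ennreal ((2 * s) ^ DIM('a))"
      using True by (subst emeasure_lborel_box) auto
    then show ?thesis using True
      by (subst emeasure_Diff) (auto simp: emeasure_cub cub_eq_cbox box_subset_cbox)
  qed
  have "AE x in (lborel :: 'a measure). x \<notin> cub s - box (- (s *\<^sub>R One)) (s *\<^sub>R One)"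
    by (rule AE_not_in) (use e in \<open>auto simp: null_sets_def\<close>)
  then show ?thesis
  proof eventually_elim
    case (elim x)
    show ?case
    proof
      assume i: "infnorm x = s"
      then have "x \<in> cub s" using infnorm_le_iff[of x s] by simp
      moreover obtain b where "b \<in> Basis" "\<bar>x \<bullet> b\<bar> = s" using infnorm_attained[of x] i by metis
      then have "x \<notin> box (- (s *\<^sub>R One)) (s *\<^sub>R One)"
        by (auto simp: mem_box intro!: bexI[of _ b])
      ultimately show False using elim by simp
    qed
  qed
next
  case False
  have "AE x in (lborel :: 'a measure). x \<noteq> 0" by (rule AE_lborel_singleton)
  then show ?thesis
  proof eventually_elim
    case (elim x)
    then show ?case using False infnorm_pos_lt[of x] by auto
  qed
qed

lemma norm_le_infnorm_DIM: "norm (x::'a::euclidean_space) \<le> real DIM('a) * infnorm x"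
proof -
  have "norm x \<le> (\<Sum>b\<in>Basis. \<bar>x \<bullet> b\<bar>)" by (rule norm_le_l1)
  also have "\<dots> \<le> (\<Sum>b\<in>(Basis::'a set). infnorm x)" by (intro sum_mono Basis_le_infnorm)
  finally show ?thesis by simp
qed

section \<open>Truncated test functions on cubes and the translation inequality\<close>

lemma flat_abs_bound:
  assumes a: "a > 0" and t: "\<bar>t\<bar> \<le> L"
  shows "flat a j t \<le> (real (j + 2) / a) ^ (j + 2) * L\<^sup>2"
proof -
  have "flat a j t \<le> (real (j + 2) / a) ^ (j + 2) * t\<^sup>2" by (rule flat_le_square[OF a])
  also have "\<dots> \<le> (real (j + 2) / a) ^ (j + 2) * L\<^sup>2"
    using a t by (intro mult_left_mono) (auto simp: power2_le_iff_abs_le order_trans[OF abs_ge_zero t])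
  finally show ?thesis .
qed

definition dflat :: "real \<Rightarrow> nat \<Rightarrow> real \<Rightarrow> real" where
  "dflat a j t = a * flat a (j + 2) t - real j * flat a (j + 1) t"

lemma flat_bounded_on:
  assumes a: "a > 0"
  obtains C where "C \<ge> 0" "\<And>t. \<bar>t\<bar> \<le> L \<Longrightarrow> \<bar>flat a j t\<bar> \<le> C \<and> \<bar>dflat a j t\<bar> \<le> C"
proof -
  define c where "c i = (real (i + 2) / a) ^ (i + 2) * L\<^sup>2" for i :: nat
  have c0: "c i \<ge> 0" for i using a by (simp add: c_def)
  define C where "C = c j + (a * c (j + 2) + real j * c (j + 1))"
  have p: "a * c (j + 2) \<ge> 0" "real j * c (j + 1) \<ge> 0" using a c0 by auto
  show ?thesis
  proof (rule that[of C])
    show "C \<ge> 0" unfolding C_def using p c0[of j] by linarith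
    fix t assume t: "\<bar>t\<bar> \<le> L"
    have b: "0 \<le> flat a i t" "flat a i t \<le> c i" for i
      unfolding c_def using flat_nonneg flat_abs_bound[OF a t] by auto
    have "a * flat a (j + 2) t \<le> a * c (j + 2)" "real j * flat a (j + 1) t \<le> real j * c (j + 1)"
      using a b by (auto intro: mult_left_mono)
    moreover have "0 \<le> a * flat a (j + 2) t" "0 \<le> real j * flat a (j + 1) t" using a b by auto
    ultimately show "\<bar>flat a j t\<bar> \<le> C \<and> \<bar>dflat a j t\<bar> \<le> C"
      unfolding C_def dflat_def using b[of j] p c0[of j] by (auto simp: abs_le_iff)
  qed
qed

lemma grad_flat_comp:
  assumes a: "a > 0" and U: "smooth U"
  shows "grad (\<lambda>x. flat a j (U x - d)) x = dflat a j (U x - d) *\<^sub>R grad U x"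
proof (rule grad_eqI)
  have "((\<lambda>x. U x - d) has_derivative (\<lambda>h. grad U x \<bullet> h)) (at x)"
    using smooth_has_derivative[OF U] by (auto intro!: derivative_eq_intros)
  from has_derivative_compose[OF this, of "flat a j" "\<lambda>h. dflat a j (U x - d) * h"]
    flat_has_derivative[OF a, of j "U x - d"]
  have "((\<lambda>x. flat a j (U x - d)) has_derivative (\<lambda>h. dflat a j (U x - d) * (grad U x \<bullet> h))) (at x)"
    by (simp add: has_field_derivative_def dflat_def)
  then show "((\<lambda>x. flat a j (U x - d)) has_derivative (\<bullet>) (dflat a j (U x - d) *\<^sub>R grad U x)) (at x)"
    by (rule has_derivative_eq_rhs) (simp add: fun_eq_iff)
qed

text \<open>The boundary of the cube lies in the open set where U < d, and there the truncation is
  zero, so cutting off at the boundary preserves smoothness. The strict inequality makes sense at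
  every boundary point because U is continuous; for the solution itself boundary values have no
  meaning.\<close>

lemma cut_flat:
  fixes U :: "'a::euclidean_space \<Rightarrow> real" and j :: nat
  assumes a: "a > 0" and U: "smooth U" and bd: "\<And>x. infnorm x = s \<Longrightarrow> U x < d"
  defines "\<phi> \<equiv> \<lambda>x. if infnorm x < s then flat a j (U x - d) else 0"
  shows "smooth \<phi>" "vanishes_outside (real DIM('a) * s) \<phi>"
    "grad \<phi> x = (if infnorm x < s then dflat a j (U x - d) *\<^sub>R grad U x else 0)"
proof -
  define V where "V = {x. U x < d}"
  have oV: "open V" unfolding V_def
    by (intro open_Collect_less smooth_continuous U continuous_on_const)
  have fr: "frontier {x::'a. infnorm x < s} \<subseteq> V" using infnorm_frontier bd by (auto simp: V_def)
  have sf: "smooth (\<lambda>x. flat a j (U x - d))" by (intro smooth_intros a U)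
  have "smooth (\<lambda>x. if x \<in> {x. infnorm x < s} then flat a j (U x - d) else 0)"
    by (rule smooth_cut_off_at_frontier[OF sf oV fr]) (auto simp: V_def flat_eq_0)
  then show "smooth \<phi>" by (simp add: \<phi>_def)
  show "vanishes_outside (real DIM('a) * s) \<phi>"
    unfolding vanishes_outside_def \<phi>_def
  proof (intro allI impI if_not_P notI)
    fix x :: 'a assume "norm x > real DIM('a) * s" "infnorm x < s"
    then show False using norm_le_infnorm_DIM[of x] mult_left_mono[of "infnorm x" s "real DIM('a)"] by linarith
  qed
  have c: "continuous_on UNIV (infnorm :: 'a \<Rightarrow> real)" by (intro continuous_on_infnorm continuous_on_id)
  have o: "open {x::'a. infnorm x < s}" "open {x::'a. infnorm x > s}"
    using c by (auto intro: open_Collect_less continuous_on_const)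
  have z: "grad \<phi> x = 0" if "open N" "x \<in> N" "\<And>y. y \<in> N \<Longrightarrow> \<phi> y = 0" for N
  proof (rule grad_eqI)
    have "((\<lambda>x. 0::real) has_derivative (\<lambda>h. 0 \<bullet> h)) (at x)" by simp
    then show "(\<phi> has_derivative (\<bullet>) 0) (at x)"
      by (rule has_derivative_transform_within_open[OF _ that(1,2)]) (use that(3) in auto)
  qed
  consider "infnorm x < s" | "infnorm x > s" | "infnorm x = s" by linarith
  then show "grad \<phi> x = (if infnorm x < s then dflat a j (U x - d) *\<^sub>R grad U x else 0)"
  proof cases
    case 1
    have "(\<phi> has_derivative (\<lambda>h. grad (\<lambda>x. flat a j (U x - d)) x \<bullet> h)) (at x)"
      by (rule has_derivative_transform_within_open[OF smooth_has_derivative[OF sf] o(1)]) (use 1 in \<open>auto simp: \<phi>_def\<close>)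
    from grad_eqI[OF this] show ?thesis using 1 grad_flat_comp[OF a U] by simp
  next
    case 2
    then show ?thesis using z[OF o(2)] by (auto simp: \<phi>_def)
  next
    case 3
    then show ?thesis using z[OF oV] bd by (auto simp: \<phi>_def V_def flat_eq_0)
  qed
qed

lemma AE_translate:
  fixes c :: "'a::euclidean_space"
  assumes "AE x in lborel. P x" shows "AE x in lborel. P (x + c)"
proof -
  have "AE x in distr lborel borel ((+) c). P x" unfolding lborel_distr_plus using assms .
  then have "AE x in lborel. P (c + x)" by (rule AE_distrD[rotated]) simp
  then show ?thesis by (simp add: add.commute)
qed

text \<open>The difference is the integral of the directional derivative along a segment; Jensen's
  inequality on [0, 1], exchange of integrals and translation invariance finish. In this form the
  energy bounds enter the maximum principle.\<close>

lemma translation_inequality: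
  fixes f :: "'a::euclidean_space \<Rightarrow> real"
  assumes f: "smooth f"
  shows "(\<integral>\<^sup>+x. ennreal (\<bar>f (x + z) - f x\<bar> ^ n) \<partial>lborel) \<le> ennreal (norm z ^ n) * (\<integral>\<^sup>+x. ennreal (norm (grad f x) ^ n) \<partial>lborel)"
proof -
  have [measurable]: "grad f \<in> borel_measurable borel" using smooth_grad_measurable[OF f] .
  have point: "ennreal (\<bar>f (x + z) - f x\<bar> ^ n)
      \<le> (\<integral>\<^sup>+t. ennreal (norm z ^ n) * (ennreal (norm (grad f (t *\<^sub>R z + x)) ^ n) * indicator {0..1} t) \<partial>lborel)" for x
  proof -
    define g where "g t = grad f (t *\<^sub>R z + x) \<bullet> z" for t :: real
    have cg: "continuous_on UNIV g" unfolding g_def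
      by (intro continuous_intros continuous_on_compose2[OF smooth_continuous_grad[OF f]]) auto
    have d: "((\<lambda>t. f (t *\<^sub>R z + x)) has_real_derivative g t) (at t)" for t
    proof -
      have "((\<lambda>t. t *\<^sub>R z + x) has_derivative (\<lambda>h. h *\<^sub>R z)) (at t)" by (auto intro!: derivative_eq_intros)
      from has_derivative_compose[OF this smooth_has_derivative[OF f]]
      show ?thesis unfolding has_field_derivative_def by (rule has_derivative_eq_rhs) (simp add: fun_eq_iff g_def)
    qed
    have int: "integrable lborel (\<lambda>t. h t * indicator {0..1} t)" if "continuous_on UNIV h" for h :: "real \<Rightarrow> real"
      using borel_integrable_atLeastAtMost'[of 0 1 h] continuous_on_subset[OF that]
      by (simp add: set_integrable_def mult.commute)
    have "(\<integral>t. g t * indicator {0 .. 1} t \<partial>lborel) = f (1 *\<^sub>R z + x) - f (0 *\<^sub>R z + x)"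
      by (rule integral_FTC_Icc_real) (use d cg in \<open>auto simp: continuous_on_eq_continuous_at\<close>)
    then have "\<bar>f (x + z) - f x\<bar> ^ n = \<bar>\<integral>t. g t * indicator {0 .. 1} t \<partial>lborel\<bar> ^ n" by (simp add: add.commute)
    also have "\<dots> \<le> (\<integral>t. \<bar>g t\<bar> ^ n * indicator {0 .. 1} t \<partial>lborel)"
      by (rule jensen_power) (use cg in \<open>auto intro!: int continuous_intros\<close>)
    finally have "ennreal (\<bar>f (x + z) - f x\<bar> ^ n) \<le> ennreal (\<integral>t. \<bar>g t\<bar> ^ n * indicator {0 .. 1} t \<partial>lborel)"
      by (rule ennreal_leI)
    also have "\<dots> = (\<integral>\<^sup>+t. ennreal (\<bar>g t\<bar> ^ n * indicator {0 .. 1} t) \<partial>lborel)"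
      by (rule nn_integral_eq_integral[symmetric]) (use cg in \<open>auto intro!: int continuous_intros\<close>)
    also have "\<dots> \<le> (\<integral>\<^sup>+t. ennreal (norm z ^ n) * (ennreal (norm (grad f (t *\<^sub>R z + x)) ^ n) * indicator {0..1} t) \<partial>lborel)"
    proof (rule nn_integral_mono)
      fix t :: real
      have "\<bar>g t\<bar> ^ n \<le> (norm z * norm (grad f (t *\<^sub>R z + x))) ^ n"
        unfolding g_def using Cauchy_Schwarz_ineq2[of "grad f (t *\<^sub>R z + x)" z]
        by (intro power_mono) (auto simp: mult.commute)
      then have "ennreal (\<bar>g t\<bar> ^ n) \<le> ennreal (norm z ^ n) * ennreal (norm (grad f (t *\<^sub>R z + x)) ^ n)"
        by (simp add: power_mult_distrib ennreal_mult'[symmetric] ennreal_leI)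
      then show "ennreal (\<bar>g t\<bar> ^ n * indicator {0 .. 1} t) \<le> ennreal (norm z ^ n) * (ennreal (norm (grad f (t *\<^sub>R z + x)) ^ n) * indicator {0..1} t)"
        by (auto simp: indicator_def)
    qed
    finally show ?thesis .
  qed
  have "(\<integral>\<^sup>+x. ennreal (\<bar>f (x + z) - f x\<bar> ^ n) \<partial>lborel)
     \<le> (\<integral>\<^sup>+x. (\<integral>\<^sup>+t. ennreal (norm z ^ n) * (ennreal (norm (grad f (t *\<^sub>R z + x)) ^ n) * indicator {0..1} t) \<partial>lborel) \<partial>lborel)"
    by (intro nn_integral_mono point)
  also have "\<dots> = (\<integral>\<^sup>+t. (\<integral>\<^sup>+x. ennreal (norm z ^ n) * (ennreal (norm (grad f (t *\<^sub>R z + x)) ^ n) * indicator {0..1} t) \<partial>lborel) \<partial>lborel)"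
    by (rule lborel_pair.Fubini') measurable
  also have "\<dots> = (\<integral>\<^sup>+t. (ennreal (norm z ^ n) * (\<integral>\<^sup>+x. ennreal (norm (grad f x) ^ n) \<partial>lborel)) * indicator {0..1::real} t \<partial>lborel)"
  proof (rule nn_integral_cong)
    fix t :: real
    have "(\<integral>\<^sup>+x. ennreal (norm z ^ n) * (ennreal (norm (grad f (t *\<^sub>R z + x)) ^ n) * indicator {0..1} t) \<partial>lborel)
       = ennreal (norm z ^ n) * ((\<integral>\<^sup>+x. ennreal (norm (grad f (t *\<^sub>R z + x)) ^ n) \<partial>lborel) * indicator {0..1} t)"
      by (simp add: nn_integral_cmult nn_integral_multc)
    also have "(\<integral>\<^sup>+x. ennreal (norm (grad f (t *\<^sub>R z + x)) ^ n) \<partial>lborel) = (\<integral>\<^sup>+x. ennreal (norm (grad f x) ^ n) \<partial>lborel)"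
      by (rule nn_integral_translate[of "\<lambda>x. ennreal (norm (grad f x) ^ n)"]) simp
    finally show "(\<integral>\<^sup>+x. ennreal (norm z ^ n) * (ennreal (norm (grad f (t *\<^sub>R z + x)) ^ n) * indicator {0..1} t) \<partial>lborel)
       = (ennreal (norm z ^ n) * (\<integral>\<^sup>+x. ennreal (norm (grad f x) ^ n) \<partial>lborel)) * indicator {0..1::real} t" by (simp add: mult.assoc)
  qed
  also have "\<dots> = ennreal (norm z ^ n) * (\<integral>\<^sup>+x. ennreal (norm (grad f x) ^ n) \<partial>lborel)"
    by (subst nn_integral_cmult_indicator) auto
  finally show ?thesis .
qed

text \<open>\<open>V\<close> and \<open>B\<close> stand for the fields \<open>A x (u x) (G x)\<close> and \<open>B x (u x) (G x)\<close>. This linear form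
  is stable under changing the signs of \<open>u\<close>, \<open>G\<close>, \<open>V\<close> and \<open>B\<close>.\<close>

locale weak_solution =
  fixes u :: "'a::euclidean_space \<Rightarrow> real" and G V :: "'a \<Rightarrow> 'a" and B :: "'a \<Rightarrow> real"
    and a0 a1 b1 m M :: real and n :: nat
  assumes n_def: "n = DIM('a)" and n2: "n \<ge> 2" and a0: "a0 > 0" and b1: "b1 > 0"
    and um [measurable]: "u \<in> borel_measurable borel" and Gm [measurable]: "G \<in> borel_measurable borel"
    and Vm [measurable]: "V \<in> borel_measurable borel" and Bm [measurable]: "B \<in> borel_measurable borel"
    and ub: "\<And>x. m \<le> u x" "\<And>x. u x \<le> M"
    and Gi: "\<And>r. integrable lborel (\<lambda>x. indicator (cball 0 r) x * norm (G x) ^ n)"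
    and weak: "\<And>\<phi> r b. smooth \<phi> \<Longrightarrow> vanishes_outside r \<phi> \<Longrightarrow> b \<in> Basis \<Longrightarrow>
      (\<integral>x. u x * (grad \<phi> x \<bullet> b) \<partial>lborel) = - (\<integral>x. (G x \<bullet> b) * \<phi> x \<partial>lborel)"
    and str: "AE x in lborel. V x \<bullet> G x \<ge> a0 * norm (G x) ^ n \<and> norm (V x) \<le> a1 * norm (G x) ^ (n - 1) \<and>
      \<bar>B x\<bar> \<le> decay b1 x * norm (G x) ^ (n - 1)"
    and eq: "\<And>\<phi> r. smooth \<phi> \<Longrightarrow> vanishes_outside r \<phi> \<Longrightarrow>
      (\<integral>x. V x \<bullet> grad \<phi> x \<partial>lborel) + (\<integral>x. B x * \<phi> x \<partial>lborel) = 0"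
begin

definition approximates :: "(nat \<Rightarrow> 'a \<Rightarrow> real) \<Rightarrow> ('a \<Rightarrow> real) \<Rightarrow> real \<Rightarrow> bool" where
  "approximates U S K \<longleftrightarrow>
    (\<forall>k. smooth (U k)) \<and> (\<forall>k x. m \<le> U k x \<and> U k x \<le> M) \<and> integrable lborel S \<and> (\<forall>x. S x \<ge> 0) \<and>
    (AE x in lborel. norm x < K \<longrightarrow> (\<lambda>k. U k x) \<longlonglongrightarrow> u x \<and> (\<lambda>k. grad (U k) x) \<longlonglongrightarrow> G x \<and>
      (\<forall>k. norm (grad (U k) x) ^ n \<le> S x))"

lemma approximatesD:
  assumes "approximates U S K"
  shows "smooth (U k)" "m \<le> U k x" "U k x \<le> M" "integrable lborel S" "S x \<ge> 0"
    "AE x in lborel. norm x < K \<longrightarrow> (\<lambda>k. U k x) \<longlonglongrightarrow> u x \<and> (\<lambda>k. grad (U k) x) \<longlonglongrightarrow> G x \<and>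
      (\<forall>k. norm (grad (U k) x) ^ n \<le> S x)"
  using assms by (auto simp: approximates_def)

lemma approximation: "\<exists>U S. approximates U S K"
  unfolding approximates_def
proof (rule smooth_approximation[where u=u and G=G and m=m and M=M and n=n and K=K])
  show "n > 0" using n2 by simp
qed (use um Gm ub Gi weak in blast)+

lemma approximates_subseq:
  assumes ap: "approximates U S K" and r: "strict_mono r"
  shows "approximates (\<lambda>k. U (r k)) S K"
proof -
  have sub: "(\<lambda>k. X (r k)) \<longlonglongrightarrow> L" if "X \<longlonglongrightarrow> L" for X :: "nat \<Rightarrow> 'z::topological_space" and L
    using LIMSEQ_subseq_LIMSEQ[OF that r] by (simp add: o_def)
  have "AE x in lborel. norm x < K \<longrightarrow> (\<lambda>k. U (r k) x) \<longlonglongrightarrow> u x \<and> (\<lambda>k. grad (U (r k)) x) \<longlonglongrightarrow> G x \<and>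
      (\<forall>k. norm (grad (U (r k)) x) ^ n \<le> S x)"
    using approximatesD(6)[OF ap] by eventually_elim (auto intro: sub)
  then show ?thesis using ap by (simp add: approximates_def)
qed

lemma decay_bounds: "0 \<le> decay b1 x" "decay b1 x \<le> b1"
proof -
  show "0 \<le> decay b1 x" using b1 by (auto simp: decay_def)
  have "b1 / norm x \<le> b1 / 1" if "norm x > 1" using b1 that by (intro divide_left_mono) auto
  then show "decay b1 x \<le> b1" by (auto simp: decay_def)
qed

lemma power_pred_le: "t ^ (n - 1) \<le> 1 + t ^ n" if "t \<ge> 0" for t :: real
proof -
  have "t ^ (n - 1) * 1 \<le> 1 * t ^ n + 1 ^ n / 1 ^ (n - 1)"
    by (rule young_product) (use n2 that in auto)
  then show ?thesis by simp
qed

text \<open>Extends the equation to limits of smooth test functions with bounded values and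
  dominated gradients. By the growth conditions and Young's inequality the integrands are dominated
  by multiples of |G|^n + S and of 1 + |G|^n on the common support.\<close>

lemma limit_equation:
  fixes \<phi> :: "nat \<Rightarrow> 'a \<Rightarrow> real"
  assumes s: "\<And>k. smooth (\<phi> k)" and z: "\<And>k. vanishes_outside r (\<phi> k)"
    and S: "integrable lborel S" and [measurable]: "\<eta> \<in> borel_measurable borel" "H \<in> borel_measurable borel"
    and lim: "AE x in lborel. (\<lambda>k. \<phi> k x) \<longlonglongrightarrow> \<eta> x \<and> (\<lambda>k. grad (\<phi> k) x) \<longlonglongrightarrow> H x \<and>
      (\<forall>k. \<bar>\<phi> k x\<bar> \<le> C \<and> norm (grad (\<phi> k) x) ^ n \<le> S x)"
  shows "integrable lborel (\<lambda>x. V x \<bullet> H x)" "integrable lborel (\<lambda>x. B x * \<eta> x)"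
    "(\<integral>x. V x \<bullet> H x \<partial>lborel) + (\<integral>x. B x * \<eta> x \<partial>lborel) = 0"
proof -
  have [measurable]: "\<phi> k \<in> borel_measurable borel" "grad (\<phi> k) \<in> borel_measurable borel" for k
    using s smooth_measurable smooth_grad_measurable by auto
  define I where "I x = indicator (cball (0::'a) r) x * norm (G x) ^ n" for x
  have ic: "integrable lborel (indicator (cball (0::'a) r) :: 'a \<Rightarrow> real)"
    using emeasure_lborel_cball_finite by (intro integrable_real_indicator) auto
  have gz: "vanishes_outside r (grad (\<phi> k))" for k by (rule grad_zero_outside[OF z])
  define w1 where "w1 x = \<bar>a1\<bar> * (I x + S x)" for x
  have w1: "integrable lborel w1" unfolding w1_def I_def using Gi S by auto
  have b1': "AE x in lborel. norm (V x \<bullet> grad (\<phi> k) x) \<le> w1 x" for k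
    using lim str
  proof eventually_elim
    case (elim x)
    have Sx: "norm (grad (\<phi> k) x) ^ n \<le> S x" using elim by simp
    have S0: "0 \<le> S x" using Sx by (meson norm_ge_zero order_trans zero_le_power)
    show ?case
    proof (cases "norm x > r")
      case True
      then show ?thesis using vanishes_outsideD[OF gz True] S0 by (simp add: w1_def I_def)
    next
      case False
      have "norm (V x \<bullet> grad (\<phi> k) x) \<le> norm (V x) * norm (grad (\<phi> k) x)" by (simp add: Cauchy_Schwarz_ineq2)
      also have "\<dots> \<le> (\<bar>a1\<bar> * norm (G x) ^ (n - 1)) * norm (grad (\<phi> k) x)"
      proof (rule mult_right_mono)
        have "norm (V x) \<le> a1 * norm (G x) ^ (n - 1)" using elim by simp
        also have "\<dots> \<le> \<bar>a1\<bar> * norm (G x) ^ (n - 1)" by (rule mult_right_mono) auto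
        finally show "norm (V x) \<le> \<bar>a1\<bar> * norm (G x) ^ (n - 1)" .
      qed simp
      also have "\<dots> = \<bar>a1\<bar> * (norm (G x) ^ (n - 1) * norm (grad (\<phi> k) x))" by simp
      also have "\<dots> \<le> \<bar>a1\<bar> * (1 * norm (G x) ^ n + norm (grad (\<phi> k) x) ^ n / 1 ^ (n - 1))"
        using n2 by (intro mult_left_mono young_product) auto
      also have "\<dots> \<le> w1 x" unfolding w1_def I_def using False Sx by (intro mult_left_mono) auto
      finally show ?thesis .
    qed
  qed
  have l1: "AE x in lborel. (\<lambda>k. V x \<bullet> grad (\<phi> k) x) \<longlonglongrightarrow> V x \<bullet> H x"
    using lim by eventually_elim (intro tendsto_inner tendsto_const, simp)
  define w2 where "w2 x = \<bar>C\<bar> * b1 * (indicator (cball (0::'a) r) x + I x)" for x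
  have w2: "integrable lborel w2" unfolding w2_def I_def using Gi ic by auto
  have b2': "AE x in lborel. norm (B x * \<phi> k x) \<le> w2 x" for k
    using lim str
  proof eventually_elim
    case (elim x)
    show ?case
    proof (cases "norm x > r")
      case True
      then show ?thesis using vanishes_outsideD[OF z True] by (simp add: w2_def I_def)
    next
      case False
      have "\<bar>B x\<bar> \<le> b1 * norm (G x) ^ (n - 1)"
        using elim decay_bounds(2)[of x] mult_right_mono[of "decay b1 x" b1 "norm (G x) ^ (n - 1)"] by auto
      also have "\<dots> \<le> b1 * (1 + norm (G x) ^ n)" using b1 by (intro mult_left_mono power_pred_le) auto
      finally have "\<bar>B x\<bar> * \<bar>\<phi> k x\<bar> \<le> b1 * (1 + norm (G x) ^ n) * \<bar>C\<bar>"
        using elim by (intro mult_mono) (auto intro: order_trans[OF _ abs_ge_self])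
      then show ?thesis using False by (simp add: w2_def I_def abs_mult mult_ac)
    qed
  qed
  have l2: "AE x in lborel. (\<lambda>k. B x * \<phi> k x) \<longlonglongrightarrow> B x * \<eta> x"
    using lim by eventually_elim (intro tendsto_mult tendsto_const, simp)
  have t1: "(\<lambda>k. \<integral>x. V x \<bullet> grad (\<phi> k) x \<partial>lborel) \<longlonglongrightarrow> (\<integral>x. V x \<bullet> H x \<partial>lborel)"
    by (rule integral_dominated_convergence[OF _ _ w1 l1 b1']) measurable
  have t2: "(\<lambda>k. \<integral>x. B x * \<phi> k x \<partial>lborel) \<longlonglongrightarrow> (\<integral>x. B x * \<eta> x \<partial>lborel)"
    by (rule integral_dominated_convergence[OF _ _ w2 l2 b2']) measurable
  show "integrable lborel (\<lambda>x. V x \<bullet> H x)"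
    by (rule integrable_dominated_convergence[OF _ _ w1 l1 b1']) measurable
  show "integrable lborel (\<lambda>x. B x * \<eta> x)"
    by (rule integrable_dominated_convergence[OF _ _ w2 l2 b2']) measurable
  have "(\<lambda>k. (\<integral>x. V x \<bullet> grad (\<phi> k) x \<partial>lborel) + (\<integral>x. B x * \<phi> k x \<partial>lborel)) \<longlonglongrightarrow> (\<integral>x. V x \<bullet> H x \<partial>lborel) + (\<integral>x. B x * \<eta> x \<partial>lborel)"
    using t1 t2 by (rule tendsto_add)
  then show "(\<integral>x. V x \<bullet> H x \<partial>lborel) + (\<integral>x. B x * \<eta> x \<partial>lborel) = 0"
    using eq[OF s z] by (simp add: LIMSEQ_const_iff)
qed

end

text \<open>Fatou's lemma: bounds on translation differences pass to a.e. limits, without any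
  Sobolev property of the limit.\<close>

lemma fatou_translation:
  fixes F :: "nat \<Rightarrow> 'a::euclidean_space \<Rightarrow> real"
  assumes [measurable]: "\<And>k. F k \<in> borel_measurable borel" and lim: "AE x in lborel. (\<lambda>k. F k x) \<longlonglongrightarrow> f x"
    and le: "\<And>k. (\<integral>\<^sup>+x. ennreal (\<bar>F k (x + z) - F k x\<bar> ^ n) \<partial>lborel) \<le> ennreal (e k)" and e: "e \<longlonglongrightarrow> l"
  shows "(\<integral>\<^sup>+x. ennreal (\<bar>f (x + z) - f x\<bar> ^ n) \<partial>lborel) \<le> ennreal l"
proof -
  have "(\<integral>\<^sup>+x. ennreal (\<bar>f (x + z) - f x\<bar> ^ n) \<partial>lborel)
      = (\<integral>\<^sup>+x. liminf (\<lambda>k. ennreal (\<bar>F k (x + z) - F k x\<bar> ^ n)) \<partial>lborel)"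
  proof (rule nn_integral_cong_AE)
    show "AE x in lborel. ennreal (\<bar>f (x + z) - f x\<bar> ^ n) = liminf (\<lambda>k. ennreal (\<bar>F k (x + z) - F k x\<bar> ^ n))"
      using lim AE_translate[OF lim, of z]
    proof eventually_elim
      case (elim x)
      have "(\<lambda>k. ennreal (\<bar>F k (x + z) - F k x\<bar> ^ n)) \<longlonglongrightarrow> ennreal (\<bar>f (x + z) - f x\<bar> ^ n)"
        by (intro tendsto_ennrealI tendsto_intros elim)
      then show ?case by (intro lim_imp_Liminf[symmetric]) auto
    qed
  qed
  also have "\<dots> \<le> liminf (\<lambda>k. \<integral>\<^sup>+x. ennreal (\<bar>F k (x + z) - F k x\<bar> ^ n) \<partial>lborel)"
    by (rule nn_integral_liminf) measurable
  also have "\<dots> \<le> liminf (\<lambda>k. ennreal (e k))" by (intro Liminf_mono always_eventually allI le)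
  also have "\<dots> = ennreal l" using e by (intro lim_imp_Liminf tendsto_ennrealI) auto
  finally show ?thesis .
qed

section \<open>Algebra of the truncation profiles\<close>

lemma flat_power: "t > 0 \<Longrightarrow> flat (real k * a) (k * j) t = flat a j t ^ k"
  by (simp add: flat_def power_divide power_mult mult.commute flip: exp_of_nat_mult)

text \<open>With the exponent 2(n - 1), for t > 0 the derivative is exactly (n q - 2(n - 1) t) times
  the n-th power of \<open>flat q 2 t\<close>. Since t <= 1/2 and q >= 1, the subtracted part is at
  most (n - 1) q, and q remains. Here \<open>flat q 2\<close> is the derivative of
  \<open>flat q 0\<close> divided by q, so the test function controls the energy of
  \<open>flat q 0\<close> of u - d.\<close>

lemma dflat_lower_bound:
  fixes q :: real
  assumes q: "q \<ge> 1" and t: "t \<le> 1 / 2" and n: "n \<ge> 2"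
  shows "q * flat q 2 t ^ n \<le> dflat (real n * q) (2 * (n - 1)) t"
proof (cases "t > 0")
  case True
  obtain m where m: "n = Suc m" using n by (cases n) auto
  have f1: "flat (real n * q) (2 * (n - 1) + 2) t = flat q 2 t ^ n"
    using flat_power[OF True, of n q 2] by (simp add: m mult.commute)
  have f2: "flat (real n * q) (2 * (n - 1) + 1) t = t * flat q 2 t ^ n"
    using True unfolding f1[symmetric] by (simp add: flat_def m)
  have "2 * real (n - 1) * t \<le> 2 * real (n - 1) * (1 / 2)" using t by (intro mult_left_mono) auto
  also have "\<dots> \<le> real (n - 1) * q" using q by (simp add: mult_left_mono[of 1 q "real (n - 1)", simplified])
  finally have "q \<le> real n * q - 2 * real (n - 1) * t" by (simp add: m algebra_simps)
  then have "q * flat q 2 t ^ n \<le> (real n * q - 2 * real (n - 1) * t) * flat q 2 t ^ n"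
    by (rule mult_right_mono) (simp add: flat_nonneg)
  also have "\<dots> = dflat (real n * q) (2 * (n - 1)) t"
    unfolding dflat_def f1 f2 by (simp add: m algebra_simps)
  finally show ?thesis .
next
  case False
  then show ?thesis using n by (simp add: flat_eq_0 dflat_def zero_power)
qed

text \<open>The factor \<open>flat q 2 t ^ (n - 1)\<close> matches the growth |G|^(n - 1) of B.
  Young's inequality then splits the lower-order term into the coercive quantity and the n-th power
  of \<open>flat q 0\<close>.\<close>

lemma flat_product: "n \<ge> 1 \<Longrightarrow> flat (real n * q) (2 * (n - 1)) t = flat q 2 t ^ (n - 1) * flat q 0 t"
proof (cases "t > 0")
  case True
  assume "n \<ge> 1"
  then obtain m where m: "n = Suc m" by (cases n) auto
  have "flat (real m * q) (m * 2) t = flat q 2 t ^ m" by (rule flat_power[OF True])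
  moreover have "flat (real n * q) (2 * (n - 1)) t = flat (real m * q) (m * 2) t * flat q 0 t"
  proof -
    have "exp (- (real n * q / t)) = exp (- (real m * q / t)) * exp (- (q / t))"
      using True by (simp only: exp_add[symmetric]) (simp add: m field_simps)
    then show ?thesis using True by (simp add: flat_def m mult.commute[of 2])
  qed
  ultimately show ?thesis by (simp add: m)
next
  case False
  then show ?thesis by (simp add: flat_eq_0)
qed

lemma continuous_dflat: "a > 0 \<Longrightarrow> isCont (dflat a j) t"
  unfolding dflat_def by (intro continuous_intros continuous_flat) auto

lemma flat_measurable: "a > 0 \<Longrightarrow> flat a j \<in> borel_measurable borel"
  by (intro borel_measurable_continuous_onI continuous_at_imp_continuous_on ballI continuous_flat)

lemma dflat_measurable: "a > 0 \<Longrightarrow> dflat a j \<in> borel_measurable borel"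
  by (intro borel_measurable_continuous_onI continuous_at_imp_continuous_on ballI continuous_dflat)

text \<open>Smooth approximations that lie strictly below c on cube boundaries. The half-side
  \<open>sk k\<close> varies because the good cube depends on the approximation; only its limit s
  refers to u itself. The bound by \<open>R0\<close> < \<open>K\<close> keeps all cubes inside the
  ball where the approximations converge.\<close>

locale cube_approximation = weak_solution u G V B a0 a1 b1 m M n
  for u :: "'a::euclidean_space \<Rightarrow> real" and G V :: "'a \<Rightarrow> 'a" and B :: "'a \<Rightarrow> real"
    and a0 a1 b1 m M :: real and n :: nat +
  fixes U :: "nat \<Rightarrow> 'a \<Rightarrow> real" and S :: "'a \<Rightarrow> real" and K R0 s c :: real and sk :: "nat \<Rightarrow> real"
  assumes ap: "approximates U S K"
    and sk: "sk \<longlonglongrightarrow> s" and skR: "\<And>k. real n * sk k \<le> R0" and R0K: "R0 < K"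
    and bd: "\<And>k x. infnorm x = sk k \<Longrightarrow> U k x < c"
begin

lemmas U = approximatesD(1)[OF ap] and Ub = approximatesD(2,3)[OF ap] and S = approximatesD(4,5)[OF ap]
  and UAE = approximatesD(6)[OF ap]

lemma norm_less_K: "infnorm x < sk k \<or> infnorm x < s \<Longrightarrow> norm (x::'a) < K"
proof -
  have sR: "real n * s \<le> R0"
    by (rule LIMSEQ_le_const2[OF tendsto_mult[OF tendsto_const sk]]) (use skR in auto)
  assume "infnorm x < sk k \<or> infnorm x < s"
  then have "real n * infnorm x \<le> R0"
    using sR skR[of k] mult_left_mono[of "infnorm x" s "real n"] mult_left_mono[of "infnorm x" "sk k" "real n"] by auto
  then show ?thesis using norm_le_infnorm_DIM[of x] R0K by (simp add: n_def)
qed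

text \<open>For levels d >= c, \<open>phi\<close> is a smooth test function for each k, while
  \<open>eta\<close> and \<open>deta\<close> are the a.e. limits of it and of its gradient. That
  \<open>deta\<close> is a weak gradient of \<open>eta\<close> is never established; all estimates
  pass through \<open>phi\<close>.\<close>

definition phi :: "real \<Rightarrow> nat \<Rightarrow> real \<Rightarrow> nat \<Rightarrow> 'a \<Rightarrow> real" where
  "phi a j d k x = (if infnorm x < sk k then flat a j (U k x - d) else 0)"

definition eta :: "real \<Rightarrow> nat \<Rightarrow> real \<Rightarrow> 'a \<Rightarrow> real" where
  "eta a j d x = (if infnorm x < s then flat a j (u x - d) else 0)"

definition deta :: "real \<Rightarrow> nat \<Rightarrow> real \<Rightarrow> 'a \<Rightarrow> 'a" where
  "deta a j d x = (if infnorm x < s then dflat a j (u x - d) *\<^sub>R G x else 0)"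

lemma eta_measurable: "a > 0 \<Longrightarrow> eta a j d \<in> borel_measurable borel"
proof -
  assume "a > 0"
  note [measurable] = flat_measurable[OF this]
  show ?thesis unfolding eta_def by measurable
qed

lemma deta_measurable: "a > 0 \<Longrightarrow> deta a j d \<in> borel_measurable borel"
proof -
  assume "a > 0"
  note [measurable] = dflat_measurable[OF this]
  show ?thesis unfolding deta_def by measurable
qed

lemma phi_props:
  assumes a: "a > 0" and d: "c \<le> d"
  shows "smooth (phi a j d k)" "vanishes_outside R0 (phi a j d k)"
    "grad (phi a j d k) x = (if infnorm x < sk k then dflat a j (U k x - d) *\<^sub>R grad (U k) x else 0)"
proof -
  have b: "infnorm x = sk k \<Longrightarrow> U k x < d" for x using bd[of x k] d by simp
  have e: "phi a j d k = (\<lambda>x. if infnorm x < sk k then flat a j (U k x - d) else 0)"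
    by (simp add: phi_def fun_eq_iff)
  show "smooth (phi a j d k)" unfolding e by (rule cut_flat(1)[OF a U b])
  have "vanishes_outside (real DIM('a) * sk k) (phi a j d k)" unfolding e by (rule cut_flat(2)[OF a U b])
  then show "vanishes_outside R0 (phi a j d k)"
    using skR[of k] unfolding vanishes_outside_def n_def by (meson le_less_trans)
  show "grad (phi a j d k) x = (if infnorm x < sk k then dflat a j (U k x - d) *\<^sub>R grad (U k) x else 0)"
    unfolding e by (rule cut_flat(3)[OF a U b])
qed

lemma phi_limit:
  assumes a: "a > 0" and d: "c \<le> d"
  obtains C where "C \<ge> 0" "AE x in lborel. (\<lambda>k. phi a j d k x) \<longlonglongrightarrow> eta a j d x \<and> (\<lambda>k. grad (phi a j d k) x) \<longlonglongrightarrow> deta a j d x \<and>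
      (\<forall>k. \<bar>phi a j d k x\<bar> \<le> C \<and> norm (grad (phi a j d k) x) ^ n \<le> C ^ n * S x)"
proof -
  obtain C where C: "C \<ge> 0" "\<And>t. \<bar>t\<bar> \<le> \<bar>m\<bar> + \<bar>M\<bar> + \<bar>d\<bar> \<Longrightarrow> \<bar>flat a j t\<bar> \<le> C \<and> \<bar>dflat a j t\<bar> \<le> C"
    using flat_bounded_on[OF a, of "\<bar>m\<bar> + \<bar>M\<bar> + \<bar>d\<bar>" j] by metis
  have Cb: "\<bar>flat a j (U k x - d)\<bar> \<le> C" "\<bar>dflat a j (U k x - d)\<bar> \<le> C" for k x
  proof -
    have "\<bar>U k x - d\<bar> \<le> \<bar>m\<bar> + \<bar>M\<bar> + \<bar>d\<bar>" using Ub[of k x] by linarith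
    then show "\<bar>flat a j (U k x - d)\<bar> \<le> C" "\<bar>dflat a j (U k x - d)\<bar> \<le> C" using C(2) by blast+
  qed
  have "AE x in lborel. (\<lambda>k. phi a j d k x) \<longlonglongrightarrow> eta a j d x \<and> (\<lambda>k. grad (phi a j d k) x) \<longlonglongrightarrow> deta a j d x \<and>
      (\<forall>k. \<bar>phi a j d k x\<bar> \<le> C \<and> norm (grad (phi a j d k) x) ^ n \<le> C ^ n * S x)"
    using UAE AE_infnorm_neq[of s]
  proof eventually_elim
    case (elim x)
    have bounds: "\<bar>phi a j d k x\<bar> \<le> C \<and> norm (grad (phi a j d k) x) ^ n \<le> C ^ n * S x" for k
    proof (cases "infnorm x < sk k")
      case True
      then have "norm (grad (U k) x) ^ n \<le> S x" using elim norm_less_K by blast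
      then have "C ^ n * norm (grad (U k) x) ^ n \<le> C ^ n * S x" using C(1) by (intro mult_left_mono) auto
      moreover have "norm (grad (phi a j d k) x) ^ n \<le> (C * norm (grad (U k) x)) ^ n"
        unfolding phi_props(3)[OF a d] using True Cb by (intro power_mono) (auto intro: mult_right_mono)
      ultimately show ?thesis using True Cb by (auto simp: phi_def power_mult_distrib)
    next
      case False
      then show ?thesis using C(1) S(2)[of x] n2 by (simp add: phi_def phi_props(3)[OF a d] zero_power)
    qed
    have lims: "(\<lambda>k. phi a j d k x) \<longlonglongrightarrow> eta a j d x \<and> (\<lambda>k. grad (phi a j d k) x) \<longlonglongrightarrow> deta a j d x"
    proof (cases "infnorm x < s")
      case True
      then have ev: "\<forall>\<^sub>F k in sequentially. infnorm x < sk k" by (rule order_tendstoD(1)[OF sk])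
      have lu: "(\<lambda>k. U k x - d) \<longlonglongrightarrow> u x - d" and lg: "(\<lambda>k. grad (U k) x) \<longlonglongrightarrow> G x"
        using elim norm_less_K True by (auto intro!: tendsto_intros)
      have l1: "(\<lambda>k. flat a j (U k x - d)) \<longlonglongrightarrow> flat a j (u x - d)"
        by (rule isCont_tendsto_compose[OF continuous_flat[OF a] lu])
      have l2: "(\<lambda>k. dflat a j (U k x - d) *\<^sub>R grad (U k) x) \<longlonglongrightarrow> dflat a j (u x - d) *\<^sub>R G x"
        by (intro tendsto_scaleR lg isCont_tendsto_compose[OF continuous_dflat[OF a] lu])
      have e1: "\<forall>\<^sub>F k in sequentially. flat a j (U k x - d) = phi a j d k x"
        using ev by eventually_elim (simp add: phi_def)
      have e2: "\<forall>\<^sub>F k in sequentially. dflat a j (U k x - d) *\<^sub>R grad (U k) x = grad (phi a j d k) x"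
        using ev by eventually_elim (simp add: phi_props(3)[OF a d])
      show ?thesis using True Lim_transform_eventually[OF l1 e1] Lim_transform_eventually[OF l2 e2] by (simp add: eta_def deta_def)
    \<comment> \<open>Outside the limit cube, x leaves the cubes of half-side \<open>sk k\<close>
      from some k on; points with infnorm x = s have been removed as a null set.\<close>
    next
      case False
      then have "infnorm x > s" using elim by simp
      then have ev: "\<forall>\<^sub>F k in sequentially. sk k < infnorm x" by (rule order_tendstoD(2)[OF sk])
      have e1: "\<forall>\<^sub>F k in sequentially. 0 = phi a j d k x"
        using ev by eventually_elim (simp add: phi_def)
      have e2: "\<forall>\<^sub>F k in sequentially. 0 = grad (phi a j d k) x"
        using ev by eventually_elim (simp add: phi_props(3)[OF a d])
      show ?thesis using False Lim_transform_eventually[OF tendsto_const e1] Lim_transform_eventually[OF tendsto_const e2] by (simp add: eta_def deta_def)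
    qed
    show ?case using bounds lims by blast
  qed
  with C(1) that show ?thesis by blast
qed

lemma eta_power_integrable:
  assumes a: "a > 0"
  shows "integrable lborel (\<lambda>x. eta a j d x ^ n)"
proof -
  obtain C where C: "C \<ge> 0" "\<And>t. \<bar>t\<bar> \<le> \<bar>m\<bar> + \<bar>M\<bar> + \<bar>d\<bar> \<Longrightarrow> \<bar>flat a j t\<bar> \<le> C \<and> \<bar>dflat a j t\<bar> \<le> C"
    using flat_bounded_on[OF a, of "\<bar>m\<bar> + \<bar>M\<bar> + \<bar>d\<bar>" j] by metis
  note [measurable] = eta_measurable[OF a]
  show ?thesis
  proof (rule bounded_support_integrable[where C="C ^ n" and R=K])
    show "norm (eta a j d x ^ n) \<le> C ^ n" for x
    proof -
      have "\<bar>u x - d\<bar> \<le> \<bar>m\<bar> + \<bar>M\<bar> + \<bar>d\<bar>" using ub[of x] by linarith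
      then have "\<bar>eta a j d x\<bar> \<le> C" using C by (simp add: eta_def)
      then show ?thesis using power_mono[of "\<bar>eta a j d x\<bar>" C n] by (simp add: power_abs)
    qed
    show "eta a j d x ^ n = 0" if "norm x > K" for x
      using norm_less_K[of x] that n2 by (auto simp: eta_def zero_power)
  qed measurable
qed

text \<open>Test with \<open>eta (n q) (2 (n - 1)) d\<close>. The coercive term is at least a0 q
  A^n; Young's inequality absorbs half of it from the lower-order term and leaves \<open>D\<close>
  times the n-th power of \<open>eta q 0 d\<close>. Here \<open>D\<close> carries q^(1 - n), and the
  energy of \<open>eta q 0 d\<close> is q^n times the integral of A^n, so all powers of q cancel.
  This uniformity drives the maximum principle.\<close>

lemma energy:
  assumes q: "q \<ge> 1" and d: "c \<le> d" and t: "AE x in lborel. infnorm x < s \<longrightarrow> u x - d \<le> 1 / 2"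
  shows "(\<integral>x. norm (deta q 0 d x) ^ n \<partial>lborel) \<le> (2 * b1 / a0) ^ n * (\<integral>x. eta q 0 d x ^ n \<partial>lborel)"
proof -
  let ?a = "real n * q" and ?j = "2 * (n - 1)"
  have a: "?a > 0" using q n2 by simp
  have q0: "q > 0" using q by simp
  obtain C where C: "C \<ge> 0" "AE x in lborel. (\<lambda>k. phi ?a ?j d k x) \<longlonglongrightarrow> eta ?a ?j d x \<and> (\<lambda>k. grad (phi ?a ?j d k) x) \<longlonglongrightarrow> deta ?a ?j d x \<and>
      (\<forall>k. \<bar>phi ?a ?j d k x\<bar> \<le> C \<and> norm (grad (phi ?a ?j d k) x) ^ n \<le> C ^ n * S x)"
    using phi_limit[OF a d] .
  have iS: "integrable lborel (\<lambda>x. C ^ n * S x)" using S by simp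
  note lim = limit_equation[OF phi_props(1)[OF a d] phi_props(2)[OF a d] iS eta_measurable[OF a] deta_measurable[OF a] C(2)]
  \<comment> \<open>Up to the factor q this is the norm of \<open>deta q 0 d\<close>, since the
    derivative of \<open>flat q 0\<close> is q times \<open>flat q 2\<close>.\<close>
  define A where "A x = (if infnorm x < s then flat q 2 (u x - d) * norm (G x) else 0)" for x
  have [measurable]: "A \<in> borel_measurable borel"
  proof -
    note [measurable] = flat_measurable[OF q0]
    show ?thesis unfolding A_def by measurable
  qed
  define D where "D = b1 ^ n / (a0 * q / 2) ^ (n - 1)"
  have A0: "A x \<ge> 0" for x by (simp add: A_def flat_nonneg)
  have VH: "AE x in lborel. a0 * q * A x ^ n \<le> V x \<bullet> deta ?a ?j d x"
    using str t
  proof eventually_elim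
    case (elim x)
    show ?case
    proof (cases "infnorm x < s")
      case True
      then have l: "q * flat q 2 (u x - d) ^ n \<le> dflat ?a ?j (u x - d)"
        using elim by (intro dflat_lower_bound q n2) auto
      have l0: "0 \<le> q * flat q 2 (u x - d) ^ n" using q by (simp add: flat_nonneg)
      have "a0 * q * A x ^ n = (q * flat q 2 (u x - d) ^ n) * (a0 * norm (G x) ^ n)"
        using True by (simp add: A_def power_mult_distrib)
      also have "\<dots> \<le> dflat ?a ?j (u x - d) * (V x \<bullet> G x)"
        using l l0 elim a0 by (intro mult_mono) auto
      finally show ?thesis using True by (simp add: deta_def)
    qed (use n2 in \<open>simp add: A_def deta_def zero_power\<close>)
  qed
  have Bh: "AE x in lborel. \<bar>B x * eta ?a ?j d x\<bar> \<le> (a0 * q / 2) * A x ^ n + D * eta q 0 d x ^ n"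
    using str
  proof eventually_elim
    case (elim x)
    show ?case
    proof (cases "infnorm x < s")
      case True
      have Bx: "\<bar>B x\<bar> \<le> b1 * norm (G x) ^ (n - 1)"
        using elim decay_bounds(2)[of x] mult_right_mono[of "decay b1 x" b1 "norm (G x) ^ (n - 1)"] by auto
      have p: "eta ?a ?j d x = flat q 2 (u x - d) ^ (n - 1) * flat q 0 (u x - d)"
        using True n2 flat_product[of n q "u x - d"] by (simp add: eta_def)
      have "\<bar>B x * eta ?a ?j d x\<bar> \<le> (b1 * norm (G x) ^ (n - 1)) * (flat q 2 (u x - d) ^ (n - 1) * flat q 0 (u x - d))"
        unfolding p abs_mult using Bx by (intro mult_mono) (auto simp: flat_nonneg abs_mult)
      also have "\<dots> = A x ^ (n - 1) * (b1 * flat q 0 (u x - d))"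
        using True by (simp add: A_def power_mult_distrib)
      also have "\<dots> \<le> (a0 * q / 2) * A x ^ n + (b1 * flat q 0 (u x - d)) ^ n / (a0 * q / 2) ^ (n - 1)"
        by (rule young_product) (use A0 b1 a0 q n2 flat_nonneg in auto)
      also have "\<dots> = (a0 * q / 2) * A x ^ n + D * eta q 0 d x ^ n"
        using True by (simp add: D_def eta_def power_mult_distrib)
      finally show ?thesis .
    qed (use n2 in \<open>simp add: A_def eta_def zero_power\<close>)
  qed
  have iA: "integrable lborel (\<lambda>x. A x ^ n)"
  proof (rule Bochner_Integration.integrable_bound)
    show "integrable lborel (\<lambda>x. (1 / (a0 * q)) * (V x \<bullet> deta ?a ?j d x))" using lim(1) by simp
    show "AE x in lborel. norm (A x ^ n) \<le> norm ((1 / (a0 * q)) * (V x \<bullet> deta ?a ?j d x))"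
      using VH
    proof eventually_elim
      case (elim x)
      have "A x ^ n = (1 / (a0 * q)) * (a0 * q * A x ^ n)" using a0 q by simp
      also have "\<dots> \<le> (1 / (a0 * q)) * (V x \<bullet> deta ?a ?j d x)" using elim a0 q by (intro mult_left_mono) auto
      also have "\<dots> \<le> \<bar>(1 / (a0 * q)) * (V x \<bullet> deta ?a ?j d x)\<bar>" by (rule abs_ge_self)
      finally show ?case using A0[of x] by simp
    qed
  qed measurable
  have ie: "integrable lborel (\<lambda>x. eta q 0 d x ^ n)" by (rule eta_power_integrable) (use q in simp)
  have "(\<integral>x. (a0 * q / 2) * A x ^ n - D * eta q 0 d x ^ n \<partial>lborel) \<le> (\<integral>x. V x \<bullet> deta ?a ?j d x + B x * eta ?a ?j d x \<partial>lborel)"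
  proof (rule integral_mono_AE)
    show "AE x in lborel. (a0 * q / 2) * A x ^ n - D * eta q 0 d x ^ n \<le> V x \<bullet> deta ?a ?j d x + B x * eta ?a ?j d x"
      using VH Bh by eventually_elim (simp add: abs_le_iff field_simps)
  qed (use iA ie lim in auto)
  also have "\<dots> = 0" using lim by simp
  finally have "(a0 * q / 2) * (\<integral>x. A x ^ n \<partial>lborel) \<le> D * (\<integral>x. eta q 0 d x ^ n \<partial>lborel)"
    using iA ie by simp
  then have h1: "(2 * q ^ n / (a0 * q)) * ((a0 * q / 2) * (\<integral>x. A x ^ n \<partial>lborel)) \<le> (2 * q ^ n / (a0 * q)) * (D * (\<integral>x. eta q 0 d x ^ n \<partial>lborel))"
    using a0 q by (intro mult_left_mono) auto
  have h2: "(2 * q ^ n / (a0 * q)) * D = (2 * b1 / a0) ^ n"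
  proof -
    obtain k where k: "n = Suc k" using n2 by (cases n) auto
    show ?thesis using a0 q unfolding D_def k by (simp add: power_mult_distrib power_divide)
  qed
  have h3: "(\<lambda>x. norm (deta q 0 d x) ^ n) = (\<lambda>x. q ^ n * A x ^ n)"
    using q n2 by (auto simp: fun_eq_iff deta_def dflat_def A_def numeral_2_eq_2 power_mult_distrib flat_nonneg abs_mult zero_power)
  have "(\<integral>x. norm (deta q 0 d x) ^ n \<partial>lborel) = (2 * q ^ n / (a0 * q)) * ((a0 * q / 2) * (\<integral>x. A x ^ n \<partial>lborel))"
    unfolding h3 using a0 q by simp
  also note h1
  also have "(2 * q ^ n / (a0 * q)) * (D * (\<integral>x. eta q 0 d x ^ n \<partial>lborel)) = (2 * b1 / a0) ^ n * (\<integral>x. eta q 0 d x ^ n \<partial>lborel)"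
    unfolding h2[symmetric] by (simp only: mult.assoc)
  finally show ?thesis .
qed

text \<open>The translation inequality holds for the smooth \<open>phi q 0 d k\<close>. The left
  side passes to the limit by Fatou's lemma, the energies on the right by dominated convergence, and
  \<open>energy\<close> bounds their limit.\<close>

lemma eta_translation:
  assumes q: "q \<ge> 1" and d: "c \<le> d" and t: "AE x in lborel. infnorm x < s \<longrightarrow> u x - d \<le> 1 / 2"
  shows "(\<integral>\<^sup>+x. ennreal (\<bar>eta q 0 d (x + z) - eta q 0 d x\<bar> ^ n) \<partial>lborel)
    \<le> ennreal (norm z ^ n * ((2 * b1 / a0) ^ n * (\<integral>x. eta q 0 d x ^ n \<partial>lborel)))"
proof -
  have a: "q > 0" using q by simp
  obtain C where C: "C \<ge> 0" "AE x in lborel. (\<lambda>k. phi q 0 d k x) \<longlonglongrightarrow> eta q 0 d x \<and> (\<lambda>k. grad (phi q 0 d k) x) \<longlonglongrightarrow> deta q 0 d x \<and>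
      (\<forall>k. \<bar>phi q 0 d k x\<bar> \<le> C \<and> norm (grad (phi q 0 d k) x) ^ n \<le> C ^ n * S x)"
    using phi_limit[OF a d] .
  have iS: "integrable lborel (\<lambda>x. C ^ n * S x)" using S by simp
  note sm = phi_props(1)[OF a d, of 0]
  have [measurable]: "phi q 0 d k \<in> borel_measurable borel" "grad (phi q 0 d k) \<in> borel_measurable borel" for k
    using sm smooth_measurable smooth_grad_measurable by auto
  have [measurable]: "deta q 0 d \<in> borel_measurable borel" by (rule deta_measurable[OF a])
  have l: "AE x in lborel. (\<lambda>k. norm (grad (phi q 0 d k) x) ^ n) \<longlonglongrightarrow> norm (deta q 0 d x) ^ n"
    using C(2) by eventually_elim (intro tendsto_power tendsto_norm, simp)
  have b: "AE x in lborel. norm (norm (grad (phi q 0 d k) x) ^ n) \<le> C ^ n * S x" for k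
    using C(2) by eventually_elim simp
  have cv: "(\<lambda>k. \<integral>x. norm (grad (phi q 0 d k) x) ^ n \<partial>lborel) \<longlonglongrightarrow> (\<integral>x. norm (deta q 0 d x) ^ n \<partial>lborel)"
    by (rule integral_dominated_convergence[OF _ _ iS l b]) measurable
  have int: "integrable lborel (\<lambda>x. norm (grad (phi q 0 d k) x) ^ n)" for k
    by (rule integrable_dominated_convergence2[OF _ _ iS l b]) measurable
  have "(\<integral>\<^sup>+x. ennreal (\<bar>eta q 0 d (x + z) - eta q 0 d x\<bar> ^ n) \<partial>lborel)
    \<le> ennreal (norm z ^ n * (\<integral>x. norm (deta q 0 d x) ^ n \<partial>lborel))"
  proof (rule fatou_translation[where F="phi q 0 d"])
    show "AE x in lborel. (\<lambda>k. phi q 0 d k x) \<longlonglongrightarrow> eta q 0 d x" using C(2) by eventually_elim simp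
    show "(\<lambda>k. norm z ^ n * (\<integral>x. norm (grad (phi q 0 d k) x) ^ n \<partial>lborel)) \<longlonglongrightarrow> norm z ^ n * (\<integral>x. norm (deta q 0 d x) ^ n \<partial>lborel)"
      by (intro tendsto_mult tendsto_const cv)
    show "(\<integral>\<^sup>+x. ennreal (\<bar>phi q 0 d k (x + z) - phi q 0 d k x\<bar> ^ n) \<partial>lborel) \<le> ennreal (norm z ^ n * (\<integral>x. norm (grad (phi q 0 d k) x) ^ n \<partial>lborel))" for k
      using translation_inequality[OF sm[of k], of z n] nn_integral_eq_integral[OF int[of k]]
      by (simp add: ennreal_mult')
  qed measurable
  also have "\<dots> \<le> ennreal (norm z ^ n * ((2 * b1 / a0) ^ n * (\<integral>x. eta q 0 d x ^ n \<partial>lborel)))"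
    by (intro ennreal_leI mult_left_mono energy[OF q d t]) auto
  finally show ?thesis .
qed

end

section \<open>The weak maximum principle\<close>

text \<open>The modulus of translation \<open>J\<close> of the indicator function is subadditive, hence
  \<open>J w \<le> N * J (w / N)\<close>, which is of order \<open>N powr (1 - n)\<close>.\<close>

lemma translation_invariant_set_null:
  fixes P :: "'a::euclidean_space set"
  assumes P [measurable]: "P \<in> sets borel" and bdd: "bounded P" and n: "n \<ge> 2" and c: "c \<ge> 0"
    and le: "\<And>z. (\<integral>\<^sup>+x. ennreal \<bar>indicator P (x + z) - indicator P x\<bar> \<partial>lborel) \<le> ennreal (c * norm z ^ n * measure lborel P)"
  shows "emeasure lborel P = 0"
proof -
  define J where "J z = (\<integral>\<^sup>+x. ennreal \<bar>indicator P (x + z) - indicator P x\<bar> \<partial>lborel)" for z :: 'a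
  have Jm: "J (real k *\<^sub>R z) \<le> of_nat k * J z" for k z
  proof (induction k)
    case 0
    then show ?case by (simp add: J_def)
  next
    case (Suc k)
    have "J (real (Suc k) *\<^sub>R z) \<le> (\<integral>\<^sup>+x. ennreal \<bar>indicator P ((x + real k *\<^sub>R z) + z) - indicator P (x + real k *\<^sub>R z)\<bar>
         + ennreal \<bar>indicator P (x + real k *\<^sub>R z) - indicator P x\<bar> \<partial>lborel)"
      unfolding J_def
    proof (rule nn_integral_mono)
      fix x
      have "\<bar>indicator P (x + real (Suc k) *\<^sub>R z) - indicator P x\<bar>
          \<le> \<bar>indicator P ((x + real k *\<^sub>R z) + z) - indicator P (x + real k *\<^sub>R z)\<bar> + \<bar>indicator P (x + real k *\<^sub>R z) - indicator P x :: real\<bar>"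
        by (simp add: algebra_simps)
      from ennreal_leI[OF this] show "ennreal \<bar>indicator P (x + real (Suc k) *\<^sub>R z) - indicator P x\<bar>
          \<le> ennreal \<bar>indicator P ((x + real k *\<^sub>R z) + z) - indicator P (x + real k *\<^sub>R z)\<bar> + ennreal \<bar>indicator P (x + real k *\<^sub>R z) - indicator P x\<bar>"
        by (subst (asm) ennreal_plus) simp_all
    qed
    also have "\<dots> = (\<integral>\<^sup>+x. ennreal \<bar>indicator P ((x + real k *\<^sub>R z) + z) - indicator P (x + real k *\<^sub>R z)\<bar> \<partial>lborel) + J (real k *\<^sub>R z)"
      unfolding J_def by (rule nn_integral_add) measurable
    also have "(\<integral>\<^sup>+x. ennreal \<bar>indicator P ((x + real k *\<^sub>R z) + z) - indicator P (x + real k *\<^sub>R z)\<bar> \<partial>lborel) = J z"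
      unfolding J_def using nn_integral_translate[of "\<lambda>x. ennreal \<bar>indicator P (x + z) - indicator P x\<bar>" "real k *\<^sub>R z"]
      by (simp add: add.commute)
    also have "J z + J (real k *\<^sub>R z) \<le> J z + of_nat k * J z" by (intro add_left_mono Suc)
    also have "\<dots> = of_nat (Suc k) * J z" by (simp add: distrib_right)
    finally show ?case .
  qed
  obtain R where R: "R > 0" "\<And>x. x \<in> P \<Longrightarrow> norm x \<le> R" using bdd unfolding bounded_pos by blast
  obtain e :: 'a where e: "e \<in> Basis" using nonempty_Basis by blast
  \<comment> \<open>As P lies in a ball of radius R, a shift of length 3 R moves it off itself, and
    \<open>J w\<close> is at least the measure of P.\<close>
  define w where "w = (3 * R) *\<^sub>R e"
  have nw: "norm w = 3 * R" using e R by (simp add: w_def)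
  have fin: "emeasure lborel P < \<infinity>"
    using emeasure_bounded_finite[OF bdd] by simp
  have "emeasure lborel P = (\<integral>\<^sup>+x. indicator P x \<partial>lborel)" by simp
  also have "\<dots> \<le> J w" unfolding J_def
  proof (rule nn_integral_mono)
    fix x
    have "x + w \<notin> P" if "x \<in> P"
    proof
      assume "x + w \<in> P"
      then have "norm w \<le> norm (x + w) + norm x" using norm_triangle_ineq4[of "x + w" x] by simp
      then show False using R(2)[OF that] R(2)[OF \<open>x + w \<in> P\<close>] nw R(1) by simp
    qed
    then show "indicator P x \<le> ennreal \<bar>indicator P (x + w) - indicator P x\<bar>" by (auto simp: indicator_def)
  qed
  finally have Pw: "emeasure lborel P \<le> J w" .
  \<comment> \<open>N steps of length 3 R / N give |P| <= c (3 R)^n N^(1 - n) |P|. As n >= 2, this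
    choice of N makes the factor less than 1.\<close>
  obtain N :: nat where N: "c * (3 * R) ^ n < real N" using reals_Archimedean2 by blast
  have "0 \<le> c * (3 * R) ^ n" using c R by simp
  with N have N0: "N > 0" by (cases N) auto
  have "J w \<le> of_nat N * J ((1 / real N) *\<^sub>R w)" using Jm[of N "(1 / real N) *\<^sub>R w"] N0 by simp
  also have "\<dots> \<le> of_nat N * ennreal (c * norm ((1 / real N) *\<^sub>R w) ^ n * measure lborel P)"
    unfolding J_def by (intro mult_left_mono le) simp
  also have "\<dots> = ennreal (real N * (c * norm ((1 / real N) *\<^sub>R w) ^ n * measure lborel P))"
    using c by (simp add: ennreal_mult'' ennreal_of_nat_eq_real_of_nat)
  finally have Jw: "J w \<le> ennreal (real N * (c * norm ((1 / real N) *\<^sub>R w) ^ n * measure lborel P))" .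
  have "measure lborel P \<le> real N * (c * norm ((1 / real N) *\<^sub>R w) ^ n * measure lborel P)"
  proof -
    note Pw
    also note Jw
    finally have "ennreal (measure lborel P) \<le> ennreal (real N * (c * norm ((1 / real N) *\<^sub>R w) ^ n * measure lborel P))"
      using fin by (simp add: emeasure_eq_ennreal_measure)
    then show ?thesis using c by (subst (asm) ennreal_le_iff) auto
  qed
  also have "norm ((1 / real N) *\<^sub>R w) ^ n = (3 * R) ^ n / real N ^ n"
    using nw by (simp add: power_divide)
  also have "real N * (c * ((3 * R) ^ n / real N ^ n) * measure lborel P) = (c * (3 * R) ^ n) * measure lborel P * (real N / real N ^ n)"
    by simp
  also have "\<dots> \<le> (c * (3 * R) ^ n) * measure lborel P * (1 / real N)"
  proof (rule mult_left_mono)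
    have "real N ^ 2 \<le> real N ^ n" using n N0 by (intro power_increasing) auto
    then show "real N / real N ^ n \<le> 1 / real N" using N0 by (simp add: field_simps power2_eq_square)
  qed (use c R in simp)
  finally have "measure lborel P * real N \<le> (c * (3 * R) ^ n) * measure lborel P" using N0 by (simp add: field_simps)
  then have "measure lborel P * (real N - c * (3 * R) ^ n) \<le> 0" by (simp add: algebra_simps)
  then have "measure lborel P \<le> 0" using N by (simp add: mult_le_0_iff)
  then have "measure lborel P = 0" using measure_nonneg[of lborel P] by linarith
  then show ?thesis using fin by (simp add: measure_eq_0_null_sets emeasure_eq_ennreal_measure)
qed

context cube_approximation
begin

definition Q :: "'a set" where "Q = {x. infnorm x < s}"

lemma Q_measurable [measurable]: "Q \<in> sets borel" unfolding Q_def by measurable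

lemma Q_bounded: "bounded Q"
  unfolding bounded_iff Q_def by (intro exI[of _ K]) (use norm_less_K in \<open>auto intro: less_imp_le\<close>)

lemma Q_integrable: "A \<subseteq> Q \<Longrightarrow> A \<in> sets borel \<Longrightarrow> integrable lborel (indicator A :: 'a \<Rightarrow> real)"
  using emeasure_bounded_finite[of A] bounded_subset[OF Q_bounded] by (intro integrable_real_indicator) auto

text \<open>The estimate \<open>eta_translation\<close> is uniform in \<open>q\<close> and \<open>d\<close>. If \<open>t0 > c\<close> is the essential supremum
  in the cube, the functions \<open>eta q 0 d\<close>, normalised, tend to the indicator function of \<open>{x. u x = t0}\<close> as
  \<open>q\<close> grows, so this set is null.\<close>

lemma top_level_null:
  assumes t0: "t0 > c" and top: "AE x in lborel. infnorm x < s \<longrightarrow> u x \<le> t0"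
  shows "emeasure lborel {x \<in> Q. t0 \<le> u x} = 0"
proof (rule translation_invariant_set_null[OF _ _ n2])
  let ?P = "{x \<in> Q. t0 \<le> u x}"
  \<comment> \<open>Close enough to the top for the condition u - d <= 1/2 of the energy inequality,
    and not below the boundary bound c. The largest essential value of u - d is
    \<open>tm\<close>.\<close>
  define d where "d = max c (t0 - 1 / 2)"
  define tm where "tm = t0 - d"
  have d: "c \<le> d" "d < t0" and tm: "tm > 0" "tm \<le> 1 / 2" using t0 by (auto simp: d_def tm_def max_def)
  have half: "AE x in lborel. infnorm x < s \<longrightarrow> u x - d \<le> 1 / 2"
    using top by eventually_elim (use tm in \<open>auto simp: tm_def\<close>)
  show Pm [measurable]: "?P \<in> sets borel" by measurable
  show "bounded ?P" by (rule bounded_subset[OF Q_bounded]) auto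
  show "(2 * b1 / a0) ^ n \<ge> 0" using b1 a0 by simp
  \<comment> \<open>Normalised to be 1 on the top level. Where d < u < t0 it equals
    exp(-\<open>\<kappa>\<close>)^(i + 1) with \<open>\<kappa>\<close> = 1 / (u - d) - 1 / tm > 0
    and tends to zero. The parameter q is i + 1 because the energy inequality asks for q >=
    1.\<close>
  define F where "F i x = eta (real (Suc i)) 0 d x / flat (real (Suc i)) 0 tm" for i x
  have [measurable]: "F i \<in> borel_measurable borel" for i unfolding F_def using eta_measurable[of "real (Suc i)"] by simp
  have fp: "flat (real (Suc i)) 0 tm > 0" for i using tm by (simp add: flat_pos)
  have F01: "AE x in lborel. \<forall>i. 0 \<le> F i x \<and> F i x \<le> indicator Q x"
    using top
  proof eventually_elim
    case (elim x)
    show ?case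
    proof (intro allI conjI)
      fix i
      show "0 \<le> F i x" by (simp add: F_def eta_def flat_nonneg)
      show "F i x \<le> indicator Q x"
      proof (cases "infnorm x < s \<and> u x - d > 0")
        case True
        then have "real (Suc i) / tm \<le> real (Suc i) / (u x - d)" using elim by (intro divide_left_mono) (auto simp: tm_def)
        then have "flat (real (Suc i)) 0 (u x - d) \<le> flat (real (Suc i)) 0 tm" using True tm by (simp add: flat_def)
        then show ?thesis using True fp[of i] by (simp add: F_def eta_def Q_def)
      qed (auto simp: F_def eta_def flat_eq_0 Q_def indicator_def)
    qed
  qed
  have Flim: "AE x in lborel. (\<lambda>i. F i x) \<longlonglongrightarrow> indicator ?P x"
    using top
  proof eventually_elim
    case (elim x)
    consider "\<not> infnorm x < s \<or> u x - d \<le> 0" | "infnorm x < s" "u x - d > 0" "u x < t0" | "infnorm x < s" "u x \<ge> t0" by linarith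
    then show ?case
    proof cases
      case 1
      then have "F i x = 0" for i by (auto simp: F_def eta_def flat_eq_0)
      moreover have "x \<notin> ?P" using 1 d by (auto simp: Q_def)
      ultimately show ?thesis by simp
    next
      case 2
      define \<kappa> where "\<kappa> = 1 / (u x - d) - 1 / tm"
      have "\<kappa> > 0" 
      proof -
        have "u x - d < tm" using 2 by (simp add: tm_def)
        then have "1 / tm < 1 / (u x - d)" using 2 tm by (intro divide_strict_left_mono) auto
        then show ?thesis by (simp add: \<kappa>_def)
      qed
      have "F i x = exp (- \<kappa>) ^ Suc i" for i
      proof -
        have "exp (- \<kappa>) ^ Suc i = exp (real (Suc i) * - \<kappa>)" by (rule exp_of_nat_mult[symmetric])
        also have "real (Suc i) * - \<kappa> = - (real (Suc i) / (u x - d)) - (- (real (Suc i) / tm))"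
          by (simp only: \<kappa>_def minus_diff_eq right_diff_distrib times_divide_eq_right mult_1_right)
        also have "exp \<dots> = exp (- (real (Suc i) / (u x - d))) / exp (- (real (Suc i) / tm))" by (rule exp_diff)
        finally show ?thesis using 2 tm by (simp add: F_def eta_def flat_def)
      qed
      moreover have "(\<lambda>i. exp (- \<kappa>) ^ Suc i) \<longlonglongrightarrow> 0"
        using \<open>\<kappa> > 0\<close> by (intro LIMSEQ_Suc LIMSEQ_realpow_zero) auto
      ultimately show ?thesis using 2 by simp
    next
      case 3
      then have "u x - d = tm" using elim by (simp add: tm_def)
      then have "F i x = 1" for i using 3 fp[of i] by (simp add: F_def eta_def)
      then show ?thesis using 3 by (simp add: Q_def)
    qed
  qed
  have iF: "(\<lambda>i. \<integral>x. F i x ^ n \<partial>lborel) \<longlonglongrightarrow> (\<integral>x. indicator ?P x \<partial>lborel)"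
  proof (rule integral_dominated_convergence[where w="indicator Q"])
    show "integrable lborel (indicator Q :: 'a \<Rightarrow> real)" by (rule Q_integrable) auto
    show "AE x in lborel. (\<lambda>i. F i x ^ n) \<longlonglongrightarrow> indicator ?P x"
      using Flim
    proof eventually_elim
      case (elim x)
      have "(\<lambda>i. F i x ^ n) \<longlonglongrightarrow> indicator ?P x ^ n" by (intro tendsto_intros elim)
      moreover have "(indicator ?P x :: real) ^ n = indicator ?P x" using n2 by (simp add: indicator_def zero_power)
      ultimately show ?case by simp
    qed
    show "AE x in lborel. norm (F i x ^ n) \<le> indicator Q x" for i
      using F01
    proof eventually_elim
      case (elim x)
      then have "F i x ^ n \<le> indicator Q x ^ n" "0 \<le> F i x" by (auto intro: power_mono)
      moreover have "(indicator Q x :: real) ^ n = indicator Q x" using n2 by (simp add: indicator_def zero_power)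
      ultimately show ?case by simp
    qed
  qed measurable
  have Fle: "(\<integral>\<^sup>+x. ennreal (\<bar>F i (x + z) - F i x\<bar> ^ n) \<partial>lborel)
      \<le> ennreal (norm z ^ n * ((2 * b1 / a0) ^ n * (\<integral>x. F i x ^ n \<partial>lborel)))" for i z
  proof -
    let ?f = "flat (real (Suc i)) 0 tm ^ n"
    let ?E = "eta (real (Suc i)) 0 d"
    have f0: "?f > 0" using fp[of i] by simp
    have [measurable]: "?E \<in> borel_measurable borel" by (rule eta_measurable) simp
    have "(\<integral>\<^sup>+x. ennreal (\<bar>F i (x + z) - F i x\<bar> ^ n) \<partial>lborel)
       = (\<integral>\<^sup>+x. ennreal (1 / ?f) * ennreal (\<bar>?E (x + z) - ?E x\<bar> ^ n) \<partial>lborel)"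
    proof (rule nn_integral_cong)
      fix x
      have "\<bar>F i (x + z) - F i x\<bar> ^ n = (1 / ?f) * \<bar>?E (x + z) - ?E x\<bar> ^ n"
        using fp[of i] by (simp add: F_def diff_divide_distrib[symmetric] power_divide)
      then show "ennreal (\<bar>F i (x + z) - F i x\<bar> ^ n) = ennreal (1 / ?f) * ennreal (\<bar>?E (x + z) - ?E x\<bar> ^ n)"
        using f0 by (simp only:) (rule ennreal_mult', simp)
    qed
    also have "\<dots> = ennreal (1 / ?f) * (\<integral>\<^sup>+x. ennreal (\<bar>?E (x + z) - ?E x\<bar> ^ n) \<partial>lborel)"
      by (rule nn_integral_cmult) measurable
    also have "\<dots> \<le> ennreal (1 / ?f) * ennreal (norm z ^ n * ((2 * b1 / a0) ^ n * (\<integral>x. ?E x ^ n \<partial>lborel)))"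
      by (intro mult_left_mono eta_translation half d) auto
    also have "\<dots> = ennreal ((1 / ?f) * (norm z ^ n * ((2 * b1 / a0) ^ n * (\<integral>x. ?E x ^ n \<partial>lborel))))"
      using f0 by (intro ennreal_mult'[symmetric]) simp
    also have "(1 / ?f) * (norm z ^ n * ((2 * b1 / a0) ^ n * (\<integral>x. ?E x ^ n \<partial>lborel)))
       = norm z ^ n * ((2 * b1 / a0) ^ n * (\<integral>x. F i x ^ n \<partial>lborel))"
      by (simp add: F_def power_divide)
    finally show ?thesis .
  qed
  fix z :: 'a
  have "(\<integral>\<^sup>+x. ennreal (\<bar>indicator ?P (x + z) - indicator ?P x\<bar> ^ n) \<partial>lborel)
      \<le> ennreal (norm z ^ n * ((2 * b1 / a0) ^ n * (\<integral>x. indicator ?P x \<partial>lborel)))"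
  proof (rule fatou_translation[where F=F])
    show "(\<lambda>i. norm z ^ n * ((2 * b1 / a0) ^ n * (\<integral>x. F i x ^ n \<partial>lborel)))
        \<longlonglongrightarrow> norm z ^ n * ((2 * b1 / a0) ^ n * (\<integral>x. indicator ?P x \<partial>lborel))"
      by (intro tendsto_mult tendsto_const iF)
  qed (use Flim Fle in auto)
  moreover have "\<bar>indicator ?P (x + z) - indicator ?P x :: real\<bar> ^ n = \<bar>indicator ?P (x + z) - indicator ?P x\<bar>" for x
    using n2 by (simp add: indicator_def zero_power)
  ultimately show "(\<integral>\<^sup>+x. ennreal \<bar>indicator ?P (x + z) - indicator ?P x\<bar> \<partial>lborel)
      \<le> ennreal ((2 * b1 / a0) ^ n * norm z ^ n * measure lborel ?P)"
    by (simp add: mult_ac)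
qed

text \<open>By the preceding lemma the support of \<open>eta 1 0 d\<close> shrinks to a null set as \<open>d\<close> increases to
  \<open>t0\<close>. Averaging \<open>eta_translation\<close> over a small ball of translations shows that a function with small
  support can satisfy it only if it vanishes.\<close>

lemma lower_top_level:
  assumes t0: "t0 > c" and top: "AE x in lborel. infnorm x < s \<longrightarrow> u x \<le> t0"
  shows "\<exists>d<t0. AE x in lborel. infnorm x < s \<longrightarrow> u x \<le> d"
proof -
  define \<Lambda> where "\<Lambda> = (2 * b1 / a0) ^ n"
  have L0: "\<Lambda> \<ge> 0" using b1 a0 by (simp add: \<Lambda>_def)
  \<comment> \<open>Translations shorter than \<open>rad\<close> change E by at most a quarter of
    its n-th power integral, to be compared with the half obtained from \<open>low\<close>.\<close>
  define rad where "rad = min 1 (1 / (4 * (\<Lambda> + 1)))"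
  have rad: "rad > 0" "\<Lambda> * rad ^ n \<le> 1 / 4"
  proof -
    show "rad > 0" using L0 by (simp add: rad_def)
    then have "rad ^ n \<le> rad ^ 1" using n2 by (intro power_decreasing) (auto simp: rad_def)
    then have "\<Lambda> * rad ^ n \<le> \<Lambda> * (1 / (4 * (\<Lambda> + 1)))" using L0 by (intro mult_left_mono) (auto simp: rad_def)
    also have "\<dots> \<le> 1 / 4" using L0 by (simp add: field_simps)
    finally show "\<Lambda> * rad ^ n \<le> 1 / 4" .
  qed
  define W where "W = ball (0::'a) rad"
  have [measurable]: "W \<in> sets borel" by (simp add: W_def)
  define v where "v = measure lborel W"
  have v: "v > 0" unfolding v_def W_def using content_ball_pos[OF rad(1), of "0::'a"] by simp
  have Wfin: "emeasure lborel W = ennreal v" unfolding v_def W_def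
    using emeasure_bounded_finite[OF bounded_ball, of "0::'a" rad] by (intro emeasure_eq_ennreal_measure) auto
  \<comment> \<open>Levels tending to t0 that respect both d >= c and t0 - d <= 1/2 from the first
    index on.\<close>
  define dk where "dk k = max (max c (t0 - 1 / 2)) (t0 - 1 / real (Suc k))" for k :: nat
  have dk: "c \<le> dk k" "dk k < t0" "t0 - dk k \<le> 1 / 2" for k
  proof -
    have "1 / real (Suc k) > 0" by simp
    then show "c \<le> dk k" "dk k < t0" "t0 - dk k \<le> 1 / 2" unfolding dk_def using t0 by linarith+
  qed
  have dklim: "dk \<longlonglongrightarrow> t0"
  proof -
    have "(\<lambda>k. t0 - 1 / real (Suc k)) \<longlonglongrightarrow> t0 - 0" by (intro tendsto_intros LIMSEQ_Suc lim_1_over_n)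
    then have "(\<lambda>k. max (max c (t0 - 1 / 2)) (t0 - 1 / real (Suc k))) \<longlonglongrightarrow> max (max c (t0 - 1 / 2)) (t0 - 0)"
      by (intro tendsto_max tendsto_const)
    moreover have "max (max c (t0 - 1 / 2)) (t0 - 0) = t0" using t0 by linarith
    ultimately show ?thesis by (simp only: dk_def[abs_def])
  qed
  define A where "A d = {x \<in> Q. u x > d}" for d
  have [measurable]: "A d \<in> sets borel" for d unfolding A_def by measurable
  have AQ: "A d \<subseteq> Q" for d by (auto simp: A_def)
  have "(\<lambda>k. \<integral>x. indicator (A (dk k)) x \<partial>lborel) \<longlonglongrightarrow> (\<integral>x. (0::real) \<partial>(lborel :: 'a measure))"
  proof (rule integral_dominated_convergence[where w="indicator Q"])
    show "integrable lborel (indicator Q :: 'a \<Rightarrow> real)" by (rule Q_integrable) auto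
    have "AE x in lborel. x \<notin> {x \<in> Q. t0 \<le> u x}"
      by (rule AE_not_in) (use top_level_null[OF t0 top] in \<open>simp add: null_sets_def\<close>)
    then show "AE x in lborel. (\<lambda>k. indicator (A (dk k)) x :: real) \<longlonglongrightarrow> 0"
    proof eventually_elim
      case (elim x)
      have "\<forall>\<^sub>F k in sequentially. 0 = (indicator (A (dk k)) x :: real)"
      proof (cases "x \<in> Q")
        case True
        then have "u x < t0" using elim by simp
        then have "\<forall>\<^sub>F k in sequentially. u x < dk k" by (rule order_tendstoD(1)[OF dklim])
        then show ?thesis by eventually_elim (simp add: A_def)
      qed (simp add: A_def)
      then show ?case by (rule Lim_transform_eventually[OF tendsto_const])
    qed
    show "AE x in lborel. norm (indicator (A (dk k)) x :: real) \<le> indicator Q x" for k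
      using AQ by (intro AE_I2) (auto simp: indicator_def)
  qed measurable
  then have "\<forall>\<^sub>F k in sequentially. (\<integral>x. indicator (A (dk k)) x \<partial>lborel) < v / 2"
    using v by (intro order_tendstoD) auto
  then obtain k where k: "(\<integral>x. indicator (A (dk k)) x \<partial>lborel) < v / 2" by (auto simp: eventually_sequentially)
  define d where "d = dk k"
  have d: "c \<le> d" "d < t0" using dk by (auto simp: d_def)
  have half: "AE x in lborel. infnorm x < s \<longrightarrow> u x - d \<le> 1 / 2"
    using top by eventually_elim (use dk(3)[of k] in \<open>auto simp: d_def\<close>)
  have Afin: "emeasure lborel (A d) < \<infinity>"
    using emeasure_bounded_finite[of "A d"] bounded_subset[OF Q_bounded AQ] by simp
  have Asmall: "emeasure lborel (A d) \<le> ennreal (v / 2)"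
    using k Afin by (simp add: d_def emeasure_eq_ennreal_measure ennreal_leI)
  define E where "E = eta 1 0 d"
  have [measurable]: "E \<in> borel_measurable borel" unfolding E_def by (rule eta_measurable) simp
  have E0: "E x \<ge> 0" for x by (simp add: E_def eta_def flat_nonneg)
  have Epos: "E x > 0 \<longleftrightarrow> x \<in> A d" for x
    by (auto simp: E_def eta_def A_def Q_def flat_def)
  have EnA: "x \<notin> A d \<Longrightarrow> E x = 0" for x using Epos[of x] E0[of x] by auto
  define I where "I = (\<integral>x. E x ^ n \<partial>lborel)"
  have iE: "integrable lborel (\<lambda>x. E x ^ n)" unfolding E_def by (rule eta_power_integrable) simp
  have I0: "I \<ge> 0" unfolding I_def using E0 by (intro integral_nonneg_AE) auto
  have nnE: "(\<integral>\<^sup>+x. ennreal (E x ^ n) \<partial>lborel) = ennreal I"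
    unfolding I_def by (rule nn_integral_eq_integral[OF iE]) (use E0 in auto)
  \<comment> \<open>The set A d has at most half the measure of the ball W, so for every x at least
    half of the shifts z in W lead out of A d. There E(x + z) = 0, and the difference E(x + z) - E x
    has modulus E x.\<close>
  have low: "ennreal (v / 2) \<le> (\<integral>\<^sup>+z. indicator W z * indicator (- A d) (x + z) \<partial>lborel)" for x
  proof -
    have "ennreal v = (\<integral>\<^sup>+z. indicator W z \<partial>lborel)" by (simp add: Wfin)
    also have "\<dots> \<le> (\<integral>\<^sup>+z. indicator W z * indicator (- A d) (x + z) + indicator (A d) (x + z) \<partial>lborel)"
      by (rule nn_integral_mono) (auto simp: indicator_def)
    also have "\<dots> = (\<integral>\<^sup>+z. indicator W z * indicator (- A d) (x + z) \<partial>lborel) + (\<integral>\<^sup>+z. indicator (A d) (x + z) \<partial>lborel)"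
      by (rule nn_integral_add) measurable
    also have "(\<integral>\<^sup>+z. indicator (A d) (x + z) \<partial>lborel) = emeasure lborel (A d)"
      using nn_integral_translate[of "indicator (A d)" x] by simp
    also have "(\<integral>\<^sup>+z. indicator W z * indicator (- A d) (x + z) \<partial>lborel) + emeasure lborel (A d)
       \<le> (\<integral>\<^sup>+z. indicator W z * indicator (- A d) (x + z) \<partial>lborel) + ennreal (v / 2)" by (intro add_left_mono Asmall)
    finally have "ennreal v \<le> (\<integral>\<^sup>+z. indicator W z * indicator (- A d) (x + z) \<partial>lborel) + ennreal (v / 2)" .
    then have "ennreal (v / 2) + ennreal (v / 2) \<le> (\<integral>\<^sup>+z. indicator W z * indicator (- A d) (x + z) \<partial>lborel) + ennreal (v / 2)"
      using v by (simp flip: ennreal_plus)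
    then show ?thesis by (simp add: ennreal_add_left_cancel_le add.commute)
  qed
  have "ennreal (v / 2) * ennreal I = (\<integral>\<^sup>+x. ennreal (v / 2) * ennreal (E x ^ n) \<partial>lborel)"
    unfolding nnE[symmetric] by (rule nn_integral_cmult[symmetric]) measurable
  also have "\<dots> \<le> (\<integral>\<^sup>+x. (\<integral>\<^sup>+z. indicator W z * ennreal (\<bar>E (x + z) - E x\<bar> ^ n) \<partial>lborel) \<partial>lborel)"
  proof (rule nn_integral_mono)
    fix x
    have "ennreal (v / 2) * ennreal (E x ^ n) \<le> (\<integral>\<^sup>+z. indicator W z * indicator (- A d) (x + z) \<partial>lborel) * ennreal (E x ^ n)"
      by (rule mult_right_mono[OF low]) simp
    also have "\<dots> = (\<integral>\<^sup>+z. indicator W z * indicator (- A d) (x + z) * ennreal (E x ^ n) \<partial>lborel)"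
      by (rule nn_integral_multc[symmetric]) measurable
    also have "\<dots> \<le> (\<integral>\<^sup>+z. indicator W z * ennreal (\<bar>E (x + z) - E x\<bar> ^ n) \<partial>lborel)"
      by (rule nn_integral_mono) (use EnA E0 in \<open>auto simp: indicator_def\<close>)
    finally show "ennreal (v / 2) * ennreal (E x ^ n) \<le> (\<integral>\<^sup>+z. indicator W z * ennreal (\<bar>E (x + z) - E x\<bar> ^ n) \<partial>lborel)" .
  qed
  also have "\<dots> = (\<integral>\<^sup>+z. (\<integral>\<^sup>+x. indicator W z * ennreal (\<bar>E (x + z) - E x\<bar> ^ n) \<partial>lborel) \<partial>lborel)"
    by (rule lborel_pair.Fubini') measurable
  also have "\<dots> \<le> (\<integral>\<^sup>+z. ennreal (I / 4) * indicator W z \<partial>lborel)"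
  proof (rule nn_integral_mono)
    fix z :: 'a
    show "(\<integral>\<^sup>+x. indicator W z * ennreal (\<bar>E (x + z) - E x\<bar> ^ n) \<partial>lborel) \<le> ennreal (I / 4) * indicator W z"
    proof (cases "z \<in> W")
      case True
      have "(\<integral>\<^sup>+x. ennreal (\<bar>E (x + z) - E x\<bar> ^ n) \<partial>lborel) \<le> ennreal (norm z ^ n * (\<Lambda> * I))"
        unfolding E_def \<Lambda>_def I_def by (rule eta_translation[OF _ d(1) half]) simp
      also have "\<dots> \<le> ennreal (I / 4)"
      proof (rule ennreal_leI)
        have "norm z ^ n \<le> rad ^ n" using True by (intro power_mono) (auto simp: W_def)
        then have "norm z ^ n * (\<Lambda> * I) \<le> rad ^ n * (\<Lambda> * I)" using L0 I0 by (intro mult_right_mono) auto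
        also have "\<dots> \<le> (1 / 4) * I" using mult_right_mono[OF rad(2) I0] by (simp add: mult_ac)
        finally show "norm z ^ n * (\<Lambda> * I) \<le> I / 4" by simp
      qed
      finally show ?thesis using True by simp
    qed simp
  qed
  also have "\<dots> = ennreal (I / 4) * ennreal v" by (subst nn_integral_cmult_indicator) (auto simp: Wfin)
  finally have "ennreal (v / 2) * ennreal I \<le> ennreal (I / 4) * ennreal v" .
  moreover have "ennreal (v / 2) * ennreal I = ennreal (v / 2 * I)" "ennreal (I / 4) * ennreal v = ennreal (I / 4 * v)"
    using v I0 by (rule_tac ennreal_mult'[symmetric]; simp)+
  ultimately have "ennreal (v / 2 * I) \<le> ennreal (I / 4 * v)" by (simp only:)
  then have "v / 2 * I \<le> I / 4 * v" using v I0 by (subst (asm) ennreal_le_iff) auto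
  then have "v * I \<le> 0" by (simp add: mult.commute)
  then have "I = 0" using v I0 by (simp add: mult_le_0_iff)
  then have "AE x in lborel. E x ^ n = 0"
    unfolding I_def using integral_nonneg_eq_0_iff_AE[OF iE] E0 by auto
  then have "AE x in lborel. infnorm x < s \<longrightarrow> u x \<le> d"
  proof eventually_elim
    case (elim x)
    then have "x \<notin> A d" using Epos[of x] n2 by auto
    then show ?case by (auto simp: A_def Q_def)
  qed
  then show ?thesis using d(2) by blast
qed

text \<open>The infimum t0 of the essential upper bounds in the cube is itself such a bound, by a
  countable intersection. If t0 > c, then \<open>lower_top_level\<close> produces a smaller
  one.\<close>

theorem weak_maximum_principle: "AE x in lborel. infnorm x < s \<longrightarrow> u x \<le> c"
proof (rule ccontr)
  assume not: "\<not> ?thesis"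
  define X where "X = {t. AE x in lborel. infnorm x < s \<longrightarrow> u x \<le> t}"
  have up: "t' \<in> X" if "t \<in> X" "t \<le> t'" for t t'
    using that(1) unfolding X_def mem_Collect_eq by eventually_elim (use that(2) in auto)
  have "M \<in> X" using ub by (simp add: X_def)
  have cX: "c < t" if "t \<in> X" for t
    using up[OF that, of c] not by (force simp: X_def)
  then have bb: "bdd_below X" by (intro bdd_belowI[of _ c]) (auto intro: less_imp_le)
  define t0 where "t0 = Inf X"
  have "AE x in lborel. \<forall>k::nat. infnorm x < s \<longrightarrow> u x \<le> t0 + 1 / real (Suc k)"
  proof (subst AE_all_countable, intro allI)
    fix k :: nat
    have "Inf X < t0 + 1 / real (Suc k)" by (simp add: t0_def)
    then obtain t where "t \<in> X" "t < t0 + 1 / real (Suc k)" using cInf_lessD \<open>M \<in> X\<close> by blast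
    then have "t0 + 1 / real (Suc k) \<in> X" using up by auto
    then show "AE x in lborel. infnorm x < s \<longrightarrow> u x \<le> t0 + 1 / real (Suc k)" by (simp add: X_def)
  qed
  then have t0: "AE x in lborel. infnorm x < s \<longrightarrow> u x \<le> t0"
  proof eventually_elim
    case (elim x)
    have l: "(\<lambda>k. t0 + 1 / real (Suc k)) \<longlonglongrightarrow> t0 + 0" by (intro tendsto_intros LIMSEQ_Suc lim_1_over_n)
    show ?case using LIMSEQ_le_const[OF l] elim by auto
  qed
  then have "t0 \<in> X" by (simp add: X_def)
  then have "c < t0" by (rule cX)
  from lower_top_level[OF this t0] obtain d where "d < t0" "d \<in> X" by (auto simp: X_def)
  then show False using cInf_lower[OF _ bb] by (fastforce simp: t0_def)
qed

end

section \<open>The logarithmic energy estimate\<close>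

text \<open>It depends on x / R only, so its gradient is of order 1 / R. On the annulus between the
  cubes, |x|^2 / R^2 lies between 1 and 4 DIM; the thresholds 1/2 and 5 DIM leave distances of at
  least 1/2 and 1, whence the lower bound exp(-2) exp(-1).\<close>

definition annulus_cutoff :: "real \<Rightarrow> 'a::euclidean_space \<Rightarrow> real" where
  "annulus_cutoff R x = flat 1 0 (x \<bullet> x * (1 / R\<^sup>2) - 1 / 2) * flat 1 0 (5 * real DIM('a) - x \<bullet> x * (1 / R\<^sup>2))"

lemma smooth_annulus_cutoff: "smooth (annulus_cutoff R)"
  unfolding annulus_cutoff_def by (intro smooth_intros zero_less_one)

lemma annulus_cutoff_bounds: "0 \<le> annulus_cutoff R x" "annulus_cutoff R x \<le> 1"
proof -
  have "0 \<le> flat 1 0 t" "flat 1 0 t \<le> 1" for t by (auto simp: flat_def)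
  then show "0 \<le> annulus_cutoff R x" "annulus_cutoff R x \<le> 1" by (auto simp: annulus_cutoff_def mult_le_one)
qed

lemma annulus_cutoff_scale:
  "R > 0 \<Longrightarrow> annulus_cutoff R x = annulus_cutoff 1 ((1 / R) *\<^sub>R x)"
  by (simp add: annulus_cutoff_def power2_eq_square)

lemma annulus_cutoff_outside:
  assumes R: "R > 0"
  shows "vanishes_outside (5 * real DIM('a) * R) (annulus_cutoff R :: 'a::euclidean_space \<Rightarrow> real)"
  unfolding vanishes_outside_def
proof (intro allI impI)
  fix x :: 'a assume "norm x > 5 * real DIM('a) * R"
  then have "(5 * real DIM('a) * R)\<^sup>2 \<le> (norm x)\<^sup>2" using R by (intro power_mono) auto
  then have "(5 * real DIM('a))\<^sup>2 \<le> x \<bullet> x / R\<^sup>2" using R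
    by (simp add: power2_norm_eq_inner power_mult_distrib pos_le_divide_eq)
  moreover have "5 * real DIM('a) \<le> (5 * real DIM('a))\<^sup>2"
  proof (rule self_le_power)
    show "1 \<le> 5 * real DIM('a)" using DIM_ge_Suc0[where 'a='a] by linarith
  qed simp
  ultimately show "annulus_cutoff R x = 0" by (simp add: annulus_cutoff_def flat_eq_0)
qed

lemma annulus_cutoff_inside:
  assumes R: "R > 0" and x: "norm x < R / 2"
  shows "annulus_cutoff R x = 0"
proof -
  have "(norm x)\<^sup>2 \<le> (R / 2)\<^sup>2" using x by (intro power_mono) auto
  then have "x \<bullet> x \<le> R\<^sup>2 / 4" by (simp add: power2_norm_eq_inner power_divide)
  also have "\<dots> \<le> R\<^sup>2 / 2" by simp
  finally have "x \<bullet> x * (1 / R\<^sup>2) - 1 / 2 \<le> 0" using R by (simp add: divide_le_eq)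
  then show ?thesis unfolding annulus_cutoff_def by (simp only: flat_eq_0 mult_zero_left)
qed

lemma annulus_cutoff_lower:
  fixes x :: "'a::euclidean_space"
  assumes R: "R > 0" and x: "R \<le> infnorm x" "infnorm x \<le> 2 * R"
  shows "exp (- 3) \<le> annulus_cutoff R x"
proof -
  have "R\<^sup>2 \<le> (norm x)\<^sup>2" using x R infnorm_le_norm[of x] by (intro power_mono) auto
  then have l: "1 / 2 \<le> x \<bullet> x / R\<^sup>2 - 1 / 2" using R by (simp add: power2_norm_eq_inner pos_le_divide_eq)
  have "x \<bullet> x = (\<Sum>b\<in>Basis. (x \<bullet> b)\<^sup>2)" by (subst euclidean_inner) (simp add: power2_eq_square)
  also have "\<dots> \<le> (\<Sum>b\<in>(Basis::'a set). (2 * R)\<^sup>2)"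
  proof (rule sum_mono)
    fix b :: 'a assume "b \<in> Basis"
    then have "\<bar>x \<bullet> b\<bar> \<le> 2 * R" using Basis_le_infnorm[of b x] x by simp
    then show "(x \<bullet> b)\<^sup>2 \<le> (2 * R)\<^sup>2" using R by (intro power2_le_iff_abs_le[THEN iffD2]) auto
  qed
  also have "\<dots> = 4 * real DIM('a) * R\<^sup>2" by (simp add: power_mult_distrib)
  finally have "x \<bullet> x / R\<^sup>2 \<le> 4 * real DIM('a)" using R by (simp add: divide_le_eq)
  then have r: "1 \<le> 5 * real DIM('a) - x \<bullet> x / R\<^sup>2" using DIM_ge_Suc0[where 'a='a] by linarith
  have "1 / t \<le> 2" if "1 / 2 \<le> t" for t :: real using that by (simp add: divide_le_eq)
  then have f1: "exp (- 2) \<le> flat 1 0 t" if "1 / 2 \<le> t" for t using that by (simp add: flat_def)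
  have f2: "exp (- 1) \<le> flat 1 0 t" if "1 \<le> t" for t using that by (simp add: flat_def divide_le_eq)
  have "exp (- 3) = exp (- 2) * exp (- 1 :: real)" by (simp flip: exp_add)
  also have "\<dots> \<le> annulus_cutoff R x" unfolding annulus_cutoff_def using f1[OF l] f2[OF r]
    by (intro mult_mono) (auto simp: flat_nonneg)
  finally show ?thesis .
qed

lemma annulus_cutoff_grad:
  obtains L where "L \<ge> 0" "\<And>R x. R > 0 \<Longrightarrow> norm (grad (annulus_cutoff R :: 'a::euclidean_space \<Rightarrow> real) x) \<le> L / R"
proof -
  have "vanishes_outside (5 * real DIM('a) * 1) (annulus_cutoff 1 :: 'a \<Rightarrow> real)" by (rule annulus_cutoff_outside) simp
  then obtain L where L: "L \<ge> 0" "\<And>x. norm (grad (annulus_cutoff 1 :: 'a \<Rightarrow> real) x) \<le> L"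
    using bounded_grad[OF smooth_annulus_cutoff] by metis
  have "norm (grad (annulus_cutoff R :: 'a \<Rightarrow> real) x) \<le> L / R" if R: "R > 0" for R x
  proof -
    have "((\<lambda>x. (1 / R) *\<^sub>R x) has_derivative (\<lambda>h. (1 / R) *\<^sub>R h)) (at x)" by (auto intro!: derivative_eq_intros)
    note d = has_derivative_compose[OF this smooth_has_derivative[OF smooth_annulus_cutoff, of 1]]
    have "((annulus_cutoff R :: 'a \<Rightarrow> real) has_derivative (\<lambda>h. grad (annulus_cutoff 1) ((1 / R) *\<^sub>R x) \<bullet> (1 / R) *\<^sub>R h)) (at x)"
    proof -
      have e: "(annulus_cutoff R :: 'a \<Rightarrow> real) = (\<lambda>x. annulus_cutoff 1 ((1 / R) *\<^sub>R x))"
        using annulus_cutoff_scale[OF R] by (rule ext)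
      show ?thesis by (subst e) (rule d)
    qed
    then have "((annulus_cutoff R :: 'a \<Rightarrow> real) has_derivative (\<lambda>h. ((1 / R) *\<^sub>R grad (annulus_cutoff 1) ((1 / R) *\<^sub>R x)) \<bullet> h)) (at x)"
      by (rule has_derivative_eq_rhs) (simp add: fun_eq_iff)
    from grad_eqI[OF this] show ?thesis using L(2)[of "(1 / R) *\<^sub>R x"] R by (simp add: divide_right_mono)
  qed
  with L(1) that show ?thesis by blast
qed

lemma grad_log_test:
  assumes \<theta>: "smooth \<theta>" and y: "smooth y" "\<And>x. y x > 0" and n: "n \<ge> 2"
  shows "grad (\<lambda>x. \<theta> x ^ n * inverse (y x) ^ (n - 1)) x =
    (real n * \<theta> x ^ (n - 1) * inverse (y x) ^ (n - 1)) *\<^sub>R grad \<theta> x - (real (n - 1) * \<theta> x ^ n * inverse (y x) ^ n) *\<^sub>R grad y x"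
proof (rule grad_eqI)
  obtain l where l: "n = Suc (Suc l)" using n by (metis add_2_eq_Suc le_Suc_ex)
  have nz: "y x \<noteq> 0" using y(2)[of x] by simp
  have i: "((\<lambda>x. inverse (y x)) has_derivative (\<lambda>h. - (inverse (y x) * (grad y x \<bullet> h) * inverse (y x)))) (at x)"
    by (rule Deriv.has_derivative_inverse[OF nz smooth_has_derivative[OF y(1)]])
  have "((\<lambda>x. \<theta> x ^ n * inverse (y x) ^ (n - 1)) has_derivative
     (\<lambda>h. \<theta> x ^ n * (real (n - 1) * (- (inverse (y x) * (grad y x \<bullet> h) * inverse (y x))) * inverse (y x) ^ (n - 1 - 1))
        + (real n * (grad \<theta> x \<bullet> h) * \<theta> x ^ (n - 1)) * inverse (y x) ^ (n - 1))) (at x)"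
    by (rule has_derivative_mult[OF has_derivative_power[OF smooth_has_derivative[OF \<theta>]] has_derivative_power[OF i]])
  then show "((\<lambda>x. \<theta> x ^ n * inverse (y x) ^ (n - 1)) has_derivative (\<bullet>)
    ((real n * \<theta> x ^ (n - 1) * inverse (y x) ^ (n - 1)) *\<^sub>R grad \<theta> x - (real (n - 1) * \<theta> x ^ n * inverse (y x) ^ n) *\<^sub>R grad y x)) (at x)"
    by (rule has_derivative_eq_rhs) (simp add: fun_eq_iff l inner_diff_left algebra_simps)
qed

context weak_solution
begin

text \<open>The test function is \<open>\<theta> ^ n * (u - m + \<epsilon>) powr (1 - n)\<close>. Since the drift coefficient is at most
  \<open>2 * b1 / R\<close> on the annulus, the bound depends neither on \<open>R\<close> nor on \<open>\<epsilon>\<close>.\<close>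

lemma log_energy:
  obtains C where "C \<ge> 0" "\<And>R \<epsilon>. R \<ge> 2 \<Longrightarrow> \<epsilon> > 0 \<Longrightarrow>
    (\<integral>\<^sup>+x. indicator {x. R \<le> infnorm x \<and> infnorm x \<le> 2 * R} x * ennreal ((norm (G x) / (u x - m + \<epsilon>)) ^ n) \<partial>lborel) \<le> ennreal C"
proof -
  obtain L where L: "L \<ge> 0" "\<And>R x. R > 0 \<Longrightarrow> norm (grad (annulus_cutoff R :: 'a \<Rightarrow> real) x) \<le> L / R"
    using annulus_cutoff_grad by metis
  \<comment> \<open>R times the sum of the two error coefficients: n |a1| L / R comes from the
    gradient of the cut-off and 2 b1 / R from the drift.\<close>
  define \<kappa> where "\<kappa> = real n * \<bar>a1\<bar> * L + 2 * b1"
  have \<kappa>0: "\<kappa> > 0" using L b1 by (simp add: \<kappa>_def add_nonneg_pos)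
  \<comment> \<open>Half of the coercivity constant (n - 1) a0, so that one half survives after
    absorption.\<close>
  define \<delta> where "\<delta> = real (n - 1) * a0 / 2"
  have \<delta>0: "\<delta> > 0" using n2 a0 by (simp add: \<delta>_def)
  \<comment> \<open>The power of exp 3 undoes the lower bound of the cut-off on the annulus. The
    number 10 n is the side 2 r of a cube containing the support, divided by R; it cancels the R in
    \<open>\<kappa>\<close> / R.\<close>
  define C where "C = exp 3 ^ n * (1 / \<delta> * ((\<kappa> * (10 * real n)) ^ n / \<delta> ^ (n - 1)))"
  show ?thesis
  proof (rule that[of C])
    show "C \<ge> 0" using \<kappa>0 \<delta>0 by (simp add: C_def)
    fix R \<epsilon> :: real assume R2: "R \<ge> 2" and \<epsilon>: "\<epsilon> > 0"
    then have R: "R > 0" by simp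
    define \<theta> where "\<theta> = (annulus_cutoff R :: 'a \<Rightarrow> real)"
    have \<theta>s: "smooth \<theta>" unfolding \<theta>_def by (rule smooth_annulus_cutoff)
    have [measurable]: "\<theta> \<in> borel_measurable borel" "grad \<theta> \<in> borel_measurable borel"
      using smooth_measurable[OF \<theta>s] smooth_grad_measurable[OF \<theta>s] .
    have \<theta>b: "0 \<le> \<theta> x" "\<theta> x \<le> 1" for x unfolding \<theta>_def by (rule annulus_cutoff_bounds)+
    define r where "r = 5 * real n * R"
    have \<theta>z: "vanishes_outside r \<theta>" unfolding \<theta>_def r_def n_def by (rule annulus_cutoff_outside[OF R])
    have gz: "vanishes_outside r (grad \<theta>)" by (rule grad_zero_outside[OF \<theta>z])
    obtain U S where ap: "approximates U S (r + 1)" using approximation by blast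
    note U = approximatesD(1-3)[OF ap] and S = approximatesD(4,5)[OF ap] and UAE = approximatesD(6)[OF ap]
    define Y where "Y k x = U k x - m + \<epsilon>" for k x
    define y where "y x = u x - m + \<epsilon>" for x
    have [measurable]: "y \<in> borel_measurable borel" unfolding y_def by measurable
    have Ye: "\<epsilon> \<le> Y k x" for k x using U(2)[of k x] by (simp add: Y_def)
    have ye: "\<epsilon> \<le> y x" for x using ub(1)[of x] by (simp add: y_def)
    have Y0: "Y k x > 0" for k x using Ye[of k x] \<epsilon> by linarith
    have y0: "y x > 0" for x using ye[of x] \<epsilon> by linarith
    have Ys: "smooth (Y k)" for k unfolding Y_def by (auto intro!: smooth_intros U)
    have gY: "grad (Y k) x = grad (U k) x" for k x
    proof (rule grad_eqI)
      show "(Y k has_derivative (\<bullet>) (grad (U k) x)) (at x)"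
        unfolding Y_def using smooth_has_derivative[OF U(1)[of k], of x] by (auto intro!: derivative_eq_intros)
    qed
    define \<phi> where "\<phi> k x = \<theta> x ^ n * inverse (Y k x) ^ (n - 1)" for k x
    have Ynz: "Y k x \<noteq> 0" for k x using Y0[of k x] by simp
    have \<phi>s: "smooth (\<phi> k)" for k unfolding \<phi>_def by (intro smooth_intros \<theta>s Ys Ynz)
    have \<phi>z: "vanishes_outside r (\<phi> k)" for k
      using \<theta>z n2 by (auto simp: vanishes_outside_def \<phi>_def zero_power)
    have g\<phi>: "grad (\<phi> k) x = (real n * \<theta> x ^ (n - 1) * inverse (Y k x) ^ (n - 1)) *\<^sub>R grad \<theta> x
        - (real (n - 1) * \<theta> x ^ n * inverse (Y k x) ^ n) *\<^sub>R grad (U k) x" for k x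
      unfolding \<phi>_def using grad_log_test[OF \<theta>s Ys Y0 n2, of k x] by (simp add: gY)
    define \<eta> where "\<eta> x = \<theta> x ^ n * inverse (y x) ^ (n - 1)" for x
    define H where "H x = (real n * \<theta> x ^ (n - 1) * inverse (y x) ^ (n - 1)) *\<^sub>R grad \<theta> x
        - (real (n - 1) * \<theta> x ^ n * inverse (y x) ^ n) *\<^sub>R G x" for x
    have Hm: "\<eta> \<in> borel_measurable borel" "H \<in> borel_measurable borel"
      unfolding \<eta>_def H_def by measurable
    define ie where "ie = inverse \<epsilon>"
    have ie: "ie > 0" using \<epsilon> by (simp add: ie_def)
    have Yi: "inverse (Y k x) \<le> ie" "0 \<le> inverse (Y k x)" for k x
      unfolding ie_def using Ye[of k x] \<epsilon> Y0[of k x] by (auto intro: le_imp_inverse_le)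
    have yi: "inverse (y x) \<le> ie" "0 \<le> inverse (y x)" for x
      unfolding ie_def using ye[of x] \<epsilon> y0[of x] by (auto intro: le_imp_inverse_le)
    define c1 where "c1 = real n * ie ^ (n - 1) * (L / R)"
    define c2 where "c2 = real (n - 1) * ie ^ n"
    have c0: "c1 \<ge> 0" "c2 \<ge> 0" using ie L R by (auto simp: c1_def c2_def)
    define S' where "S' x = 2 ^ n * (c1 ^ n * indicator (cball 0 r) x + c2 ^ n * S x)" for x :: 'a
    have S': "integrable lborel S'" unfolding S'_def
      using S emeasure_lborel_cball_finite
      by (intro integrable_mult_right Bochner_Integration.integrable_add integrable_real_indicator) auto
    have conv: "AE x in lborel. (\<lambda>k. \<phi> k x) \<longlonglongrightarrow> \<eta> x \<and> (\<lambda>k. grad (\<phi> k) x) \<longlonglongrightarrow> H x \<and>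
      (\<forall>k. \<bar>\<phi> k x\<bar> \<le> ie ^ (n - 1) \<and> norm (grad (\<phi> k) x) ^ n \<le> S' x)"
      using UAE
    proof eventually_elim
      case (elim x)
      have \<phi>b: "\<bar>\<phi> k x\<bar> \<le> ie ^ (n - 1)" for k
      proof -
        have "\<theta> x ^ n * inverse (Y k x) ^ (n - 1) \<le> 1 * ie ^ (n - 1)"
          using \<theta>b[of x] Yi[of k x] ie by (intro mult_mono power_mono power_le_one) auto
        then show ?thesis using \<theta>b[of x] Yi[of k x] by (simp add: \<phi>_def abs_mult power_abs)
      qed
      show ?case
      proof (cases "norm x > r")
        case True
        have z: "\<theta> x = 0" "grad \<theta> x = 0" using vanishes_outsideD[OF \<theta>z True] vanishes_outsideD[OF gz True] by auto
        have "\<phi> k x = 0" "grad (\<phi> k) x = 0" "\<eta> x = 0" "H x = 0" for k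
          using z n2 by (auto simp: \<phi>_def g\<phi> \<eta>_def H_def zero_power)
        moreover have "0 \<le> S' x" using S(2)[of x] c0 by (simp add: S'_def)
        ultimately show ?thesis using \<phi>b n2 by (simp add: zero_power)
      next
        case False
        then have x: "(\<lambda>k. U k x) \<longlonglongrightarrow> u x" "(\<lambda>k. grad (U k) x) \<longlonglongrightarrow> G x" "\<And>k. norm (grad (U k) x) ^ n \<le> S x"
          using elim by auto
        have li: "(\<lambda>k. inverse (Y k x)) \<longlonglongrightarrow> inverse (y x)"
          unfolding Y_def y_def using y0[of x] by (intro tendsto_intros x) (simp add: y_def)
        have "(\<lambda>k. \<phi> k x) \<longlonglongrightarrow> \<eta> x" unfolding \<phi>_def \<eta>_def by (intro tendsto_intros li)
        moreover have "(\<lambda>k. grad (\<phi> k) x) \<longlonglongrightarrow> H x" unfolding g\<phi> H_def by (intro tendsto_intros x li)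
        moreover have "norm (grad (\<phi> k) x) ^ n \<le> S' x" for k
        proof -
          have "norm (grad (\<phi> k) x) \<le> real n * \<theta> x ^ (n - 1) * inverse (Y k x) ^ (n - 1) * norm (grad \<theta> x)
              + real (n - 1) * \<theta> x ^ n * inverse (Y k x) ^ n * norm (grad (U k) x)"
            unfolding g\<phi>
            by (rule order_trans[OF norm_triangle_ineq4]) (use \<theta>b[of x] Y0[of k x] in \<open>simp add: abs_mult power_abs\<close>)
          also have "\<dots> \<le> c1 + c2 * norm (grad (U k) x)"
          proof (intro add_mono mult_right_mono)
            have a: "real n * \<theta> x ^ (n - 1) * inverse (Y k x) ^ (n - 1) \<le> real n * 1 * ie ^ (n - 1)"
              using \<theta>b[of x] Yi[of k x] ie by (intro mult_mono power_mono power_le_one) auto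
            have b: "norm (grad \<theta> x) \<le> L / R" unfolding \<theta>_def by (rule L(2)[OF R])
            have "0 \<le> real n * 1 * ie ^ (n - 1)" using ie by simp
            from mult_mono[OF a b this norm_ge_zero]
            show "real n * \<theta> x ^ (n - 1) * inverse (Y k x) ^ (n - 1) * norm (grad \<theta> x) \<le> c1"
              unfolding c1_def by simp
            have "real (n - 1) * \<theta> x ^ n * inverse (Y k x) ^ n \<le> real (n - 1) * 1 * ie ^ n"
              using \<theta>b[of x] Yi[of k x] ie by (intro mult_mono power_mono power_le_one) auto
            then show "real (n - 1) * \<theta> x ^ n * inverse (Y k x) ^ n \<le> c2" by (simp add: c2_def)
          qed simp
          finally have "norm (grad (\<phi> k) x) ^ n \<le> (c1 + c2 * norm (grad (U k) x)) ^ n" by (intro power_mono) auto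
          also have "\<dots> \<le> 2 ^ n * (c1 ^ n + (c2 * norm (grad (U k) x)) ^ n)" using c0 by (intro power_add_le) auto
          also have "\<dots> = 2 ^ n * (c1 ^ n + c2 ^ n * norm (grad (U k) x) ^ n)" by (simp only: power_mult_distrib)
          also have "\<dots> \<le> 2 ^ n * (c1 ^ n + c2 ^ n * S x)" using c0 x(3) by (intro mult_left_mono add_left_mono) auto
          also have "\<dots> = S' x" using False by (simp add: S'_def)
          finally show ?thesis .
        qed
        ultimately show ?thesis using \<phi>b by blast
      qed
    qed
    note lim = limit_equation[OF \<phi>s \<phi>z S' Hm conv]
    \<comment> \<open>The cut-off times the norm of the formal gradient of ln y; its n-th power
      integral is the localised logarithmic energy.\<close>
    define P where "P x = \<theta> x * norm (G x) * inverse (y x)" for x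
    have P0: "P x \<ge> 0" for x using \<theta>b[of x] yi[of x] by (simp add: P_def)
    have [measurable]: "P \<in> borel_measurable borel" unfolding P_def by measurable
    define k where "k x = (\<kappa> / R) * indicator (cub r) x" for x :: 'a
    have iP: "integrable lborel (\<lambda>x. P x ^ n)"
    proof (rule Bochner_Integration.integrable_bound)
      show "integrable lborel (\<lambda>x. ie ^ n * (indicator (cball 0 r) x * norm (G x) ^ n))" using Gi by simp
      show "AE x in lborel. norm (P x ^ n) \<le> norm (ie ^ n * (indicator (cball 0 r) x * norm (G x) ^ n))"
      proof (rule AE_I2)
        fix x
        show "norm (P x ^ n) \<le> norm (ie ^ n * (indicator (cball 0 r) x * norm (G x) ^ n))"
        proof (cases "norm x > r")
          case True
          then show ?thesis using vanishes_outsideD[OF \<theta>z True] n2 by (simp add: P_def zero_power)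
        next
          case False
          have "P x \<le> 1 * norm (G x) * ie" unfolding P_def using \<theta>b[of x] yi[of x] by (intro mult_mono) auto
          then have "P x ^ n \<le> (ie * norm (G x)) ^ n" using P0[of x] by (intro power_mono) (auto simp: mult.commute)
          then show ?thesis using False P0[of x] ie by (simp add: power_mult_distrib)
        qed
      qed
    qed measurable
    have ik: "integrable lborel (\<lambda>x. k x ^ n)" "(\<integral>x. k x ^ n \<partial>lborel) = (\<kappa> * (10 * real n)) ^ n"
    proof -
      have r0: "r \<ge> 0" using R by (simp add: r_def)
      have e: "k x ^ n = (\<kappa> / R) ^ n * indicator (cub r) x" for x
        using n2 by (simp add: k_def indicator_def zero_power)
      have f: "emeasure lborel (cub r :: 'a set) = ennreal ((2 * r) ^ n)" using emeasure_cub[OF r0, where 'a='a] by (simp add: n_def)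
      show "integrable lborel (\<lambda>x. k x ^ n)" unfolding e using f
        by (intro integrable_mult_right integrable_real_indicator) auto
      have "(\<integral>x. k x ^ n \<partial>lborel) = (\<kappa> / R) ^ n * (2 * r) ^ n" unfolding e using f r0 by (simp add: measure_def)
      also have "\<dots> = (\<kappa> * (10 * real n)) ^ n" 
      proof -
        have "\<kappa> / R * (2 * r) = \<kappa> * (10 * real n)" using R by (simp add: r_def)
        then show ?thesis by (simp only: power_mult_distrib[symmetric])
      qed
      finally show "(\<integral>x. k x ^ n \<partial>lborel) = (\<kappa> * (10 * real n)) ^ n" .
    qed
    \<comment> \<open>Differentiating the negative power of y produces the coercive term with a
      negative sign. All other terms, the drift with either sign included, are at most P^(n - 1) k
      and are absorbed by Young's inequality.\<close>
    have pointwise: "AE x in lborel. V x \<bullet> H x + B x * \<eta> x \<le> k x ^ n / \<delta> ^ (n - 1) - \<delta> * P x ^ n"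
      using str
    proof eventually_elim
      case (elim x)
      have ks: "real n * \<bar>a1\<bar> * norm (grad \<theta> x) + decay b1 x * \<theta> x \<le> k x"
      proof (cases "norm x > r")
        case True
        then have "\<theta> x = 0" "grad \<theta> x = 0" using vanishes_outsideD[OF \<theta>z True] vanishes_outsideD[OF gz True] by auto
        then show ?thesis using \<kappa>0 R by (simp add: k_def)
      next
        case False
        then have c: "x \<in> cub r" using Basis_le_norm[of _ x] by (force simp: cub_def)
        have "real n * \<bar>a1\<bar> * norm (grad \<theta> x) \<le> real n * \<bar>a1\<bar> * (L / R)"
          unfolding \<theta>_def using L(2)[OF R] by (intro mult_left_mono) auto
        moreover have "decay b1 x * \<theta> x \<le> 2 * b1 / R"
        proof (cases "norm x < R / 2")
          case True
          then show ?thesis using annulus_cutoff_inside[OF R True] b1 R by (simp add: \<theta>_def)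
        next
          case False
          have "decay b1 x \<le> 2 * b1 / R"
          proof (cases "norm x \<le> 1")
            case True
            \<comment> \<open>Here R / 2 <= norm x <= 1 and R >= 2, so R = 2 and the bound 2 b1 / R
              is just b1.\<close>
            then have "R = 2" using False R2 by simp
            then show ?thesis using decay_bounds(2)[of x] by simp
          next
            case xl: False
            have "b1 / norm x \<le> b1 / (R / 2)" using False R b1 xl by (intro divide_left_mono mult_pos_pos) auto
            then show ?thesis using xl by (simp add: decay_def mult.commute)
          qed
          then have "decay b1 x * \<theta> x \<le> 2 * b1 / R * 1"
            using \<theta>b[of x] decay_bounds(1)[of x] b1 R by (intro mult_mono) auto
          then show ?thesis by simp
        qed
        ultimately have "real n * \<bar>a1\<bar> * norm (grad \<theta> x) + decay b1 x * \<theta> x \<le> real n * \<bar>a1\<bar> * (L / R) + 2 * b1 / R" by linarith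
        also have "\<dots> = k x" using c by (simp add: k_def \<kappa>_def add_divide_distrib)
        finally show ?thesis .
      qed
      define iy where "iy = inverse (y x)"
      have iy: "iy > 0" using y0[of x] by (simp add: iy_def)
      have Pe: "P x = \<theta> x * norm (G x) * iy" by (simp add: P_def iy_def)
      have nn: "n = Suc (n - 1)" using n2 by simp
      have t1: "V x \<bullet> ((real n * \<theta> x ^ (n - 1) * iy ^ (n - 1)) *\<^sub>R grad \<theta> x) \<le> P x ^ (n - 1) * (real n * \<bar>a1\<bar> * norm (grad \<theta> x))"
      proof -
        have "V x \<bullet> grad \<theta> x \<le> norm (V x) * norm (grad \<theta> x)" by (rule norm_cauchy_schwarz)
        also have "\<dots> \<le> (\<bar>a1\<bar> * norm (G x) ^ (n - 1)) * norm (grad \<theta> x)"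
        proof (rule mult_right_mono)
          have "norm (V x) \<le> a1 * norm (G x) ^ (n - 1)" using elim by simp
          also have "\<dots> \<le> \<bar>a1\<bar> * norm (G x) ^ (n - 1)" by (rule mult_right_mono) auto
          finally show "norm (V x) \<le> \<bar>a1\<bar> * norm (G x) ^ (n - 1)" .
        qed simp
        finally have "(real n * \<theta> x ^ (n - 1) * iy ^ (n - 1)) * (V x \<bullet> grad \<theta> x) \<le> (real n * \<theta> x ^ (n - 1) * iy ^ (n - 1)) * ((\<bar>a1\<bar> * norm (G x) ^ (n - 1)) * norm (grad \<theta> x))"
          using \<theta>b[of x] iy by (intro mult_left_mono) auto
        then show ?thesis by (simp add: Pe power_mult_distrib mult_ac)
      qed
      have t2: "real (n - 1) * a0 * P x ^ n \<le> V x \<bullet> ((real (n - 1) * \<theta> x ^ n * iy ^ n) *\<^sub>R G x)"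
      proof -
        have "(real (n - 1) * \<theta> x ^ n * iy ^ n) * (a0 * norm (G x) ^ n) \<le> (real (n - 1) * \<theta> x ^ n * iy ^ n) * (V x \<bullet> G x)"
          using \<theta>b[of x] iy elim by (intro mult_left_mono) auto
        then show ?thesis by (simp add: Pe power_mult_distrib mult_ac)
      qed
      have t3: "B x * \<eta> x \<le> P x ^ (n - 1) * (decay b1 x * \<theta> x)"
      proof -
        have e0: "\<eta> x = \<theta> x ^ n * iy ^ (n - 1)" "0 \<le> \<eta> x" using \<theta>b[of x] iy by (auto simp: \<eta>_def iy_def)
        have "B x * \<eta> x \<le> \<bar>B x\<bar> * \<eta> x" using e0 by (intro mult_right_mono) auto
        also have "\<dots> \<le> (decay b1 x * norm (G x) ^ (n - 1)) * \<eta> x" using e0 elim by (intro mult_right_mono) auto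
        also have "\<dots> = P x ^ (n - 1) * (decay b1 x * \<theta> x)"
          unfolding e0(1) Pe power_mult_distrib by (subst nn) (simp only: power_Suc mult_ac)
        finally show ?thesis .
      qed
      have "V x \<bullet> H x + B x * \<eta> x \<le> P x ^ (n - 1) * (real n * \<bar>a1\<bar> * norm (grad \<theta> x)) - real (n - 1) * a0 * P x ^ n + P x ^ (n - 1) * (decay b1 x * \<theta> x)"
        unfolding H_def inner_diff_right iy_def[symmetric] using t1 t2 t3 by linarith
      also have "\<dots> = P x ^ (n - 1) * (real n * \<bar>a1\<bar> * norm (grad \<theta> x) + decay b1 x * \<theta> x) - 2 * \<delta> * P x ^ n"
        by (simp add: \<delta>_def algebra_simps)
      also have "\<dots> \<le> P x ^ (n - 1) * k x - 2 * \<delta> * P x ^ n"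
        using ks P0[of x] by (intro diff_right_mono mult_left_mono) auto
      also have "\<dots> \<le> (\<delta> * P x ^ n + k x ^ n / \<delta> ^ (n - 1)) - 2 * \<delta> * P x ^ n"
        using P0[of x] \<delta>0 n2 \<kappa>0 R by (intro diff_right_mono young_product) (auto simp: k_def)
      finally show ?case by simp
    qed
    have "0 = (\<integral>x. V x \<bullet> H x + B x * \<eta> x \<partial>lborel)" using lim by simp
    also have "\<dots> \<le> (\<integral>x. k x ^ n / \<delta> ^ (n - 1) - \<delta> * P x ^ n \<partial>lborel)"
      by (rule integral_mono_AE[OF _ _ pointwise]) (use lim ik iP in auto)
    also have "\<dots> = (\<kappa> * (10 * real n)) ^ n / \<delta> ^ (n - 1) - \<delta> * (\<integral>x. P x ^ n \<partial>lborel)"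
      using ik iP by simp
    finally have "\<delta> * (\<integral>x. P x ^ n \<partial>lborel) \<le> (\<kappa> * (10 * real n)) ^ n / \<delta> ^ (n - 1)" by simp
    then have PI: "(\<integral>x. P x ^ n \<partial>lborel) \<le> 1 / \<delta> * ((\<kappa> * (10 * real n)) ^ n / \<delta> ^ (n - 1))"
      using \<delta>0 by (simp add: field_simps)
    have "(\<integral>\<^sup>+x. indicator {x. R \<le> infnorm x \<and> infnorm x \<le> 2 * R} x * ennreal ((norm (G x) / (u x - m + \<epsilon>)) ^ n) \<partial>lborel)
      \<le> (\<integral>\<^sup>+x. ennreal (exp 3 ^ n * P x ^ n) \<partial>lborel)"
    proof (rule nn_integral_mono)
      fix x
      show "indicator {x. R \<le> infnorm x \<and> infnorm x \<le> 2 * R} x * ennreal ((norm (G x) / (u x - m + \<epsilon>)) ^ n) \<le> ennreal (exp 3 ^ n * P x ^ n)"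
      proof (cases "R \<le> infnorm x \<and> infnorm x \<le> 2 * R")
        case True
        then have "exp (- 3) \<le> \<theta> x" unfolding \<theta>_def using R by (intro annulus_cutoff_lower) auto
        then have "exp 3 * exp (- 3) \<le> exp 3 * \<theta> x" by (intro mult_left_mono) auto
        then have "1 \<le> exp 3 * \<theta> x" by (simp flip: exp_add)
        then have "1 * (norm (G x) * inverse (y x)) \<le> (exp 3 * \<theta> x) * (norm (G x) * inverse (y x))"
          using yi[of x] by (intro mult_right_mono) auto
        then have "norm (G x) / (u x - m + \<epsilon>) \<le> exp 3 * P x" by (simp add: P_def y_def divide_inverse mult_ac)
        then have "(norm (G x) / (u x - m + \<epsilon>)) ^ n \<le> (exp 3 * P x) ^ n"
          using y0[of x] by (intro power_mono) (auto simp: y_def)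
        then show ?thesis using True by (simp add: power_mult_distrib ennreal_leI)
      qed simp
    qed
    also have "\<dots> = ennreal (exp 3 ^ n * (\<integral>x. P x ^ n \<partial>lborel))"
      by (subst nn_integral_eq_integral) (use iP P0 in auto)
    also have "\<dots> \<le> ennreal C" unfolding C_def by (intro ennreal_leI mult_left_mono PI) simp
    finally show "(\<integral>\<^sup>+x. indicator {x. R \<le> infnorm x \<and> infnorm x \<le> 2 * R} x * ennreal ((norm (G x) / (u x - m + \<epsilon>)) ^ n) \<partial>lborel) \<le> ennreal C" .
  qed
qed

end

section \<open>Harnack inequality and Liouville theorem\<close>

lemma grad_minus: "smooth f \<Longrightarrow> grad (\<lambda>x. - f x) x = - grad f x"
  by (rule grad_eqI) (use smooth_has_derivative[of f x] in \<open>auto intro!: derivative_eq_intros\<close>)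

context weak_solution
begin

lemma minus_solution: "weak_solution (\<lambda>x. - u x) (\<lambda>x. - G x) (\<lambda>x. - V x) (\<lambda>x. - B x) a0 a1 b1 (- M) (- m) n"
proof
  show "AE x in lborel. a0 * norm (- G x) ^ n \<le> - V x \<bullet> - G x \<and> norm (- V x) \<le> a1 * norm (- G x) ^ (n - 1) \<and>
     \<bar>- B x\<bar> \<le> decay b1 x * norm (- G x) ^ (n - 1)"
    using str by simp
next
  fix \<phi> :: "'a \<Rightarrow> real" and r :: real and b :: 'a assume "smooth \<phi>" "vanishes_outside r \<phi>" "b \<in> Basis"
  from weak[OF this] show "(\<integral>x. - u x * (grad \<phi> x \<bullet> b) \<partial>lborel) = - (\<integral>x. (- G x \<bullet> b) * \<phi> x \<partial>lborel)" by simp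
next
  fix \<phi> :: "'a \<Rightarrow> real" and r :: real assume "smooth \<phi>" "vanishes_outside r \<phi>"
  from eq[OF this] show "(\<integral>x. - V x \<bullet> grad \<phi> x \<partial>lborel) + (\<integral>x. - B x * \<phi> x \<partial>lborel) = 0" by simp
qed (use n_def n2 a0 b1 ub Gi in auto)

text \<open>Dropping finitely many indices makes the boundary bound hold for all k, and the limit s
  of the half-sides is at least R, so the maximum principle covers the cube of half-side R.\<close>

lemma boundary_upper_bound:
  assumes ap: "approximates U S K"
    and sk: "sk \<longlonglongrightarrow> s" "\<And>k. R \<le> sk k" "\<And>k. real n * sk k \<le> R0" and R0K: "R0 < K"
    and bd: "\<forall>\<^sub>F k in sequentially. \<forall>x. infnorm x = sk k \<longrightarrow> U k x < c"
  shows "AE x in lborel. infnorm x < R \<longrightarrow> u x \<le> c"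
proof -
  obtain N where N: "\<And>k x. k \<ge> N \<Longrightarrow> infnorm x = sk k \<Longrightarrow> U k x < c"
    using bd by (auto simp: eventually_sequentially)
  have Rs: "R \<le> s" by (rule LIMSEQ_le_const[OF sk(1)]) (use sk(2) in auto)
  interpret cube_approximation u G V B a0 a1 b1 m M n "\<lambda>k. U (k + N)" S K R0 s c "\<lambda>k. sk (k + N)"
  proof
    show "approximates (\<lambda>k. U (k + N)) S K" by (rule approximates_subseq[OF ap]) (simp add: strict_mono_def)
    show "(\<lambda>k. sk (k + N)) \<longlonglongrightarrow> s" using sk(1) by (rule LIMSEQ_ignore_initial_segment)
  qed (use sk R0K N in auto)
  show ?thesis using weak_maximum_principle by eventually_elim (use Rs in auto)
qed

text \<open>\<open>good_cube\<close> is applied to the logarithms of the smooth approximations,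
  whose energies converge to that of ln(u - m + \<open>\<epsilon>\<close>). The resulting comparison
  on varying cube boundaries is carried inside by the maximum principle for u and - u.\<close>

lemma harnack:
  obtains Kc where "Kc > 0" "\<And>R \<epsilon>. R \<ge> 2 \<Longrightarrow> \<epsilon> > 0 \<Longrightarrow>
    \<exists>a b. (AE x in lborel. infnorm x < R \<longrightarrow> a \<le> u x \<and> u x \<le> b) \<and> b - m + \<epsilon> \<le> Kc * (a - m + \<epsilon>)"
proof -
  obtain C where C: "C \<ge> 0" "\<And>R \<epsilon>. R \<ge> 2 \<Longrightarrow> \<epsilon> > 0 \<Longrightarrow>
    (\<integral>\<^sup>+x. indicator {x. R \<le> infnorm x \<and> infnorm x \<le> 2 * R} x * ennreal ((norm (G x) / (u x - m + \<epsilon>)) ^ n) \<partial>lborel) \<le> ennreal C"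
    by (rule log_energy) blast
  \<comment> \<open>The limit energy is at most C, so from some index on the approximations have
    energy below C + 1; \<open>good_cube\<close> is used with this bound.\<close>
  have E0: "C + 1 \<ge> 0" and dim: "DIM('a) \<ge> 2" using C(1) n2 by (auto simp: n_def)
  obtain K where K: "\<And>R f. R > 0 \<Longrightarrow> smooth f \<Longrightarrow>
    (\<integral>\<^sup>+x. indicator {x. R \<le> infnorm x \<and> infnorm x \<le> 2 * R} x * ennreal (norm (grad f x) ^ DIM('a)) \<partial>lborel) \<le> ennreal (C + 1) \<Longrightarrow>
    \<exists>s. R \<le> s \<and> s \<le> 2 * R \<and> (\<forall>x y. infnorm x = s \<longrightarrow> infnorm y = s \<longrightarrow> \<bar>f x - f (y::'a)\<bar> \<le> K)"
    using good_cube[OF E0 dim] by blast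
  \<comment> \<open>A factor exp K is lost in the upper and again in the lower bound. The 4 consists
    of a factor 2 on each side, the slack that turns limits into the strict boundary inequalities
    required for large k.\<close>
  define Kc where "Kc = 4 * exp (2 * K)"
  show ?thesis
  proof (rule that[of Kc])
    show "Kc > 0" by (simp add: Kc_def)
    fix R \<epsilon> :: real assume R2: "R \<ge> 2" and \<epsilon>: "\<epsilon> > 0"
    then have R: "R > 0" by simp
    define R0 where "R0 = real n * (2 * R)"
    obtain U S where ap: "approximates U S (R0 + 1)" using approximation by blast
    note U = approximatesD(1-3)[OF ap] and S = approximatesD(4,5)[OF ap] and UAE = approximatesD(6)[OF ap]
    define Y where "Y k x = U k x - m + \<epsilon>" for k x
    define y where "y x = u x - m + \<epsilon>" for x
    have [measurable]: "y \<in> borel_measurable borel" unfolding y_def by measurable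
    have Ye: "\<epsilon> \<le> Y k x" for k x using U(2)[of k x] by (simp add: Y_def)
    have Y0: "Y k x > 0" for k x using Ye[of k x] \<epsilon> by linarith
    have y0: "y x > 0" for x using ub(1)[of x] \<epsilon> by (simp add: y_def)
    define f where "f k x = ln (Y k x)" for k x
    have Ys: "smooth (Y k)" for k unfolding Y_def by (auto intro!: smooth_intros U)
    have fs: "smooth (f k)" for k unfolding f_def by (intro smooth_intros Ys Y0)
    have gf: "grad (f k) x = inverse (Y k x) *\<^sub>R grad (U k) x" for k x
    proof (rule grad_eqI)
      have "(Y k has_derivative (\<lambda>h. grad (U k) x \<bullet> h)) (at x)"
        unfolding Y_def using smooth_has_derivative[OF U(1)[of k], of x] by (auto intro!: derivative_eq_intros)
      from has_derivative_ln[OF Y0 this]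
      show "(f k has_derivative (\<bullet>) (inverse (Y k x) *\<^sub>R grad (U k) x)) (at x)"
        unfolding f_def by (rule has_derivative_eq_rhs) (auto simp: fun_eq_iff mult_ac)
    qed
    have [measurable]: "grad (f k) \<in> borel_measurable borel" for k by (rule smooth_grad_measurable[OF fs])
    define sh where "sh = {x::'a. R \<le> infnorm x \<and> infnorm x \<le> 2 * R}"
    have [measurable]: "sh \<in> sets borel" unfolding sh_def by measurable
    have shn: "norm x < R0 + 1" if "x \<in> sh" for x
    proof -
      have "real n * infnorm x \<le> R0" unfolding R0_def using that by (intro mult_left_mono) (auto simp: sh_def)
      then show ?thesis using norm_le_infnorm_DIM[of x] by (simp add: n_def)
    qed
    have lim: "AE x in lborel. (\<lambda>k. indicator sh x * norm (grad (f k) x) ^ n) \<longlonglongrightarrow> indicator sh x * (norm (G x) / y x) ^ n"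
      using UAE
    proof eventually_elim
      case (elim x)
      show ?case
      proof (cases "x \<in> sh")
        case True
        then have l: "(\<lambda>k. U k x) \<longlonglongrightarrow> u x" "(\<lambda>k. grad (U k) x) \<longlonglongrightarrow> G x" using elim shn by auto
        have "(\<lambda>k. norm (inverse (Y k x) *\<^sub>R grad (U k) x) ^ n) \<longlonglongrightarrow> norm (inverse (y x) *\<^sub>R G x) ^ n"
          unfolding Y_def y_def using y0[of x] by (intro tendsto_intros l) (simp add: y_def)
        moreover have "norm (inverse (y x) *\<^sub>R G x) = norm (G x) / y x" using y0[of x] by (simp add: divide_inverse mult.commute)
        ultimately show ?thesis using True by (simp add: gf)
      qed simp
    qed
    define ie where "ie = inverse \<epsilon>"
    have dom: "AE x in lborel. norm (indicator sh x * norm (grad (f k) x) ^ n) \<le> ie ^ n * S x" for k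
      using UAE
    proof eventually_elim
      case (elim x)
      show ?case
      proof (cases "x \<in> sh")
        case True
        then have "norm (grad (U k) x) ^ n \<le> S x" using elim shn by auto
        moreover have "inverse (Y k x) \<le> ie" "0 \<le> inverse (Y k x)"
          unfolding ie_def using Ye[of k x] \<epsilon> Y0[of k x] by (auto intro: le_imp_inverse_le)
        ultimately have "inverse (Y k x) ^ n * norm (grad (U k) x) ^ n \<le> ie ^ n * S x"
          using \<epsilon> by (intro mult_mono power_mono) (auto simp: ie_def)
        then show ?thesis using True Y0[of k x] by (simp add: gf power_mult_distrib)
      qed (use S(2)[of x] \<epsilon> in \<open>simp add: ie_def\<close>)
    qed
    have iS: "integrable lborel (\<lambda>x. ie ^ n * S x)" using S by simp
    have cv: "(\<lambda>k. \<integral>x. indicator sh x * norm (grad (f k) x) ^ n \<partial>lborel) \<longlonglongrightarrow> (\<integral>x. indicator sh x * (norm (G x) / y x) ^ n \<partial>lborel)"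
      by (rule integral_dominated_convergence[OF _ _ iS lim dom]) measurable
    have ii: "integrable lborel (\<lambda>x. indicator sh x * norm (grad (f k) x) ^ n)" for k
      by (rule integrable_dominated_convergence2[OF _ _ iS lim dom]) measurable
    have il: "integrable lborel (\<lambda>x. indicator sh x * (norm (G x) / y x) ^ n)"
      by (rule integrable_dominated_convergence[OF _ _ iS lim dom]) measurable
    have "ennreal (\<integral>x. indicator sh x * (norm (G x) / y x) ^ n \<partial>lborel) = (\<integral>\<^sup>+x. ennreal (indicator sh x * (norm (G x) / y x) ^ n) \<partial>lborel)"
      by (rule nn_integral_eq_integral[symmetric, OF il]) (use y0 in \<open>auto intro!: AE_I2 mult_nonneg_nonneg zero_le_power divide_nonneg_pos\<close>)
    also have "\<dots> = (\<integral>\<^sup>+x. indicator sh x * ennreal ((norm (G x) / (u x - m + \<epsilon>)) ^ n) \<partial>lborel)"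
      by (rule nn_integral_cong) (auto simp: indicator_def y_def)
    also have "\<dots> \<le> ennreal C" unfolding sh_def by (rule C(2)[OF R2 \<epsilon>])
    finally have "(\<integral>x. indicator sh x * (norm (G x) / y x) ^ n \<partial>lborel) < C + 1" using C(1) by (simp add: ennreal_le_iff)
    then have "\<forall>\<^sub>F k in sequentially. (\<integral>x. indicator sh x * norm (grad (f k) x) ^ n \<partial>lborel) < C + 1"
      by (rule order_tendstoD(2)[OF cv])
    then obtain N where N: "\<And>k. k \<ge> N \<Longrightarrow> (\<integral>x. indicator sh x * norm (grad (f k) x) ^ n \<partial>lborel) < C + 1"
      by (auto simp: eventually_sequentially)
    have "\<exists>s. R \<le> s \<and> s \<le> 2 * R \<and> (\<forall>x y. infnorm x = s \<longrightarrow> infnorm y = s \<longrightarrow> \<bar>f (k + N) x - f (k + N) y\<bar> \<le> K)" for k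
    proof (rule K[OF R fs])
      have "(\<integral>\<^sup>+x. indicator sh x * ennreal (norm (grad (f (k + N)) x) ^ n) \<partial>lborel) = (\<integral>\<^sup>+x. ennreal (indicator sh x * norm (grad (f (k + N)) x) ^ n) \<partial>lborel)"
        by (rule nn_integral_cong) (auto simp: indicator_def)
      also have "\<dots> = ennreal (\<integral>x. indicator sh x * norm (grad (f (k + N)) x) ^ n \<partial>lborel)"
        by (rule nn_integral_eq_integral[OF ii]) auto
      also have "\<dots> \<le> ennreal (C + 1)" using N[of "k + N"] by (intro ennreal_leI) auto
      finally show "(\<integral>\<^sup>+x. indicator {x. R \<le> infnorm x \<and> infnorm x \<le> 2 * R} x * ennreal (norm (grad (f (k + N)) x) ^ DIM('a)) \<partial>lborel) \<le> ennreal (C + 1)"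
        by (simp add: sh_def n_def)
    qed
    then have "\<forall>k. \<exists>s. R \<le> s \<and> s \<le> 2 * R \<and> (\<forall>x y. infnorm x = s \<longrightarrow> infnorm y = s \<longrightarrow> \<bar>f (k + N) x - f (k + N) y\<bar> \<le> K)"
      by blast
    from choice[OF this] obtain s where s: "\<forall>k. R \<le> s k \<and> s k \<le> 2 * R \<and> (\<forall>x y. infnorm x = s k \<longrightarrow> infnorm y = s k \<longrightarrow> \<bar>f (k + N) x - f (k + N) y\<bar> \<le> K)"
      by (elim exE)
    obtain e :: 'a where e: "e \<in> Basis" using nonempty_Basis by blast
    define v where "v k = U (k + N) (s k *\<^sub>R e)" for k
    have inf_e: "infnorm (s k *\<^sub>R e) = s k" for k
    proof (rule infnorm_eqI[OF _ e])
      have "s k \<ge> 0" using s R by (meson less_imp_le order_trans)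
      then show "s k *\<^sub>R e \<in> cub (s k)" "\<bar>s k *\<^sub>R e \<bullet> e\<bar> = s k" using e by (auto simp: cub_def inner_Basis)
    qed
    \<comment> \<open>The good cube changes with k. Compactness provides a subsequence along which
      both its half-side and the value \<open>v k\<close> at one boundary point converge; this one
      value controls the whole boundary up to the factor exp K.\<close>
    have "range (\<lambda>k. (s k, v k)) \<subseteq> {R..2 * R} \<times> {m..M}" using s U by (auto simp: v_def)
    then have "bounded (range (\<lambda>k. (s k, v k)))"
      by (rule bounded_subset[rotated]) (auto intro: bounded_Times)
    from bounded_imp_convergent_subsequence[OF this] obtain l r where l: "strict_mono r" "((\<lambda>k. (s k, v k)) \<circ> r) \<longlonglongrightarrow> l"
      by blast
    define v0 where "v0 = snd l"
    have sl: "(\<lambda>k. s (r k)) \<longlonglongrightarrow> fst l" using tendsto_fst[OF l(2)] by (simp add: o_def)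
    have vl: "(\<lambda>k. v (r k)) \<longlonglongrightarrow> v0" using tendsto_snd[OF l(2)] by (simp add: o_def v0_def)
    have v0m: "m \<le> v0" by (rule LIMSEQ_le_const[OF vl]) (use U in \<open>auto simp: v_def\<close>)
    define y0 where "y0 = v0 - m + \<epsilon>"
    have y0: "y0 > 0" using v0m \<epsilon> by (simp add: y0_def)
    have Yl: "(\<lambda>k. v (r k) - m + \<epsilon>) \<longlonglongrightarrow> y0" unfolding y0_def by (intro tendsto_intros vl)
    have rel: "U (r k + N) x - m + \<epsilon> \<le> exp K * (v (r k) - m + \<epsilon>)" "exp (- K) * (v (r k) - m + \<epsilon>) \<le> U (r k + N) x - m + \<epsilon>"
      if "infnorm x = s (r k)" for k x
    proof -
      let ?p = "s (r k) *\<^sub>R e"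
      have "\<bar>f (r k + N) x - f (r k + N) ?p\<bar> \<le> K" using s inf_e that by blast
      then have a: "ln (Y (r k + N) x) \<le> K + ln (Y (r k + N) ?p)" "- K + ln (Y (r k + N) ?p) \<le> ln (Y (r k + N) x)"
        by (auto simp: f_def abs_le_iff)
      have "exp (ln (Y (r k + N) x)) \<le> exp (K + ln (Y (r k + N) ?p))" using a(1) by simp
      then show "U (r k + N) x - m + \<epsilon> \<le> exp K * (v (r k) - m + \<epsilon>)" using Y0 by (simp add: exp_add Y_def v_def)
      have "exp (- K + ln (Y (r k + N) ?p)) \<le> exp (ln (Y (r k + N) x))" using a(2) by simp
      then show "exp (- K) * (v (r k) - m + \<epsilon>) \<le> U (r k + N) x - m + \<epsilon>" using Y0 unfolding exp_add by (simp add: Y_def v_def)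
    qed
    define b where "b = m - \<epsilon> + 2 * exp K * y0"
    define a where "a = m - \<epsilon> + exp (- K) * y0 / 2"
    have ap': "approximates (\<lambda>k. U (r k + N)) S (R0 + 1)"
      by (rule approximates_subseq[OF ap]) (use l(1) in \<open>simp add: strict_mono_def\<close>)
    have sb: "R \<le> s (r k)" "real n * s (r k) \<le> R0" for k
      unfolding R0_def using s by (auto intro!: mult_left_mono)
    have "AE x in lborel. infnorm x < R \<longrightarrow> u x \<le> b"
    proof (rule boundary_upper_bound[OF ap' sl sb])
      have "exp K * y0 < 2 * exp K * y0" using y0 by simp
      then have "\<forall>\<^sub>F k in sequentially. exp K * (v (r k) - m + \<epsilon>) < 2 * exp K * y0"
        by (intro order_tendstoD(2)[OF tendsto_mult[OF tendsto_const Yl]])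
      then show "\<forall>\<^sub>F k in sequentially. \<forall>x. infnorm x = s (r k) \<longrightarrow> U (r k + N) x < b"
      proof eventually_elim
        case (elim k)
        show ?case
        proof (intro allI impI)
          fix x :: 'a assume "infnorm x = s (r k)"
          from rel(1)[OF this] elim show "U (r k + N) x < b" unfolding b_def by linarith
        qed
      qed
    qed simp
    moreover have "AE x in lborel. infnorm x < R \<longrightarrow> a \<le> u x"
    proof -
      interpret neg: weak_solution "\<lambda>x. - u x" "\<lambda>x. - G x" "\<lambda>x. - V x" "\<lambda>x. - B x" a0 a1 b1 "- M" "- m" n
        by (rule minus_solution)
      have "AE x in lborel. infnorm x < R \<longrightarrow> - u x \<le> - a"
      proof (rule neg.boundary_upper_bound[OF _ sl sb])
        have "AE x in lborel. norm x < R0 + 1 \<longrightarrow> (\<lambda>k. - U (r k + N) x) \<longlonglongrightarrow> - u x \<and> (\<lambda>k. grad (\<lambda>x. - U (r k + N) x) x) \<longlonglongrightarrow> - G x \<and>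
           (\<forall>k. norm (grad (\<lambda>x. - U (r k + N) x) x) ^ n \<le> S x)"
          using approximatesD(6)[OF ap'] by eventually_elim (auto simp: grad_minus[OF U(1)] intro: tendsto_minus)
        then show "neg.approximates (\<lambda>k x. - U (r k + N) x) S (R0 + 1)"
          using U S by (simp add: neg.approximates_def smooth_minus)
        have "exp (- K) * y0 / 2 < exp (- K) * y0" using y0 by simp
        then have "\<forall>\<^sub>F k in sequentially. exp (- K) * y0 / 2 < exp (- K) * (v (r k) - m + \<epsilon>)"
          by (intro order_tendstoD(1)[OF tendsto_mult[OF tendsto_const Yl]])
        then show "\<forall>\<^sub>F k in sequentially. \<forall>x. infnorm x = s (r k) \<longrightarrow> - U (r k + N) x < - a"
        proof eventually_elim
          case (elim k)
          show ?case
          proof (intro allI impI)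
            fix x :: 'a assume "infnorm x = s (r k)"
            from rel(2)[OF this] elim show "- U (r k + N) x < - a" unfolding a_def by linarith
          qed
        qed
      qed simp
      then show ?thesis by simp
    qed
    ultimately have "AE x in lborel. infnorm x < R \<longrightarrow> a \<le> u x \<and> u x \<le> b" by eventually_elim auto
    moreover have "b - m + \<epsilon> \<le> Kc * (a - m + \<epsilon>)"
    proof -
      have "exp (- K) * exp (2 * K) = exp K" by (simp flip: exp_add)
      then have "Kc * (a - m + \<epsilon>) = 2 * exp K * y0" by (simp add: Kc_def a_def)
      then show ?thesis by (simp add: b_def)
    qed
    ultimately show "\<exists>a b. (AE x in lborel. infnorm x < R \<longrightarrow> a \<le> u x \<and> u x \<le> b) \<and> b - m + \<epsilon> \<le> Kc * (a - m + \<epsilon>)" by blast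
  qed
qed

lemma liouville:
  assumes inf: "\<And>t. t > m \<Longrightarrow> \<not> (AE x in lborel. t \<le> u x)"
  shows "AE x in lborel. u x = m"
proof -
  obtain Kc where Kc: "Kc > 0" "\<And>R \<epsilon>. R \<ge> 2 \<Longrightarrow> \<epsilon> > 0 \<Longrightarrow>
    \<exists>a b. (AE x in lborel. infnorm x < R \<longrightarrow> a \<le> u x \<and> u x \<le> b) \<and> b - m + \<epsilon> \<le> Kc * (a - m + \<epsilon>)"
    by (rule harnack) blast
  have step: "AE x in lborel. u x \<le> m + 2 * Kc * \<epsilon>" if \<epsilon>: "\<epsilon> > 0" for \<epsilon>
  proof -
    \<comment> \<open>As m + \<open>\<epsilon>\<close> is no essential lower bound of u, it fails to
      be one on some cube, and then on all larger ones. There the lower constant a of the Harnack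
      inequality is below m + \<open>\<epsilon>\<close>. The summand 2 keeps the half-sides at least
      2.\<close>
    have "\<not> (\<forall>j::nat. AE x in lborel. infnorm x < real j + 2 \<longrightarrow> m + \<epsilon> \<le> u x)"
    proof
      assume "\<forall>j::nat. AE x in lborel. infnorm x < real j + 2 \<longrightarrow> m + \<epsilon> \<le> u x"
      then have "AE x in lborel. \<forall>j::nat. infnorm x < real j + 2 \<longrightarrow> m + \<epsilon> \<le> u x" unfolding AE_all_countable .
      then have "AE x in lborel. m + \<epsilon> \<le> u x"
      proof eventually_elim
        case (elim x)
        obtain j :: nat where "infnorm x < real j" using reals_Archimedean2 by blast
        then have "infnorm x < real j + 2" by simp
        then show ?case using elim by blast
      qed
      then show False using inf[of "m + \<epsilon>"] \<epsilon> by simp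
    qed
    then obtain j0 :: nat where j0: "\<not> (AE x in lborel. infnorm x < real j0 + 2 \<longrightarrow> m + \<epsilon> \<le> u x)" by blast
    have "AE x in lborel. infnorm x < real (j + j0) + 2 \<longrightarrow> u x \<le> m + 2 * Kc * \<epsilon>" for j
    proof -
      obtain a b where ab: "AE x in lborel. infnorm x < real (j + j0) + 2 \<longrightarrow> a \<le> u x \<and> u x \<le> b" "b - m + \<epsilon> \<le> Kc * (a - m + \<epsilon>)"
        using Kc(2)[of "real (j + j0) + 2" \<epsilon>] \<epsilon> by auto
      have "a < m + \<epsilon>"
      proof (rule ccontr)
        assume na: "\<not> a < m + \<epsilon>"
        have "AE x in lborel. infnorm x < real j0 + 2 \<longrightarrow> m + \<epsilon> \<le> u x"
          using ab(1) by eventually_elim (use na in auto)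
        then show False using j0 by simp
      qed
      then have "Kc * (a - m + \<epsilon>) \<le> Kc * (2 * \<epsilon>)" using Kc(1) by (intro mult_left_mono) auto
      then have bm: "b \<le> m + 2 * Kc * \<epsilon>" using ab(2) \<epsilon> by (simp add: algebra_simps)
      show ?thesis using ab(1) by eventually_elim (use bm in auto)
    qed
    then have "AE x in lborel. \<forall>j. infnorm x < real (j + j0) + 2 \<longrightarrow> u x \<le> m + 2 * Kc * \<epsilon>" unfolding AE_all_countable by (rule allI)
    then show ?thesis
    proof eventually_elim
      case (elim x)
      obtain j :: nat where "infnorm x < real j" using reals_Archimedean2 by blast
      then have "infnorm x < real (j + j0) + 2" by simp
      then show ?case using elim by blast
    qed
  qed
  have "AE x in lborel. \<forall>i::nat. u x \<le> m + 2 * Kc * (1 / real (Suc i))"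
    unfolding AE_all_countable by (intro allI step) simp
  then show ?thesis
  proof eventually_elim
    case (elim x)
    have "(\<lambda>i. m + 2 * Kc * (1 / real (Suc i))) \<longlonglongrightarrow> m + 2 * Kc * 0"
      by (intro tendsto_intros LIMSEQ_Suc lim_1_over_n)
    then have "u x \<le> m + 2 * Kc * 0" by (rule LIMSEQ_le_const) (use elim in blast)
    then show ?case using ub(1)[of x] by simp
  qed
qed

end

section \<open>From the definitions to the locale of weak solutions\<close>

lemma integral_uminus:
  fixes f :: "'a::euclidean_space \<Rightarrow> 'b::{banach, second_countable_topology}"
  assumes [measurable]: "f \<in> borel_measurable borel"
  shows "(\<integral>x. f (- x) \<partial>lborel) = (\<integral>x. f x \<partial>lborel)"
proof -
  have l: "distr lborel borel (uminus :: 'a \<Rightarrow> 'a) = lborel"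
    by (subst (2) lborel_affine[of "-1" 0]) (auto simp: density_1)
  have "(\<integral>x. f x \<partial>lborel) = (\<integral>x. f x \<partial>(distr lborel borel (uminus :: 'a \<Rightarrow> 'a)))" by (simp add: l)
  also have "\<dots> = (\<integral>x. f (- x) \<partial>lborel)" by (subst integral_distr) auto
  finally show ?thesis by simp
qed

text \<open>The convolution of the constant 1 with f is constant, and its gradient is the
  convolution of 1 with the gradient of f. This stands in for integration by parts.\<close>

lemma integral_grad_zero:
  fixes f :: "'a::euclidean_space \<Rightarrow> real"
  assumes f: "smooth f" and z: "vanishes_outside r f"
  shows "(\<integral>x. grad f x \<bullet> b \<partial>lborel) = 0"
proof -
  have [measurable]: "f \<in> borel_measurable borel" "grad f \<in> borel_measurable borel"
    using smooth_measurable[OF f] smooth_grad_measurable[OF f] .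
  have one: "(\<lambda>_::'a. 1::real) \<in> borel_measurable borel" "\<And>x::'a. \<bar>1::real\<bar> \<le> 1" by auto
  have e: "conv (\<lambda>_. 1) f = (\<lambda>_. \<integral>y. f (- y) \<partial>lborel)"
    unfolding conv_def using integral_translate[of "\<lambda>y. f (- y)" "- _"] by (intro ext) simp
  have "((conv (\<lambda>_. 1) f) has_derivative (\<lambda>h. 0 \<bullet> h)) (at 0)" unfolding e by simp
  then have "grad (conv (\<lambda>_. 1) f) 0 = 0" by (rule grad_eqI)
  then have "0 = conv (\<lambda>_. 1) (\<lambda>x. grad f x \<bullet> b) 0"
    using conv_grad_inner[OF one f z, of 0 b] by simp
  also have "\<dots> = (\<integral>y. grad f (- y) \<bullet> b \<partial>lborel)" by (simp add: conv_def)
  also have "\<dots> = (\<integral>y. grad f y \<bullet> b \<partial>lborel)"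
    using integral_uminus[of "\<lambda>y. grad f y \<bullet> b"] by simp
  finally show ?thesis by simp
qed

lemma grad_mult:
  assumes "smooth f" "smooth g"
  shows "grad (\<lambda>x. f x * g x) x = f x *\<^sub>R grad g x + g x *\<^sub>R grad f x"
  by (rule grad_eqI)
    (rule has_derivative_eq_rhs[OF has_derivative_mult[OF smooth_has_derivative[OF assms(1)] smooth_has_derivative[OF assms(2)]]],
      simp add: fun_eq_iff inner_add_left)

lemma test_function_smooth: "\<psi> \<in> test_functions D \<Longrightarrow> smooth \<psi>"
  by (simp add: test_functions_def smooth_def)

lemma test_function_vanishes:
  assumes "\<psi> \<in> test_functions D"
  obtains r where "vanishes_outside r \<psi>"
proof -
  have "bounded (closure {x. \<psi> x \<noteq> 0})" using assms by (auto simp: test_functions_def compact_imp_bounded)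
  then obtain r where r: "\<And>x. x \<in> closure {x. \<psi> x \<noteq> 0} \<Longrightarrow> norm x \<le> r" unfolding bounded_iff by blast
  have "\<psi> x = 0" if "norm x > r" for x
  proof (rule ccontr)
    assume "\<psi> x \<noteq> 0"
    then have "x \<in> closure {x. \<psi> x \<noteq> 0}" using closure_subset[of "{x. \<psi> x \<noteq> 0}"] by auto
    then show False using r[of x] that by simp
  qed
  then show ?thesis using that[of r] by (simp add: vanishes_outside_def)
qed

lemma test_function_zero:
  assumes \<psi>: "\<psi> \<in> test_functions D" and x: "x \<notin> D"
  shows "\<psi> x = 0" "grad \<psi> x = 0"
proof -
  let ?C = "closure {x. \<psi> x \<noteq> 0}"
  have C: "x \<in> - ?C" using \<psi> x by (auto simp: test_functions_def)
  have z: "\<psi> y = 0" if "y \<in> - ?C" for y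
  proof (rule ccontr)
    assume "\<psi> y \<noteq> 0"
    then have "y \<in> {x. \<psi> x \<noteq> 0}" by simp
    then show False using that closure_subset by (metis ComplD subsetD)
  qed
  show "\<psi> x = 0" using C by (rule z)
  show "grad \<psi> x = 0"
  proof (rule grad_eqI)
    have d: "((\<lambda>x. 0::real) has_derivative (\<lambda>h. 0 \<bullet> h)) (at x)" by simp
    show "(\<psi> has_derivative (\<bullet>) 0) (at x)"
      by (rule has_derivative_transform_within_open[OF d open_Compl[OF closed_closure] C]) (rule z[symmetric])
  qed
qed

lemma smooth_test_function:
  assumes s: "smooth \<phi>" and z: "vanishes_outside r \<phi>" and D: "cball 0 r \<subseteq> D"
  shows "\<phi> \<in> test_functions D"
proof -
  have c: "closure {x. \<phi> x \<noteq> 0} \<subseteq> cball 0 r"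
  proof (rule closure_minimal)
    show "{x. \<phi> x \<noteq> 0} \<subseteq> cball 0 r"
    proof clarify
      fix x assume "\<phi> x \<noteq> 0"
      then have "\<not> norm x > r" using vanishes_outsideD[OF z] by blast
      then show "x \<in> cball 0 r" by simp
    qed
  qed simp
  have "compact (closure {x. \<phi> x \<noteq> 0})"
    unfolding compact_eq_bounded_closed using bounded_subset[OF bounded_cball c] closed_closure by (rule conjI)
  moreover have "closure {x. \<phi> x \<noteq> 0} \<subseteq> D" using c D by (rule subset_trans)
  ultimately show ?thesis using s by (simp add: test_functions_def smooth_def)
qed

lemma borel_lebesgue: "f \<in> borel_measurable borel \<Longrightarrow> f \<in> borel_measurable lebesgue"
  by (rule measurable_completion) simp

lemma set_integral_eq_lborel:
  fixes f :: "'a::euclidean_space \<Rightarrow> 'b::{banach, second_countable_topology}"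
  assumes g: "g \<in> borel_measurable borel" and f: "f \<in> borel_measurable lebesgue"
    and fg: "AE x in lborel. f x = g x" and z: "\<And>x. x \<notin> D \<Longrightarrow> f x = 0"
  shows "(LINT x:D|lebesgue. f x) = (\<integral>x. g x \<partial>lborel)"
proof -
  have "(LINT x:D|lebesgue. f x) = (\<integral>x. f x \<partial>lebesgue)"
    unfolding set_lebesgue_integral_def using z by (intro Bochner_Integration.integral_cong) (auto simp: indicator_def)
  also have "\<dots> = (\<integral>x. g x \<partial>lebesgue)"
    by (rule integral_cong_AE[OF f borel_lebesgue[OF g] AE_completion[OF fg]])
  also have "\<dots> = (\<integral>x. g x \<partial>lborel)" using g by (intro integral_completion) simp
  finally show ?thesis .
qed

text \<open>The weak gradient identity is the vanishing integral of the gradient of a product of two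
  test functions, and the constant sequence approximates. Hence the equation may be tested with
  smooth functions.\<close>

lemma smooth_in_W1p_0:
  fixes \<phi> :: "'a::euclidean_space \<Rightarrow> real"
  assumes D: "open D" "bounded D" and \<phi>: "\<phi> \<in> test_functions D" and p: "p > 0"
  shows "\<phi> \<in> W1p_0 p D" "has_weak_gradient D \<phi> (grad \<phi>)"
proof -
  have s: "smooth \<phi>" by (rule test_function_smooth[OF \<phi>])
  obtain r where z: "vanishes_outside r \<phi>" using test_function_vanishes[OF \<phi>] .
  have m: "\<phi> \<in> borel_measurable borel" "grad \<phi> \<in> borel_measurable borel"
    using smooth_measurable[OF s] smooth_grad_measurable[OF s] .
  obtain R where R: "\<And>x. x \<in> D \<Longrightarrow> norm x \<le> R" using D(2) unfolding bounded_iff by blast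
  have int: "set_integrable lebesgue E f"
    if E: "bounded E" "E \<in> sets borel" and f: "f \<in> borel_measurable borel" "\<And>x. norm (f x) \<le> L" for E L
    and f :: "'a \<Rightarrow> 'c::euclidean_space"
  proof -
    obtain R where R: "\<And>x. x \<in> E \<Longrightarrow> norm x \<le> R" using E(1) unfolding bounded_iff by blast
    have mm: "(\<lambda>x. indicator E x *\<^sub>R f x) \<in> borel_measurable borel" using E f by simp
    have "integrable lborel (\<lambda>x. indicator E x *\<^sub>R f x)"
    proof (rule bounded_support_integrable[where C=L and R=R])
      show "norm (indicator E x *\<^sub>R f x) \<le> L" for x
        using f(2)[of x] order_trans[OF norm_ge_zero f(2)[of x]] by (simp add: indicator_def)
      show "indicator E x *\<^sub>R f x = 0" if "norm x > R" for x using R[of x] that by (auto simp: indicator_def)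
    qed (use mm in simp)
    then show ?thesis unfolding set_integrable_def using mm by (subst integrable_completion) auto
  qed
  obtain L1 where L1: "\<And>x. norm (\<phi> x) \<le> L1" using bounded_support_bound[OF smooth_continuous[OF s] z] by metis
  obtain L2 where L2: "\<And>x. norm (grad \<phi> x) \<le> L2" using bounded_grad[OF s z] by metis
  have Db: "D \<in> sets borel" using D(1) by simp
  have Lp: "f \<in> Lp p D" if f: "f \<in> borel_measurable borel" "\<And>x. norm (f x) \<le> L" for f :: "'a \<Rightarrow> 'c::euclidean_space" and L
    unfolding Lp_def mem_Collect_eq
  proof
    show "set_borel_measurable lebesgue D f" unfolding set_borel_measurable_def
      using f(1) Db by (intro borel_lebesgue) simp
    have "norm (norm (f x) powr p) \<le> L powr p" for x using f(2)[of x] p by (simp add: powr_mono2)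
    then show "set_integrable lebesgue D (\<lambda>x. norm (f x) powr p)"
      using f(1) by (intro int[OF D(2) Db]) auto
  qed
  have loc: "f locally_integrable_on D" if f: "f \<in> borel_measurable borel" "\<And>x. norm (f x) \<le> L" for f :: "'a \<Rightarrow> 'c::euclidean_space" and L
    unfolding locally_integrable_on_def
    by (intro allI impI int[OF _ _ f]) (auto intro: compact_imp_bounded borel_compact)
  show w: "has_weak_gradient D \<phi> (grad \<phi>)"
    unfolding has_weak_gradient_def
  proof (intro conjI ballI loc[OF m(1) L1] loc[OF m(2) L2])
    fix \<psi> and b :: 'a assume \<psi>: "\<psi> \<in> test_functions D" and b: "b \<in> Basis"
    have s': "smooth \<psi>" by (rule test_function_smooth[OF \<psi>])
    have m': "\<psi> \<in> borel_measurable borel" "grad \<psi> \<in> borel_measurable borel"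
      using smooth_measurable[OF s'] smooth_grad_measurable[OF s'] .
    obtain r' where z': "vanishes_outside r' \<psi>" using test_function_vanishes[OF \<psi>] .
    obtain L3 where L3: "\<And>x. norm (\<psi> x) \<le> L3" using bounded_support_bound[OF smooth_continuous[OF s'] z'] by metis
    obtain L4 where L4: "\<And>x. norm (grad \<psi> x) \<le> L4" using bounded_grad[OF s' z'] by metis
    have gz: "vanishes_outside r (grad \<phi>)" by (rule grad_zero_outside[OF z])
    have i1: "integrable lborel (\<lambda>x. \<phi> x * (grad \<psi> x \<bullet> b))"
    proof (rule bounded_support_integrable[where C="L1 * L4" and R=r])
      show "norm (\<phi> x * (grad \<psi> x \<bullet> b)) \<le> L1 * L4" for x
        using L1[of x] L4[of x] Basis_le_norm[OF b, of "grad \<psi> x"] order_trans[OF norm_ge_zero L1[of x]]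
        by (auto simp: abs_mult intro!: mult_mono)
    qed (use m m' vanishes_outsideD[OF z] in auto)
    have i2: "integrable lborel (\<lambda>x. (grad \<phi> x \<bullet> b) * \<psi> x)"
    proof (rule bounded_support_integrable[where C="L2 * L3" and R=r])
      show "norm ((grad \<phi> x \<bullet> b) * \<psi> x) \<le> L2 * L3" for x
        using L2[of x] L3[of x] Basis_le_norm[OF b, of "grad \<phi> x"] order_trans[OF norm_ge_zero L2[of x]]
        by (auto simp: abs_mult intro!: mult_mono)
    qed (use m m' vanishes_outsideD[OF gz] in auto)
    have "(\<integral>x. grad (\<lambda>x. \<phi> x * \<psi> x) x \<bullet> b \<partial>lborel) = 0"
      by (rule integral_grad_zero[OF smooth_mult[OF s s'], of r]) (use z in \<open>auto simp: vanishes_outside_def\<close>)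
    then have "(\<integral>x. \<phi> x * (grad \<psi> x \<bullet> b) + (grad \<phi> x \<bullet> b) * \<psi> x \<partial>lborel) = 0"
      by (simp add: grad_mult[OF s s'] inner_add_left mult.commute)
    then have e: "(\<integral>x. \<phi> x * (grad \<psi> x \<bullet> b) \<partial>lborel) = - (\<integral>x. (grad \<phi> x \<bullet> b) * \<psi> x \<partial>lborel)"
      using i1 i2 by simp
    have "(LINT x:D|lebesgue. \<phi> x * (grad \<psi> x \<bullet> b)) = (\<integral>x. \<phi> x * (grad \<psi> x \<bullet> b) \<partial>lborel)"
      by (rule set_integral_eq_lborel) (use m m' test_function_zero[OF \<psi>] in \<open>auto intro!: borel_lebesgue\<close>)
    moreover have "(LINT x:D|lebesgue. (grad \<phi> x \<bullet> b) * \<psi> x) = (\<integral>x. (grad \<phi> x \<bullet> b) * \<psi> x \<partial>lborel)"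
      by (rule set_integral_eq_lborel) (use m m' test_function_zero[OF \<psi>] in \<open>auto intro!: borel_lebesgue\<close>)
    ultimately show "(LINT x:D|lebesgue. \<phi> x * (grad \<psi> x \<bullet> b)) = - (LINT x:D|lebesgue. (grad \<phi> x \<bullet> b) * \<psi> x)"
      using e by simp
  qed
  show "\<phi> \<in> W1p_0 p D"
    unfolding W1p_0_def mem_Collect_eq
  proof (intro conjI bexI[of _ "grad \<phi>"] exI[of _ "\<lambda>_. \<phi>"])
    show "\<phi> \<in> Lp p D" "grad \<phi> \<in> Lp p D" using Lp[OF m(1) L1] Lp[OF m(2) L2] .
  qed (use w \<phi> in auto)
qed

section \<open>Measurable representatives and the pointwise structure conditions\<close>

lemma borel_representative:
  fixes f :: "'a::euclidean_space \<Rightarrow> 'b::euclidean_space"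
  assumes f: "f \<in> borel_measurable lebesgue"
  obtains g where "g \<in> borel_measurable borel" "AE x in lborel. f x = g x"
proof -
  have "\<forall>b\<in>Basis. \<exists>g. g \<in> borel_measurable borel \<and> (AE x in lborel. f x \<bullet> b = g x)"
  proof
    fix b :: 'b
    have "(\<lambda>x. f x \<bullet> b) \<in> borel_measurable lebesgue" using f by simp
    from completion_ex_borel_measurable_real[OF this] show "\<exists>g. g \<in> borel_measurable borel \<and> (AE x in lborel. f x \<bullet> b = g x)" by auto
  qed
  from bchoice[OF this] obtain g where g: "\<forall>b\<in>Basis. g b \<in> borel_measurable borel \<and> (AE x in lborel. f x \<bullet> b = g b x)"
    by (elim exE)
  show ?thesis
  proof (rule that[of "\<lambda>x. \<Sum>b\<in>Basis. g b x *\<^sub>R b"])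
    show "(\<lambda>x. \<Sum>b\<in>Basis. g b x *\<^sub>R b) \<in> borel_measurable borel"
      using g by (intro borel_measurable_sum borel_measurable_scaleR) auto
    have "AE x in lborel. \<forall>b\<in>Basis. f x \<bullet> b = g b x" using g by (intro AE_finite_allI) auto
    then show "AE x in lborel. f x = (\<Sum>b\<in>Basis. g b x *\<^sub>R b)"
    proof eventually_elim
      case (elim x)
      have "f x = (\<Sum>b\<in>Basis. (f x \<bullet> b) *\<^sub>R b)" by (simp add: euclidean_representation)
      also have "\<dots> = (\<Sum>b\<in>Basis. g b x *\<^sub>R b)" using elim by (intro sum.cong) auto
      finally show ?case .
    qed
  qed
qed

lemma lebesgue_measurable_AE:
  assumes f: "f \<in> borel_measurable lebesgue" and fg: "AE x in lebesgue. f x = g x"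
  shows "g \<in> borel_measurable lebesgue"
proof (rule measurableI)
  fix X assume X: "X \<in> sets (borel :: 'b measure)"
  show "g -` X \<inter> space lebesgue \<in> sets lebesgue"
  proof (rule completion.in_sets_AE[of "f -` X \<inter> space lebesgue"])
    show "AE x in lebesgue. (x \<in> f -` X \<inter> space lebesgue) = (x \<in> g -` X \<inter> space lebesgue)"
      using fg by eventually_elim auto
  qed (use measurable_sets[OF f X] in auto)
qed simp

text \<open>For simple functions in place of (u, G) only finitely many parameter values occur, and
  measurability in x suffices. Continuity in (t, h) passes to the limit, after the null set where it
  fails has been overwritten by 0.\<close>

lemma superposition_measurable:
  fixes F :: "'a::euclidean_space \<Rightarrow> real \<Rightarrow> 'a \<Rightarrow> 'b::euclidean_space"
  assumes F: "caratheodory F" and u: "u \<in> borel_measurable lebesgue" and G: "G \<in> borel_measurable lebesgue"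
  shows "(\<lambda>x. F x (u x) (G x)) \<in> borel_measurable lebesgue"
proof -
  obtain N where N: "{x \<in> space lebesgue. \<not> continuous_on UNIV (\<lambda>(t, h). F x t h)} \<subseteq> N" "N \<in> null_sets lebesgue"
    using F unfolding caratheodory_def eventually_ae_filter by blast
  have Ns: "N \<in> sets lebesgue" using N(2) by auto
  define F' where "F' x p = (if x \<in> N then 0 else F x (fst p) (snd p))" for x p
  have F'm: "(\<lambda>x. F' x p) \<in> borel_measurable lebesgue" for p
    unfolding F'_def using F Ns unfolding caratheodory_def by (intro measurable_If_set) auto
  define w where "w x = (u x, G x)" for x
  have w: "w \<in> borel_measurable lebesgue" unfolding w_def using u G by (rule borel_measurable_Pair)
  obtain s where s: "\<And>i. simple_function lebesgue (s i)" "\<And>x. (\<lambda>i. s i x) \<longlonglongrightarrow> w x"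
    using borel_measurable_implies_sequence_metric[OF w, of "(0, 0)"] by auto
  have "(\<lambda>x. F' x (s i x)) \<in> borel_measurable lebesgue" for i
  proof (rule measurable_compose_countable'[where f="\<lambda>p x. F' x p" and g="s i" and I="range (s i)"])
    have fin: "finite (range (s i))" using simple_functionD(1)[OF s(1)] by simp
    then show "countable (range (s i))" by (rule countable_finite)
    show "s i \<in> measurable lebesgue (count_space (range (s i)))"
      using simple_functionD(2)[OF s(1)] by (intro measurableI) auto
  qed (rule F'm)
  then have "(\<lambda>x. F' x (w x)) \<in> borel_measurable lebesgue"
  proof (rule borel_measurable_LIMSEQ_metric)
    fix x
    show "(\<lambda>i. F' x (s i x)) \<longlonglongrightarrow> F' x (w x)"
    proof (cases "x \<in> N")
      case False
      then have "continuous_on UNIV (\<lambda>(t, h). F x t h)" using N(1) by auto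
      then have "isCont (\<lambda>(t, h). F x t h) (w x)" by (simp add: continuous_on_eq_continuous_at del: split_paired_All)
      from isCont_tendsto_compose[OF this s(2)[of x]] show ?thesis
        using False by (simp add: F'_def case_prod_beta)
    qed (simp add: F'_def)
  qed
  then show ?thesis
  proof (rule lebesgue_measurable_AE)
    have "AE x in lebesgue. x \<notin> N" using N(2) by (rule AE_not_in)
    then show "AE x in lebesgue. F' x (w x) = F x (u x) (G x)" by eventually_elim (simp add: F'_def w_def)
  qed
qed

lemma powr_nat_eq: "t \<ge> 0 \<Longrightarrow> k > 0 \<Longrightarrow> t powr real k = t ^ k" for t :: real
  by (cases "t = 0") (auto simp: powr_realpow)

text \<open>In the hypothesis the exceptional null set may depend on (t, h), which forbids inserting
  u x and G x. A countable dense set of parameters has a common null set, and by continuity the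
  closed conditions extend to all parameters.\<close>

lemma structural_all:
  fixes A :: "'a::euclidean_space \<Rightarrow> real \<Rightarrow> 'a \<Rightarrow> 'a" and B :: "'a \<Rightarrow> real \<Rightarrow> 'a \<Rightarrow> real"
  assumes A: "caratheodory A" and B: "caratheodory B" and n: "n \<ge> 2"
    and str: "structural_assumptions (real n) a0 a1 b1 A B"
  shows "AE x in lebesgue. \<forall>t h. A x t h \<bullet> h \<ge> a0 * norm h ^ n \<and> norm (A x t h) \<le> a1 * norm h ^ (n - 1) \<and>
    \<bar>B x t h\<bar> \<le> decay b1 x * norm h ^ (n - 1)"
proof -
  obtain D :: "(real \<times> 'a) set" where D: "countable D" "\<And>X. open X \<Longrightarrow> X \<noteq> {} \<Longrightarrow> \<exists>d\<in>D. d \<in> X"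
    using countable_dense_setE by blast
  \<comment> \<open>Both exponents are positive because n >= 2, so real and natural powers agree
    also at h = 0.\<close>
  have pw: "norm h powr real n = norm h ^ n" "norm h powr (real n - 1) = norm h ^ (n - 1)" for h :: 'a
    using n powr_nat_eq[of "norm h" n] powr_nat_eq[of "norm h" "n - 1"] by auto
  define P where "P x d \<longleftrightarrow> A x (fst d) (snd d) \<bullet> snd d \<ge> a0 * norm (snd d) ^ n \<and> norm (A x (fst d) (snd d)) \<le> a1 * norm (snd d) ^ (n - 1) \<and>
    \<bar>B x (fst d) (snd d)\<bar> \<le> decay b1 x * norm (snd d) ^ (n - 1)" for x d
  have "AE x in lebesgue. P x d" for d
    using str unfolding structural_assumptions_def pw P_def by blast
  then have "AE x in lebesgue. \<forall>d\<in>D. P x d" using D(1) by (simp add: AE_ball_countable)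
  moreover have "AE x in lebesgue. continuous_on UNIV (\<lambda>(t, h). A x t h)" "AE x in lebesgue. continuous_on UNIV (\<lambda>(t, h). B x t h)"
    using A B by (auto simp: caratheodory_def)
  ultimately show ?thesis
  proof eventually_elim
    case (elim x)
    have cA: "continuous_on UNIV (\<lambda>d. A x (fst d) (snd d))" and cB: "continuous_on UNIV (\<lambda>d. B x (fst d) (snd d))"
      using elim(2,3) by (simp_all add: case_prod_beta)
    have "closed {d. P x d}"
      unfolding P_def by (intro closed_Collect_conj closed_Collect_le continuous_intros cA cB)
    then have "open (- {d. P x d})" by (simp add: open_Compl)
    then have "- {d. P x d} = {}" using D(2)[of "- {d. P x d}"] elim(1) by blast
    then have "P x (t, h)" for t h by blast
    then show ?case by (simp add: P_def)
  qed
qed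

lemma lebesgue_measurable_of_balls:
  fixes f :: "'a::euclidean_space \<Rightarrow> 'b::euclidean_space"
  assumes "\<And>k::nat. (\<lambda>x. indicator (ball 0 (real k)) x *\<^sub>R f x) \<in> borel_measurable lebesgue"
  shows "f \<in> borel_measurable lebesgue"
proof (rule borel_measurable_LIMSEQ_metric[OF assms])
  fix x :: 'a
  obtain N :: nat where N: "norm x < real N" using reals_Archimedean2 by blast
  have "\<forall>\<^sub>F k in sequentially. f x = indicator (ball 0 (real k)) x *\<^sub>R f x"
    unfolding eventually_sequentially by (intro exI[of _ N]) (use N in auto)
  then show "(\<lambda>k. indicator (ball 0 (real k)) x *\<^sub>R f x) \<longlonglongrightarrow> f x"
    by (rule Lim_transform_eventually[OF tendsto_const])
qed

lemma relatively_compact_ball: "relatively_compact_open_in UNIV (ball (0::'a::euclidean_space) r)"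
  by (simp add: relatively_compact_open_in_def compact_eq_bounded_closed bounded_closure)

text \<open>The supremum of all essential lower bounds is one itself, being approached by countably
  many. It is finite because the whole space is not null.\<close>

lemma essential_infimum:
  fixes u :: "'a::euclidean_space \<Rightarrow> real"
  assumes "AE x in lborel. \<bar>u x\<bar> \<le> M"
  shows "\<exists>m. (AE x in lborel. m \<le> u x) \<and> (\<forall>t>m. \<not> (AE x in lborel. t \<le> u x))"
proof -
  define X where "X = {t. AE x in lborel. t \<le> u x}"
  have "- M \<in> X" unfolding X_def mem_Collect_eq using assms by eventually_elim auto
  have ub: "t \<le> M" if "t \<in> X" for t
  proof (rule ccontr)
    assume t: "\<not> t \<le> M"
    have "AE x in lborel. t \<le> u x" using that by (simp add: X_def)
    then have "AE x in (lborel :: 'a measure). False"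
      using assms by eventually_elim (use t in auto)
    then show False using AE_iff_measurable[of UNIV "lborel :: 'a measure" "\<lambda>_. False"] by simp
  qed
  then have bdd: "bdd_above X" by (intro bdd_aboveI[of _ M])
  show ?thesis
  proof (rule exI[of _ "Sup X"], intro conjI allI impI)
    have "AE x in lborel. \<forall>k::nat. Sup X - 1 / real (Suc k) \<le> u x"
      unfolding AE_all_countable
    proof
      fix k :: nat
      have "Sup X - 1 / real (Suc k) < Sup X" by simp
      then obtain t where "t \<in> X" "Sup X - 1 / real (Suc k) < t" using less_cSupD \<open>- M \<in> X\<close> by blast
      then show "AE x in lborel. Sup X - 1 / real (Suc k) \<le> u x" unfolding X_def mem_Collect_eq by (auto elim!: eventually_mono)
    qed
    then show "AE x in lborel. Sup X \<le> u x"
    proof eventually_elim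
      case (elim x)
      have "(\<lambda>k. Sup X - 1 / real (Suc k)) \<longlonglongrightarrow> Sup X - 0" by (intro tendsto_intros LIMSEQ_Suc lim_1_over_n)
      then have "Sup X - 0 \<le> u x" by (rule LIMSEQ_le_const2) (use elim in blast)
      then show ?case by simp
    qed
    show "\<not> (AE x in lborel. t \<le> u x)" if "t > Sup X" for t
      using cSup_upper[OF _ bdd, of t] that by (auto simp: X_def)
  qed
qed

text \<open>All data are replaced by Borel functions equal to them a.e., and u by a representative
  with bounds at every point, as the locale requires. Its lower bound is the essential infimum, so
  that \<open>liouville\<close> applies.\<close>

lemma bounded_solution_constant:
  fixes A :: "'a::euclidean_space \<Rightarrow> real \<Rightarrow> 'a \<Rightarrow> 'a" and B :: "'a \<Rightarrow> real \<Rightarrow> 'a \<Rightarrow> real" and u :: "'a \<Rightarrow> real"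
  assumes n: "n = DIM('a)" "n \<ge> 2" and a0: "0 < a0" and b1: "0 < b1"
    and cA: "caratheodory A" and cB: "caratheodory B"
    and str: "structural_assumptions (real n) a0 a1 b1 A B"
    and sol: "is_solution (real n) A B u" and bdd: "AE x in lebesgue. \<bar>u x\<bar> \<le> M"
  shows "\<exists>c. AE x in lebesgue. u x = c"
proof -
  have p: "real n > 0" using n by simp
  obtain G where uL: "u \<in> Lp_loc (real n) UNIV" and GL: "G \<in> Lp_loc (real n) UNIV" and wG: "has_weak_gradient UNIV u G"
    using sol by (auto simp: is_solution_def W1p_loc_def)
  have um: "u \<in> borel_measurable lebesgue" and Gm: "G \<in> borel_measurable lebesgue"
  proof -
    have "v \<in> borel_measurable lebesgue" if "v \<in> Lp_loc (real n) UNIV" for v :: "'a \<Rightarrow> 'c::euclidean_space"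
    proof (rule lebesgue_measurable_of_balls)
      fix k :: nat
      have "v \<in> Lp (real n) (ball 0 (real k))" using that relatively_compact_ball[of "real k", where 'a='a] by (simp add: Lp_loc_def)
      then show "(\<lambda>x. indicator (ball 0 (real k)) x *\<^sub>R v x) \<in> borel_measurable lebesgue"
        by (simp add: Lp_def set_borel_measurable_def)
    qed
    from this[OF uL] this[OF GL] show "u \<in> borel_measurable lebesgue" "G \<in> borel_measurable lebesgue" .
  qed
  note VAm = superposition_measurable[OF cA um Gm] and VBm = superposition_measurable[OF cB um Gm]
  obtain G' where G': "G' \<in> borel_measurable borel" "AE x in lborel. G x = G' x" by (rule borel_representative[OF Gm])
  obtain V where V: "V \<in> borel_measurable borel" "AE x in lborel. A x (u x) (G x) = V x" by (rule borel_representative[OF VAm])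
  obtain B' where B': "B' \<in> borel_measurable borel" "AE x in lborel. B x (u x) (G x) = B' x" by (rule borel_representative[OF VBm])
  obtain u' where u': "u' \<in> borel_measurable borel" "AE x in lborel. u x = u' x" by (rule borel_representative[OF um])
  have bdd': "AE x in lborel. \<bar>u' x\<bar> \<le> M"
    using AE_lborel_of_lebesgue[OF bdd] u'(2) by eventually_elim simp
  from essential_infimum[OF bdd'] obtain m
    where "(AE x in lborel. m \<le> u' x) \<and> (\<forall>t>m. \<not> (AE x in lborel. t \<le> u' x))" by (elim exE)
  then have m: "AE x in lborel. m \<le> u' x" "\<And>t. t > m \<Longrightarrow> \<not> (AE x in lborel. t \<le> u' x)" by simp_all
  \<comment> \<open>Clipping changes \<open>u'\<close> only on a null set. The outer
    \<open>max\<close> makes m a lower bound everywhere, and \<open>max m M\<close> is then an upper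
    bound whichever of m and M is larger.\<close>
  define w where "w x = max m (min (max m M) (u' x))" for x
  have wm: "w \<in> borel_measurable borel" unfolding w_def using u'(1) by measurable
  have uw: "AE x in lborel. u x = w x" and u'w: "AE x in lborel. u' x = w x"
    using u'(2) bdd' m(1) by (eventually_elim, auto simp: w_def)+
  have Gi: "integrable lborel (\<lambda>x. indicator (cball 0 r) x * norm (G' x) ^ n)" for r
  proof -
    \<comment> \<open>Local integrability is available on relatively compact open sets only; this
      ball contains the closed ball of radius r.\<close>
    let ?D = "ball (0::'a) (\<bar>r\<bar> + 1)"
    have "set_integrable lebesgue ?D (\<lambda>x. norm (G x) powr real n)"
      using GL relatively_compact_ball[of "\<bar>r\<bar> + 1", where 'a='a] unfolding Lp_loc_def Lp_def by blast
    then have i: "integrable lebesgue (\<lambda>x. indicator ?D x * norm (G x) powr real n)"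
      by (simp add: set_integrable_def)
    have mm: "(\<lambda>x. indicator ?D x * norm (G' x) ^ n) \<in> borel_measurable borel"
    proof -
      note [measurable] = G'(1)
      have [measurable]: "?D \<in> sets borel" by simp
      show ?thesis by measurable
    qed
    have "integrable lebesgue (\<lambda>x. indicator ?D x * norm (G' x) ^ n)"
    proof (rule integrable_cong_AE_imp[OF i borel_lebesgue[OF mm]])
      show "AE x in lebesgue. indicator ?D x * norm (G x) powr real n = indicator ?D x * norm (G' x) ^ n"
        using AE_completion[OF G'(2)] by eventually_elim (use n in \<open>simp add: powr_nat_eq\<close>)
    qed
    then have i2: "integrable lborel (\<lambda>x. indicator ?D x * norm (G' x) ^ n)"
      using mm by (subst (asm) integrable_completion) auto
    show ?thesis
      by (rule Bochner_Integration.integrable_bound[OF i2]) (use G'(1) in \<open>auto simp: indicator_def intro!: AE_I2\<close>)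
  qed
  interpret weak_solution w G' V B' a0 a1 b1 m "max m M" n
  proof
    show "AE x in lborel. a0 * norm (G' x) ^ n \<le> V x \<bullet> G' x \<and> norm (V x) \<le> a1 * norm (G' x) ^ (n - 1) \<and> \<bar>B' x\<bar> \<le> decay b1 x * norm (G' x) ^ (n - 1)"
      using AE_lborel_of_lebesgue[OF structural_all[OF cA cB n(2) str]] G'(2) V(2) B'(2)
    proof eventually_elim
      case (elim x)
      have "a0 * norm (G x) ^ n \<le> A x (u x) (G x) \<bullet> G x \<and> norm (A x (u x) (G x)) \<le> a1 * norm (G x) ^ (n - 1) \<and>
        \<bar>B x (u x) (G x)\<bar> \<le> decay b1 x * norm (G x) ^ (n - 1)" using elim(1) by blast
      from this[unfolded elim(3,4), unfolded elim(2)] show ?case .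
    qed
  next
    fix \<phi> :: "'a \<Rightarrow> real" and r :: real and b :: 'a
    assume s: "smooth \<phi>" and z: "vanishes_outside r \<phi>" and b: "b \<in> Basis"
    have m': "\<phi> \<in> borel_measurable borel" "grad \<phi> \<in> borel_measurable borel"
      using smooth_measurable[OF s] smooth_grad_measurable[OF s] .
    have "\<phi> \<in> test_functions UNIV" by (rule smooth_test_function[OF s z]) simp
    then have e: "(LINT x:UNIV|lebesgue. u x * (grad \<phi> x \<bullet> b)) = - (LINT x:UNIV|lebesgue. (G x \<bullet> b) * \<phi> x)"
      using wG b unfolding has_weak_gradient_def by blast
    have "(LINT x:UNIV|lebesgue. u x * (grad \<phi> x \<bullet> b)) = (\<integral>x. w x * (grad \<phi> x \<bullet> b) \<partial>lborel)"
    proof (rule set_integral_eq_lborel)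
      show "AE x in lborel. u x * (grad \<phi> x \<bullet> b) = w x * (grad \<phi> x \<bullet> b)" using uw by eventually_elim simp
    qed (use wm um G'(1) Gm m' borel_lebesgue[OF m'(1)] borel_lebesgue[OF m'(2)] in
        \<open>auto intro!: borel_measurable_times borel_measurable_inner borel_measurable_const\<close>)
    moreover have "(LINT x:UNIV|lebesgue. (G x \<bullet> b) * \<phi> x) = (\<integral>x. (G' x \<bullet> b) * \<phi> x \<partial>lborel)"
    proof (rule set_integral_eq_lborel)
      show "AE x in lborel. (G x \<bullet> b) * \<phi> x = (G' x \<bullet> b) * \<phi> x" using G'(2) by eventually_elim simp
    qed (use wm um G'(1) Gm m' borel_lebesgue[OF m'(1)] borel_lebesgue[OF m'(2)] in
        \<open>auto intro!: borel_measurable_times borel_measurable_inner borel_measurable_const\<close>)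
    ultimately show "(\<integral>x. w x * (grad \<phi> x \<bullet> b) \<partial>lborel) = - (\<integral>x. (G' x \<bullet> b) * \<phi> x \<partial>lborel)" using e by simp
  next
    fix \<phi> :: "'a \<Rightarrow> real" and r :: real
    assume s: "smooth \<phi>" and z: "vanishes_outside r \<phi>"
    let ?D = "ball (0::'a) (\<bar>r\<bar> + 1)"
    have m': "\<phi> \<in> borel_measurable borel" "grad \<phi> \<in> borel_measurable borel"
      using smooth_measurable[OF s] smooth_grad_measurable[OF s] .
    have t: "\<phi> \<in> test_functions ?D" by (rule smooth_test_function[OF s z]) auto
    have "\<phi> \<in> W1p_0 (real n) ?D" "has_weak_gradient ?D \<phi> (grad \<phi>)"
      by (rule smooth_in_W1p_0[OF open_ball bounded_ball t p])+
    then have e: "(LINT x:?D|lebesgue. A x (u x) (G x) \<bullet> grad \<phi> x) + (LINT x:?D|lebesgue. B x (u x) (G x) * \<phi> x) = 0"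
      using sol wG relatively_compact_ball[of "\<bar>r\<bar> + 1", where 'a='a] unfolding is_solution_def by blast
    have "(LINT x:?D|lebesgue. A x (u x) (G x) \<bullet> grad \<phi> x) = (\<integral>x. V x \<bullet> grad \<phi> x \<partial>lborel)"
    proof (rule set_integral_eq_lborel)
      show "AE x in lborel. A x (u x) (G x) \<bullet> grad \<phi> x = V x \<bullet> grad \<phi> x" using V(2) by eventually_elim simp
      show "A x (u x) (G x) \<bullet> grad \<phi> x = 0" if "x \<notin> ?D" for x using test_function_zero[OF t that] by simp
    qed (use V(1) VAm B'(1) VBm m' borel_lebesgue[OF m'(1)] borel_lebesgue[OF m'(2)] in
        \<open>auto intro!: borel_measurable_times borel_measurable_inner borel_measurable_const\<close>)
    moreover have "(LINT x:?D|lebesgue. B x (u x) (G x) * \<phi> x) = (\<integral>x. B' x * \<phi> x \<partial>lborel)"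
    proof (rule set_integral_eq_lborel)
      show "AE x in lborel. B x (u x) (G x) * \<phi> x = B' x * \<phi> x" using B'(2) by eventually_elim simp
      show "B x (u x) (G x) * \<phi> x = 0" if "x \<notin> ?D" for x using test_function_zero[OF t that] by simp
    qed (use V(1) VAm B'(1) VBm m' borel_lebesgue[OF m'(1)] borel_lebesgue[OF m'(2)] in
        \<open>auto intro!: borel_measurable_times borel_measurable_inner borel_measurable_const\<close>)
    ultimately show "(\<integral>x. V x \<bullet> grad \<phi> x \<partial>lborel) + (\<integral>x. B' x * \<phi> x \<partial>lborel) = 0" using e by simp
  qed (use n a0 b1 wm G'(1) V(1) B'(1) Gi in \<open>auto simp: w_def\<close>)
  have "AE x in lborel. w x = m"
  proof (rule liouville)
    fix t assume t: "t > m"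
    show "\<not> (AE x in lborel. t \<le> w x)"
    proof
      assume "AE x in lborel. t \<le> w x"
      then have "AE x in lborel. t \<le> u' x" using u'w by eventually_elim simp
      then show False using m(2)[OF t] by simp
    qed
  qed
  then have "AE x in lborel. u x = m" using uw by eventually_elim simp
  then show ?thesis using AE_completion by blast
qed

theorem theorem5p7:
  fixes A :: "real ^ 'n \<Rightarrow> real \<Rightarrow> real ^ 'n \<Rightarrow> real ^ 'n"
    and B :: "real ^ 'n \<Rightarrow> real \<Rightarrow> real ^ 'n \<Rightarrow> real"
    and u :: "real ^ 'n \<Rightarrow> real"
    and a\<^sub>0 a\<^sub>1 b\<^sub>1 :: real
  assumes "CARD('n) \<ge> 2"
    and "0 < a\<^sub>0" and "a\<^sub>0 \<le> a\<^sub>1" and "0 < b\<^sub>1"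
    and "caratheodory A" and "caratheodory B"
    and "structural_assumptions (real CARD('n)) a\<^sub>0 a\<^sub>1 b\<^sub>1 A B"
    and "is_solution (real CARD('n)) A B u"
    and "\<exists>M. AE x in lebesgue. \<bar>u x\<bar> \<le> M"
  shows "\<exists>c. AE x in lebesgue. u x = c"
proof -
  obtain M where "AE x in lebesgue. \<bar>u x\<bar> \<le> M" using assms(9) by blast
  then show ?thesis
    using bounded_solution_constant[of "CARD('n)" a\<^sub>0 b\<^sub>1 A B a\<^sub>1 u M] assms by simp
qed

end
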